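(* Let $n=2$ or $n=4$. Then for every positive integer $r\ge n/2$ and every prime $p\ge 5$ we have $$\sum_{\substack{i_1+\cdots+i_n=p^r\\ i_1,\dots,i_n\in \mathfrak{P}_p}} \frac{1}{i_1i_2\cdots i_n} \equiv -\frac{n!}{n+1}\, p^{r} B_{p-n-1} \pmod{p^{r+1}}.$$
   Context: For a prime $p$, $\mathfrak{P}_p$ denotes the set of positive integers which are prime to $p$. The sum runs over ordered $n$-tuples. $B_j$ is the $j$-th Bernoulli number, defined by $\frac{x}{e^x-1}=\sum_{j=0}^\infty \frac{B_j}{j!}x^j$. For rational numbers $a,b$, $a\equiv b \pmod{p^k}$ means $a-b\in p^k\mathbb{Z}_{(p)}$, where $\mathbb{Z}_{(p)}$ is the ring of rationals whose denominators are prime to $p$. *)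

theory Defs
  imports Complex_Main "HOL-Computational_Algebra.Computational_Algebra"
begin

(* The quotient is exact: fps_X and fps_exp 1 - 1 both have subdegree 1,
   see bernoulli_gf below. In this convention B_1 = -1/2. *)
definition bernoulli :: "nat \<Rightarrow> rat" where
  "bernoulli j = fact j * fps_nth (fps_X / (fps_exp 1 - 1)) j"

definition prime_to :: "nat \<Rightarrow> nat set" where
  "prime_to p = {i. i > 0 \<and> coprime i p}"

(* Ordered n-tuples are lists of length n. *)
definition tuples :: "nat \<Rightarrow> nat \<Rightarrow> nat \<Rightarrow> nat list set" where
  "tuples p n m = {xs. length xs = n \<and> set xs \<subseteq> prime_to p \<and> sum_list xs = m}"

definition Z_loc :: "nat \<Rightarrow> rat set" where
  "Z_loc p = {q. coprime (snd (quotient_of q)) (int p)}"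

definition rat_cong :: "rat \<Rightarrow> rat \<Rightarrow> nat \<Rightarrow> nat \<Rightarrow> bool" where
  "rat_cong a b p k \<longleftrightarrow> (\<exists>z \<in> Z_loc p. a - b = of_nat (p ^ k) * z)"

lemma bernoulli_gf:
  "Abs_fps (\<lambda>j. bernoulli j / fact j) * (fps_exp 1 - 1) = fps_X"
proof -
  have nz: "fps_nth (fps_exp 1 - 1 :: rat fps) 1 \<noteq> 0" by simp
  hence nz0: "(fps_exp 1 - 1 :: rat fps) \<noteq> 0" by (metis fps_zero_nth)
  have "subdegree (fps_exp 1 - 1 :: rat fps) \<le> subdegree (fps_X :: rat fps)"
    using subdegree_leI[OF nz] by simp
  hence "(fps_exp 1 - 1 :: rat fps) dvd fps_X"
    using nz0 by (simp add: fps_dvd_iff)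
  moreover have "Abs_fps (\<lambda>j. bernoulli j / fact j) = fps_X / (fps_exp 1 - 1)"
    by (rule fps_ext) (simp add: bernoulli_def)
  ultimately show ?thesis by simp
qed

lemma finite_tuples: "finite (tuples p n m)"
proof (rule finite_subset)
  show "tuples p n m \<subseteq> {xs. set xs \<subseteq> {..m} \<and> length xs = n}"
    using member_le_sum_list by (fastforce simp: tuples_def)
  show "finite {xs. set xs \<subseteq> {..m} \<and> length xs = n}"
    by (rule finite_lists_length_eq) simp
qed

end

theory Submission
  imports Defs "HOL-Number_Theory.Residues"
begin

text \<open>
Write \<open>H k q\<close> for the sum of \<open>1/a^k\<close> over the units \<open>a < q\<close>. The substitution
\<open>u \<mapsto> 2 u mod p\<close>, that is \<open>2 u - p\<close> for \<open>u > p/2\<close>, gives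
\<open>(2^k - 1) H k p \<equiv> (k/2) p \<Phi>\<close> modulo \<open>p^2\<close>, where \<open>\<Phi>\<close> is the sum of \<open>1/u^(k+1)\<close> over
\<open>p/2 < u < p\<close>. The same computation for the exponent \<open>p - 1 - k\<close> and Faulhaber's formula
express \<open>\<Phi>\<close> by \<open>B\<^bsub>p-1-k\<^esub>\<close>. For pairs, the sum is \<open>- H 2 (p^r)\<close> modulo \<open>p^(r+1)\<close>, and
\<open>H 2 (p q) \<equiv> p H 2 q\<close>.

For quadruples and \<open>q = p^r\<close>, let \<open>S m q\<close> and \<open>Q m q\<close> be the sums of \<open>1/(abcd)\<close> and \<open>1/(a^2 bcd)\<close> over
the units \<open>a, b, c, d < q\<close> with sum \<open>m q\<close>, \<open>1 \<le> m \<le> 3\<close>, and let \<open>U q = S 1 q + S 2 q + S 3 q\<close>.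
Splitting each unit below \<open>p q\<close> as \<open>a + q x\<close> with \<open>x < p\<close> and using the reflection \<open>a \<mapsto> q - a\<close>,
\<open>S 1 (p q) \<equiv> p S 1 q + p (p^2 - 1)/6 U q + 4/3 p q Q 1 q\<close> modulo \<open>p^(r+2)\<close> for \<open>r \<ge> 2\<close>, and for \<open>r = 1\<close>
if \<open>p \<ge> 7\<close>. For \<open>r \<ge> 2\<close> the last two terms vanish. For \<open>r = 1\<close> they are multiples of \<open>H 4 p\<close>: the
substitution \<open>u \<mapsto> 2 u mod p\<close> reduces \<open>U p\<close> and \<open>Q 1 p\<close> to convolutions of inverse powers modulo \<open>p\<close>,
which partial fractions evaluate. Finally \<open>S 1 p\<close> is \<open>24/p\<close> times an elementary symmetric
polynomial of \<open>1, 1/2, \<dots>, 1/(p-1)\<close>, hence \<open>- 12 H 4 p\<close>. For \<open>p = 5\<close>, where \<open>B\<^sub>0 / 5\<close> is not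
integral, \<open>S 1 25\<close> is computed modulo \<open>125\<close>.
\<close>

section \<open>Integrality and divisibility by powers of \<open>p\<close>\<close>

text \<open>The reduced denominator divides the denominator of every other representation, so one
  representation with denominator prime to \<open>p\<close> suffices. Closure under sums and
  products then needs no reduced fractions.\<close>

lemma Z_loc_iff: "q \<in> Z_loc p \<longleftrightarrow> (\<exists>a b. coprime b (int p) \<and> b \<noteq> 0 \<and> q = of_int a / of_int b)"
proof
  assume "q \<in> Z_loc p"
  obtain a b where ab: "quotient_of q = (a, b)" by fastforce
  have "coprime b (int p)" using \<open>q \<in> Z_loc p\<close> ab by (simp add: Z_loc_def)
  with quotient_of_div[OF ab] quotient_of_denom_pos[OF ab]
  show "\<exists>a b. coprime b (int p) \<and> b \<noteq> 0 \<and> q = of_int a / of_int b"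
    by (metis less_irrefl)
next
  assume "\<exists>a b. coprime b (int p) \<and> b \<noteq> 0 \<and> q = of_int a / of_int b"
  then obtain a b where ab: "coprime b (int p)" "b \<noteq> 0" "q = of_int a / of_int b" by blast
  obtain c d where cd: "quotient_of q = (c, d)" by fastforce
  have d: "d > 0" "coprime c d" "q = of_int c / of_int d"
    using quotient_of_denom_pos[OF cd] quotient_of_coprime[OF cd] quotient_of_div[OF cd] by auto
  have "of_int (c * b) = (of_int (a * d) :: rat)"
    using ab d by (auto simp: field_simps)
  hence "c * b = a * d" by (simp only: of_int_eq_iff)
  hence "d dvd c * b" by (metis dvd_triv_right)
  hence "d dvd b" using coprime_dvd_mult_right_iff[of d c b] d(2) by (simp add: coprime_commute)
  hence "coprime d (int p)" using coprime_divisors[OF _ dvd_refl ab(1)] by blast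
  thus "q \<in> Z_loc p" by (simp add: Z_loc_def cd)
qed

locale prime_ge5 =
  fixes p :: nat
  assumes prime_p: "prime p" and p_ge5: "p \<ge> 5"
begin

text \<open>The ideal p^k Z_(p), with \<open>J 0\<close> the ring itself. Congruences are stated as
  membership of a difference, so that integrality and divisibility share one set of closure
  rules.\<close>

definition J :: "nat \<Rightarrow> rat set" where
  "J k = {q. rat_cong q 0 p k}"

lemma p_pos: "p > 0" "(of_nat p :: rat) \<noteq> 0"
  using p_ge5 by auto

lemma Z_loc_add: "x \<in> Z_loc p \<Longrightarrow> y \<in> Z_loc p \<Longrightarrow> x + y \<in> Z_loc p"
proof -
  assume "x \<in> Z_loc p" "y \<in> Z_loc p"
  then obtain a b c d where *: "coprime b (int p)" "b \<noteq> 0" "x = of_int a / of_int b"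
     "coprime d (int p)" "d \<noteq> 0" "y = of_int c / of_int d" unfolding Z_loc_iff by blast
  have "x + y = of_int (a * d + c * b) / of_int (b * d)" using * by (simp add: field_simps)
  moreover have "coprime (b * d) (int p)" using * by simp
  ultimately show ?thesis unfolding Z_loc_iff using * by (metis mult_eq_0_iff)
qed

lemma Z_loc_mult: "x \<in> Z_loc p \<Longrightarrow> y \<in> Z_loc p \<Longrightarrow> x * y \<in> Z_loc p"
proof -
  assume "x \<in> Z_loc p" "y \<in> Z_loc p"
  then obtain a b c d where *: "coprime b (int p)" "b \<noteq> 0" "x = of_int a / of_int b"
     "coprime d (int p)" "d \<noteq> 0" "y = of_int c / of_int d" unfolding Z_loc_iff by blast
  have "x * y = of_int (a * c) / of_int (b * d)" using * by (simp add: field_simps)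
  moreover have "coprime (b * d) (int p)" using * by simp
  ultimately show ?thesis unfolding Z_loc_iff using * by (metis mult_eq_0_iff)
qed

lemma Z_loc_of_int: "of_int a \<in> Z_loc p"
  unfolding Z_loc_iff by (rule exI[of _ a], rule exI[of _ 1]) simp

lemma J_iff: "x \<in> J k \<longleftrightarrow> (\<exists>z\<in>Z_loc p. x = of_nat p ^ k * z)"
  by (simp add: J_def rat_cong_def)

lemma rat_cong_iff_J: "rat_cong x y p k \<longleftrightarrow> x - y \<in> J k"
  by (simp add: J_def rat_cong_def)

lemma J_add [intro]: "x \<in> J k \<Longrightarrow> y \<in> J k \<Longrightarrow> x + y \<in> J k"
  unfolding J_iff by (metis Z_loc_add distrib_left)

lemma J_mult: "x \<in> J i \<Longrightarrow> y \<in> J j \<Longrightarrow> x * y \<in> J (i + j)"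
  unfolding J_iff power_add using Z_loc_mult
  by (smt (verit, ccfv_threshold) mult.assoc mult.left_commute)

lemma J_of_int [simp]: "of_int a \<in> J 0"
  by (simp add: J_iff Z_loc_of_int)

lemma J_of_nat [simp]: "of_nat a \<in> J 0"
  using J_of_int[of "int a"] by simp

lemma J_numeral [simp]: "numeral a \<in> J 0"
  using J_of_nat[of "numeral a"] by (simp only: of_nat_numeral)

lemma J_1 [simp]: "1 \<in> J 0"
  using J_of_nat[of 1] by simp

lemma J_0 [simp]: "0 \<in> J k"
  unfolding J_iff using Z_loc_of_int[of 0] by auto

lemma J_mult_left: "z \<in> J 0 \<Longrightarrow> x \<in> J k \<Longrightarrow> z * x \<in> J k"
  using J_mult[of z 0 x k] by simp

lemma J_mult_right: "z \<in> J 0 \<Longrightarrow> x \<in> J k \<Longrightarrow> x * z \<in> J k"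
  using J_mult[of x k z 0] by simp

lemma J_uminus: "x \<in> J k \<Longrightarrow> - x \<in> J k"
  using J_mult_left[of "of_int (- 1)" x k] J_of_int[of "- 1"] by simp

lemma J_uminus_iff [simp]: "- x \<in> J k \<longleftrightarrow> x \<in> J k"
  using J_uminus[of x k] J_uminus[of "-x" k] by auto

lemma J_diff [intro]: "x \<in> J k \<Longrightarrow> y \<in> J k \<Longrightarrow> x - y \<in> J k"
  using J_add[of x k "-y"] by simp

lemma J_trans: "x - y \<in> J k \<Longrightarrow> y - z \<in> J k \<Longrightarrow> x - z \<in> J k"
  using J_add[of "x - y" k "y - z"] by simp

lemma J_sum: "(\<And>i. i \<in> X \<Longrightarrow> g i \<in> J k) \<Longrightarrow> sum g X \<in> J k"
  by (induction X rule: infinite_finite_induct) auto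

lemma J_sum_cong: "(\<And>i. i \<in> X \<Longrightarrow> g i - h i \<in> J k) \<Longrightarrow> sum g X - sum h X \<in> J k"
  unfolding sum_subtractf[symmetric] by (rule J_sum)

lemma J_mult_cong:
  "x - x' \<in> J k \<Longrightarrow> y - y' \<in> J k \<Longrightarrow> x \<in> J 0 \<Longrightarrow> y' \<in> J 0 \<Longrightarrow> x * y - x' * y' \<in> J k"
proof -
  assume *: "x - x' \<in> J k" "y - y' \<in> J k" "x \<in> J 0" "y' \<in> J 0"
  have "x * y - x' * y' = x * (y - y') + y' * (x - x')" by (simp add: algebra_simps)
  also have "\<dots> \<in> J k" by (intro J_add J_mult_left[OF *(3,2)] J_mult_left[OF *(4,1)])
  finally show ?thesis .
qed

lemma J_p_power: "of_nat p ^ k \<in> J k"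
  unfolding J_iff using Z_loc_of_int[of 1] by auto

lemma J_p_power_mult: "x \<in> J j \<Longrightarrow> of_nat p ^ k * x \<in> J (k + j)"
  by (rule J_mult[OF J_p_power])

lemma J_mono: "x \<in> J k \<Longrightarrow> j \<le> k \<Longrightarrow> x \<in> J j"
proof -
  assume x: "x \<in> J k" and "j \<le> k"
  then obtain z where z: "z \<in> Z_loc p" "x = of_nat p ^ k * z" unfolding J_iff by blast
  have "x = of_nat p ^ j * (of_int (int p ^ (k - j)) * z)"
    using \<open>j \<le> k\<close> by (simp add: z(2) flip: power_add mult.assoc)
  thus ?thesis unfolding J_iff using Z_loc_mult Z_loc_of_int z(1) by blast
qed

lemma J_p: "of_nat p \<in> J 1"
  using J_p_power[of 1] by simp

lemma J_dvd: "p dvd n \<Longrightarrow> of_nat n \<in> J 1"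
  by (erule dvdE) (use J_mult_right[OF J_of_nat J_p] in simp)

lemma J_inverse: "coprime n p \<Longrightarrow> 1 / of_nat n \<in> J 0"
proof -
  assume "coprime n p"
  moreover have "n \<noteq> 0" using calculation p_ge5 by (auto intro!: Nat.gr0I)
  ultimately have "1 / of_nat n \<in> Z_loc p" unfolding Z_loc_iff
    by (intro exI[of _ 1] exI[of _ "int n"]) auto
  thus ?thesis by (simp add: J_iff)
qed

lemma J_power: "x \<in> J 0 \<Longrightarrow> x ^ n \<in> J 0"
  by (induction n) (auto intro: J_mult_left)

lemma J_cancel: "coprime n p \<Longrightarrow> of_nat n * x \<in> J k \<Longrightarrow> x \<in> J k"
proof -
  assume c: "coprime n p" and x: "of_nat n * x \<in> J k"
  have "n \<noteq> 0" using c p_ge5 by (auto intro!: Nat.gr0I)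
  hence "x = (1 / of_nat n) * (of_nat n * x)" by simp
  thus ?thesis using J_mult_left[OF J_inverse[OF c] x] by argo
qed

lemma J_cancel_p: "of_nat p ^ j * x \<in> J (j + k) \<Longrightarrow> x \<in> J k"
  unfolding J_iff using p_pos by (auto simp: power_add)

lemma coprime_p_iff: "coprime n p \<longleftrightarrow> \<not> p dvd n"
  using prime_p by (metis coprime_commute prime_imp_coprime coprime_absorb_left not_prime_unit)

lemma coprime_small: "0 < n \<Longrightarrow> n < p \<Longrightarrow> coprime n p"
  by (simp add: coprime_p_iff nat_dvd_not_less)

section \<open>Sums of inverse powers over the units\<close>

text \<open>For \<open>q\<close> a positive power of \<open>p\<close> these are the least positive
  representatives of the units modulo \<open>q\<close>.\<close>

definition units :: "nat \<Rightarrow> nat set" where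
  "units q = prime_to p \<inter> {..<q}"

definition H :: "nat \<Rightarrow> nat \<Rightarrow> rat" where
  "H k q = (\<Sum>a\<in>units q. (1 / of_nat a) ^ k)"

lemma in_units_iff: "a \<in> units q \<longleftrightarrow> a < q \<and> \<not> p dvd a"
  unfolding units_def prime_to_def by (cases "a = 0") (auto simp: coprime_p_iff)

lemma finite_units [simp]: "finite (units q)"
  by (simp add: units_def)

lemma units_p: "units p = {0<..<p}"
  by (auto simp: in_units_iff nat_dvd_not_less intro: Nat.gr0I)

lemma units_pos: "a \<in> units q \<Longrightarrow> 0 < a" "a \<in> units q \<Longrightarrow> (of_nat a :: rat) \<noteq> 0"
  unfolding units_def prime_to_def by auto

lemma J_inverse_dvd: "\<not> p dvd a \<Longrightarrow> 1 / of_nat a \<in> J 0"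
  by (simp add: J_inverse coprime_p_iff)

lemma J_inverse_units: "a \<in> units q \<Longrightarrow> 1 / of_nat a \<in> J 0"
  by (simp add: J_inverse_dvd in_units_iff)

lemma J_power_cong: "x \<in> J 0 \<Longrightarrow> y \<in> J 0 \<Longrightarrow> x - y \<in> J k \<Longrightarrow> x ^ n - y ^ n \<in> J k"
proof (induction n)
  case (Suc n)
  have "x ^ Suc n - y ^ Suc n = x * (x ^ n - y ^ n) + (y ^ n) * (x - y)"
    by (simp add: algebra_simps)
  thus ?case using Suc by (auto intro!: J_add J_mult_left J_power)
qed simp

text \<open>The binomial terms beyond first order contain \<open>y * y\<close>. The truncated
  exponent \<open>n - 1\<close> is harmless at \<open>n = 0\<close> because of the factor
  \<open>of_nat n\<close>.\<close>

lemma J_power_first_order: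
  "x \<in> J 0 \<Longrightarrow> y \<in> J 1 \<Longrightarrow> (x + y) ^ n - (x ^ n + of_nat n * x ^ (n - 1) * y) \<in> J 2"
proof (induction n)
  case (Suc n)
  have y2: "y * y \<in> J 2" using J_mult[OF Suc.prems(2) Suc.prems(2)] by (simp add: numeral_2_eq_2)
  have y0: "y \<in> J 0" using Suc.prems(2) J_mono by blast
  have "(x + y) ^ Suc n - (x ^ Suc n + of_nat (Suc n) * x ^ (Suc n - 1) * y)
    = (x + y) * ((x + y) ^ n - (x ^ n + of_nat n * x ^ (n - 1) * y)) + of_nat n * x ^ (n - 1) * (y * y)"
  proof (cases n)
    case (Suc m)
    show ?thesis unfolding Suc of_nat_Suc power_Suc diff_Suc_1 by (simp add: algebra_simps)
  qed simp
  moreover have "\<dots> \<in> J 2" using Suc.IH[OF Suc.prems] Suc.prems(1) y2 y0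
    by (intro J_add[of _ 2] J_mult_left[OF _ y2] J_mult_left[of "x + y"] J_mult_left[of "of_nat n" _ 0]
        J_power J_add[of _ 0] J_of_nat)
  ultimately show ?case by simp
qed simp

lemma reflect_in_units: "p dvd q \<Longrightarrow> a \<in> units q \<Longrightarrow> q - a \<in> units q"
  using units_pos(1)[of a q] dvd_diffD1[of p q a] by (auto simp: in_units_iff)

lemma sum_units_reflect:
  assumes "p dvd q" shows "(\<Sum>a\<in>units q. g (q - a)) = (\<Sum>a\<in>units q. g a)"
  using reflect_in_units[OF assms]
  by (intro sum.reindex_bij_witness[of _ "\<lambda>a. q - a" "\<lambda>a. q - a"]) (simp_all add: in_units_iff)

lemma inverse_reflect:
  assumes "of_nat q \<in> J r" "p dvd q" "a \<in> units q"
  shows "1 / of_nat (q - a) + 1 / of_nat a \<in> J r"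
proof -
  have u: "q - a \<in> units q" "a < q"
    using reflect_in_units[OF assms(2,3)] assms(3) by (auto simp: in_units_iff)
  have "1 / of_nat (q - a) + 1 / of_nat a = (1 / of_nat (q - a) * (1 / of_nat a)) * (of_nat q :: rat)"
    using u assms units_pos[OF u(1)] units_pos[OF assms(3)] by (simp add: field_simps of_nat_diff)
  also have "\<dots> \<in> J r"
    by (intro J_mult_left assms(1) J_mult_left[of _ _ 0]
        J_inverse_units[OF u(1)] J_inverse_units[OF assms(3)])
  finally show ?thesis .
qed

text \<open>Pairing \<open>a\<close> with \<open>q - a\<close> counts the sum twice, and for odd
  \<open>k\<close> the two terms of a pair cancel modulo p^r by
  \<open>inverse_reflect\<close>.\<close>

lemma H_odd:
  assumes "of_nat q \<in> J r" "p dvd q" "odd k"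
  shows "H k q \<in> J r"
proof -
  have "2 * H k q = (\<Sum>a\<in>units q. (1 / of_nat (q - a)) ^ k + (1 / of_nat a) ^ k)"
    unfolding H_def sum.distrib sum_units_reflect[OF assms(2), of "\<lambda>a. (1 / of_nat a) ^ k"] by simp
  also have "\<dots> \<in> J r"
  proof (rule J_sum)
    fix a assume a: "a \<in> units q"
    have u: "q - a \<in> units q"
      by (rule reflect_in_units[OF assms(2) a])
    have "(1 / of_nat (q - a)) ^ k - (- (1 / of_nat a)) ^ k \<in> J r"
      using inverse_reflect[OF assms(1,2) a] J_inverse_units[OF a] J_inverse_units[OF u]
      by (intro J_power_cong) (simp_all del: minus_divide_left)
    thus "(1 / of_nat (q - a)) ^ k + (1 / of_nat a) ^ k \<in> J r" using assms(3) by simp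
  qed
  finally show ?thesis using J_cancel[of 2] coprime_small[of 2] p_ge5 by simp
qed

text \<open>Division with remainder by \<open>q\<close>: since \<open>p dvd q\<close>, whether
  \<open>a + q * c\<close> is prime to \<open>p\<close> depends on \<open>a\<close> alone, so the
  leading digit \<open>c < p\<close> is free.\<close>

lemma sum_units_lift:
  assumes "p dvd q" "0 < q"
  shows "(\<Sum>x\<in>units (p * q). g x) = (\<Sum>a\<in>units q. \<Sum>c<p. g (a + q * c))"
proof -
  have 1: "x mod q \<in> units q" "x div q < p" if "x \<in> units (p * q)" for x
    using assms that by (auto simp: in_units_iff dvd_mod_iff less_mult_imp_div_less)
  have 2: "a + q * c \<in> units (p * q)" "(a + q * c) mod q = a" "(a + q * c) div q = c"
    if "a \<in> units q" "c < p" for a c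
  proof -
    have "a + q * c < q * Suc c" using that by (simp add: in_units_iff)
    also have "\<dots> \<le> q * p" using that by (intro mult_le_mono2) auto
    finally show "a + q * c \<in> units (p * q)"
      using assms that by (simp add: in_units_iff dvd_add_left_iff mult.commute)
  qed (use that in \<open>auto simp: in_units_iff\<close>)
  have "(\<Sum>x\<in>units (p * q). g x) = (\<Sum>(a, c)\<in>units q \<times> {..<p}. g (a + q * c))"
    by (rule sum.reindex_bij_witness[of _ "\<lambda>(a, c). a + q * c" "\<lambda>x. (x mod q, x div q)"])
       (auto simp: 1 2 simp del: mod_mult_self2 div_mult_self2)
  thus ?thesis by (simp add: sum.cartesian_product)
qed

section \<open>Digit sums and the lift of \<open>H 2\<close> from \<open>q\<close> to
  \<open>p q\<close>\<close>

lemma coprime_2: "coprime 2 p" and coprime_3: "coprime 3 p"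
  using coprime_small[of 2] coprime_small[of 3] p_ge5 by auto

lemma coprime_6: "coprime 6 p"
  using coprime_mult_left_iff[of 2 3 p] coprime_2 coprime_3 by simp

lemma sum_id_p: "(\<Sum>c<p. of_nat c) \<in> J 1"
proof -
  have "2 * (\<Sum>c<n. of_nat c) = of_nat n * (of_nat n - (1 :: rat))" for n
    by (induction n) (auto simp: algebra_simps)
  from this[of p] have "of_nat 2 * (\<Sum>c<p. of_nat c) = of_nat p * (of_nat p - (1 :: rat))" by simp
  also have "\<dots> \<in> J 1" by (intro J_mult_right J_diff J_p) auto
  finally show ?thesis by (rule J_cancel[OF coprime_2])
qed

lemma sum_square_p: "(\<Sum>c<p. of_nat c ^ 2) \<in> J 1"
proof -
  have "6 * (\<Sum>c<n. of_nat c ^ 2) = of_nat n * ((of_nat n - (1 :: rat)) * (2 * of_nat n - 1))" for n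
    by (induction n) (auto simp: algebra_simps power2_eq_square)
  from this[of p] have "of_nat 6 * (\<Sum>c<p. of_nat c ^ 2) = of_nat p * ((of_nat p - (1 :: rat)) * (2 * of_nat p - 1))"
    by simp
  also have "\<dots> \<in> J 1" by (intro J_mult_right J_mult_left J_diff J_p) auto
  finally show ?thesis by (rule J_cancel[OF coprime_6])
qed

text \<open>Taylor expansion of \<open>1 / (a + q c)^2\<close> in \<open>q\<close>. The linear term
  gains one factor \<open>p\<close> from the sum of the digits and one from \<open>H 3 q\<close>;
  the quadratic term has order at least 2r + 1 and the cubic remainder order 3r, both at least r +
  2.\<close>

lemma H2_lift:
  assumes "r \<ge> 1"
  shows "H 2 (p * p ^ r) - of_nat p * H 2 (p ^ r) \<in> J (r + 2)"
proof -
  define q where "q = p ^ r"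
  have q: "p dvd q" "0 < q" using assms p_ge5 by (auto simp: q_def)
  have qJ: "of_nat q \<in> J r" using J_p_power by (simp add: q_def)
  \<comment> \<open>The exact Taylor remainder after the quadratic term, with \<open>- q^3\<close>
    taken out.\<close>
  define R where "R a c = (4 * of_nat a + 3 * of_nat (q * c)) * (1 / of_nat a) ^ 4 * (1 / of_nat (a + q * c)) ^ 2
    * (of_nat c ^ 3 :: rat)" for a c
  have *: "(1 / of_nat (a + q * c)) ^ 2 = (1 / of_nat a) ^ 2 - 2 * of_nat q * (1 / of_nat a) ^ 3 * of_nat c
      + 3 * of_nat q ^ 2 * (1 / of_nat a) ^ 4 * of_nat c ^ 2 - (of_nat q ^ 3 :: rat) * R a c"
    if "a \<in> units q" for a c
  proof -
    have id: "(1 / (a + x)) ^ 2 = (1 / a) ^ 2 - 2 * x * (1 / a) ^ 3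
      + 3 * x ^ 2 * (1 / a) ^ 4  - x ^ 3 * ((4 * a + 3 * x) * (1 / a) ^ 4 * (1 / (a + x)) ^ 2)"
      if "a \<noteq> 0" "a + x \<noteq> 0" for a x :: rat
      using that by (simp add: divide_simps) (simp add: algebra_simps eval_nat_numeral)
    have "(of_nat a :: rat) \<noteq> 0" "of_nat a + of_nat (q * c) \<noteq> (0 :: rat)"
      using units_pos[OF that] by (auto simp flip: of_nat_add of_nat_mult)
    from id[OF this] show ?thesis by (simp add: R_def algebra_simps power_mult_distrib)
  qed
  let ?s = "\<Sum>c<p. of_nat c :: rat" and ?t = "\<Sum>c<p. of_nat c ^ 2 :: rat"
  have "H 2 (p * q) = (\<Sum>a\<in>units q. of_nat p * (1 / of_nat a) ^ 2 - (2 * of_nat q * ?s) * (1 / of_nat a) ^ 3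
     + (3 * of_nat q ^ 2 * ?t) * (1 / of_nat a) ^ 4 - of_nat q ^ 3 * (\<Sum>c<p. R a c))"
    unfolding H_def sum_units_lift[OF q]
  proof (rule sum.cong[OF refl])
    fix a assume "a \<in> units q"
    thus "(\<Sum>c<p. (1 / of_nat (a + q * c)) ^ 2) = of_nat p * (1 / of_nat a) ^ 2 - (2 * of_nat q * ?s) * (1 / of_nat a) ^ 3
     + (3 * of_nat q ^ 2 * ?t) * (1 / of_nat a) ^ 4 - of_nat q ^ 3 * (\<Sum>c<p. R a c)"
      by (simp only: *) (simp add: sum.distrib sum_subtractf flip: sum_distrib_left)
  qed
  also have "\<dots> = of_nat p * H 2 q - (2 * of_nat q * ?s) * H 3 q + (3 * of_nat q ^ 2 * ?t) * H 4 q
      - of_nat q ^ 3 * (\<Sum>a\<in>units q. \<Sum>c<p. R a c)"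
    unfolding H_def by (simp only: sum.distrib sum_subtractf sum_distrib_left)
  also have "\<dots> = of_nat p * H 2 q - 2 * ((of_nat q * ?s) * H 3 q)
     + 3 * ((of_nat q * of_nat q) * ?t) * H 4 q
     - (of_nat q * of_nat q * of_nat q) * (\<Sum>a\<in>units q. \<Sum>c<p. R a c)"
    by (simp add: power2_eq_square power3_eq_cube)
  also have "\<dots> - of_nat p * H 2 q \<in> J (r + 2)"
  proof -
    have A: "((of_nat q * (\<Sum>c<p. of_nat c)) * H 3 q) \<in> J (r + 1 + 1)"
      using H_odd[OF J_dvd[OF q(1)] q(1), of 3] by (intro J_mult qJ sum_id_p) auto
    have B: "((of_nat q * of_nat q) * (\<Sum>c<p. of_nat c ^ 2)) \<in> J (r + r + 1)"
      by (intro J_mult qJ sum_square_p)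
    have C: "of_nat q * of_nat q * of_nat q \<in> J (r + r + r)"
      by (intro J_mult qJ)
    have H4: "H 4 q \<in> J 0" unfolding H_def by (intro J_sum J_power J_inverse_units)
    have R: "R a c \<in> J 0" if "a \<in> units q" for a c
    proof -
      have "\<not> p dvd a + q * c" using that q by (auto simp: in_units_iff dvd_add_left_iff)
      thus ?thesis unfolding R_def
        by (intro J_mult_left[of _ _ 0] J_power J_add[of _ 0] J_numeral J_of_nat
            J_inverse_dvd J_inverse_units[OF that])
    qed
    have A': "2 * ((of_nat q * (\<Sum>c<p. of_nat c)) * H 3 q) \<in> J (r + 2)"
      using J_mult_left[OF J_numeral A] by simp
    have B': "3 * ((of_nat q * of_nat q) * (\<Sum>c<p. of_nat c ^ 2)) * H 4 q \<in> J (r + 2)"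
      using J_mono[OF B, of "r + 2"] assms by (intro J_mult_right[OF H4] J_mult_left[OF J_numeral]) auto
    have C': "(of_nat q * of_nat q * of_nat q) * (\<Sum>a\<in>units q. \<Sum>c<p. R a c) \<in> J (r + 2)"
      using J_mono[OF C, of "r + 2"] assms R by (intro J_mult_right[OF J_sum[OF J_sum]]) auto
    have "x - a + b - c - x = (- a + b - c :: rat)" for x a b c by simp
    thus ?thesis using A' B' C' by (auto intro!: J_add J_diff)
  qed
  finally show ?thesis by (simp add: q_def)
qed

text \<open>On units below \<open>p\<close> the factor \<open>2 * u div p\<close> is the indicator
  of \<open>u > p/2\<close>, that is, the carry in doubling modulo \<open>p\<close>.\<close>

definition Phi :: "nat \<Rightarrow> rat" where
  "Phi k = (\<Sum>u\<in>units p. of_nat (2 * u div p) * (1 / of_nat u) ^ k)"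

lemma dvd_double_iff: "p dvd 2 * u \<longleftrightarrow> p dvd u"
  using prime_dvd_mult_iff[OF prime_p, of 2 u] p_ge5 by (auto dest: dvd_imp_le)

lemma double_in_units: "u \<in> units p \<Longrightarrow> 2 * u mod p \<in> units p"
  using p_pos dvd_double_iff by (auto simp: in_units_iff dvd_mod_iff)

lemma inj_double: "inj_on (\<lambda>u. 2 * u mod p) (units p)"
proof (rule inj_onI)
  have *: "u = v" if "u \<le> v" "2 * u mod p = 2 * v mod p" "v < p" for u v
  proof -
    have "p dvd 2 * v - 2 * u" using that by (intro mod_eq_dvd_iff_nat[THEN iffD1]) auto
    hence "p dvd v - u" using dvd_double_iff[of "v - u"] by (simp add: diff_mult_distrib2)
    thus "u = v" using that nat_dvd_not_less[of "v - u" p] by force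
  qed
  fix u v assume "u \<in> units p" "v \<in> units p" "2 * u mod p = 2 * v mod p"
  thus "u = v" using *[of u v] *[of v u] by (cases "u \<le> v") (auto simp: in_units_iff)
qed

lemma bij_double: "bij_betw (\<lambda>u. 2 * u mod p) (units p) (units p)"
  unfolding bij_betw_def using inj_double endo_inj_surj[OF finite_units _ inj_double] double_in_units by blast

lemma sum_double: "(\<Sum>u\<in>units p. g (2 * u mod p)) = (\<Sum>u\<in>units p. g u)"
  by (rule sum.reindex_bij_betw[OF bij_double])

lemma of_nat_double_mod: "(of_nat (2 * u mod p) :: rat) = 2 * of_nat u - of_nat p * of_nat (2 * u div p)"
proof -
  have "(of_nat (2 * u) :: rat) = of_nat (p * (2 * u div p) + 2 * u mod p)" by simp
  thus ?thesis unfolding of_nat_add of_nat_mult by simp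
qed

text \<open>With \<open>x = 2 u\<close> and \<open>y\<close> equal to \<open>p\<close> times the
  carry, this is the geometric series for \<open>1 / (x - y)\<close> cut after first order; the
  error contains \<open>y^2\<close>, hence p^2.\<close>

lemma inverse_double:
  assumes "u \<in> units p"
  shows "1 / of_nat (2 * u mod p) - ((1 / of_nat (2 * u)) + of_nat p * of_nat (2 * u div p) * (1 / of_nat (2 * u)) ^ 2) \<in> J 2"
proof -
  have id: "1 / (x - y) - (1 / x + y * (1 / x) ^ 2) = y ^ 2 * ((1 / x) ^ 2 * (1 / (x - y)))"
    if "x \<noteq> 0" "x - y \<noteq> 0" for x y :: rat
    using that by (simp add: divide_simps) (simp add: algebra_simps eval_nat_numeral)
  let ?x = "of_nat (2 * u) :: rat" and ?y = "of_nat p * of_nat (2 * u div p) :: rat"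
  have D: "of_nat (2 * u mod p) = ?x - ?y" by (simp add: of_nat_double_mod)
  have x: "?x \<noteq> 0" "1 / ?x \<in> J 0" using units_pos[OF assms] assms dvd_double_iff
    by (auto intro!: J_inverse_dvd simp: in_units_iff simp del: of_nat_mult)
  have y: "?x - ?y \<noteq> 0" "1 / (?x - ?y) \<in> J 0"
    using units_pos[OF double_in_units[OF assms]] J_inverse_units[OF double_in_units[OF assms]] by (auto simp: D)
  have y2: "?y ^ 2 \<in> J 2" unfolding power_mult_distrib by (intro J_mult_right J_p_power J_power J_of_nat)
  show ?thesis unfolding D id[OF x(1) y(1)] using x(2) y(2) y2 by (intro J_mult_right J_mult_left J_power)
qed

text \<open>Doubling permutes the units modulo \<open>p\<close>, so \<open>H k p\<close> may be
  summed over \<open>2 u mod p\<close> and expanded to first order by \<open>inverse_double\<close>.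
  Multiplying by \<open>2 ^ (k + 1)\<close> clears the denominators.\<close>

lemma H_double: "2 * (2 ^ k - 1) * H k p - of_nat k * of_nat p * Phi (k + 1) \<in> J 2"
proof -
  have "H k p - (\<Sum>u\<in>units p. (1 / 2) ^ k * (1 / of_nat u) ^ k
      + (1 / 2) ^ (k + 1) * (of_nat k * of_nat p) * (of_nat (2 * u div p) * (1 / of_nat u) ^ (k + 1))) \<in> J 2"
    unfolding H_def sum_double[of "\<lambda>a. (1 / of_nat a) ^ k", symmetric]
  proof (intro J_sum_cong)
    fix u assume u: "u \<in> units p"
    let ?X = "1 / of_nat (2 * u) :: rat" and ?Y = "of_nat p * of_nat (2 * u div p) * (1 / of_nat (2 * u)) ^ 2 :: rat"
    have X: "?X \<in> J 0" using u dvd_double_iff by (auto intro!: J_inverse_dvd simp: in_units_iff simp del: of_nat_mult)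
    have Y: "?Y \<in> J 1" using X by (intro J_mult_right J_p J_power) auto
    have 1: "(1 / of_nat (2 * u mod p)) ^ k - (?X + ?Y) ^ k \<in> J 2"
      by (intro J_power_cong inverse_double[OF u] J_inverse_units[OF double_in_units[OF u]] J_add[OF X] J_mono[OF Y]) simp
    have 2: "(?X + ?Y) ^ k - (?X ^ k + of_nat k * ?X ^ (k - 1) * ?Y) \<in> J 2"
      by (intro J_power_first_order X Y)
    have 3: "of_nat k * ?X ^ (k - 1) * ?Y = (1 / 2) ^ (k + 1) * (of_nat k * of_nat p) * (of_nat (2 * u div p) * (1 / of_nat u) ^ (k + 1))"
      by (cases k) (auto simp: power_divide power_mult_distrib power2_eq_square field_simps)
    have 4: "?X ^ k = (1 / 2) ^ k * (1 / of_nat u) ^ k" by (simp add: power_divide power_mult_distrib)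
    from J_trans[OF 1 2] show "(1 / of_nat (2 * u mod p)) ^ k - ((1 / 2) ^ k * (1 / of_nat u) ^ k
      + (1 / 2) ^ (k + 1) * (of_nat k * of_nat p) * (of_nat (2 * u div p) * (1 / of_nat u) ^ (k + 1))) \<in> J 2"
      unfolding 3 4 .
  qed
  hence "H k p - ((1 / 2) ^ k * H k p + (1 / 2) ^ (k + 1) * (of_nat k * of_nat p) * Phi (k + 1)) \<in> J 2"
    unfolding sum.distrib Phi_def H_def by (simp only: sum_distrib_left)
  from J_mult_left[OF J_of_nat[of "2 ^ (k + 1)"] this] show ?thesis
    by (simp add: power_one_over right_diff_distrib distrib_left) (simp add: algebra_simps)
qed

end

section \<open>Bernoulli numbers\<close>

text \<open>Faulhaber's formula: compare the coefficients of \<open>X^(m + 1)\<close> in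
  \<open>X * T = B * (exp(n X) - 1)\<close>, where \<open>T\<close> is the geometric sum of
  \<open>exp(i X)\<close> and \<open>B\<close> is the generating function of the Bernoulli
  numbers.\<close>

lemma sum_powers_bernoulli:
  "(\<Sum>i<n. of_nat i ^ m) =
     fact m * (\<Sum>j\<le>m. bernoulli j / fact j * (of_nat n ^ (m + 1 - j) / fact (m + 1 - j)))"
proof -
  define B where "B = Abs_fps (\<lambda>j. bernoulli j / fact j)"
  define T :: "rat fps" where "T = (\<Sum>i<n. fps_exp (of_nat i))"
  have T: "T * (fps_exp 1 - 1) = fps_exp (of_nat n) - 1" unfolding T_def
    by (induction n) (auto simp: algebra_simps fps_exp_add_mult)
  have "fps_X * T = B * (fps_exp 1 - 1) * T" by (simp add: B_def bernoulli_gf)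
  also have "\<dots> = B * (fps_exp (of_nat n) - 1)" by (simp add: T[symmetric] mult_ac)
  finally have "fps_nth (fps_X * T) (Suc m) = fps_nth (B * (fps_exp (of_nat n) - 1)) (Suc m)" by simp
  also have "fps_nth (fps_X * T) (Suc m) = (\<Sum>i<n. of_nat i ^ m) / fact m"
    by (simp add: T_def fps_sum_nth sum_divide_distrib)
  also have "fps_nth (B * (fps_exp (of_nat n) - 1)) (Suc m)
      = (\<Sum>j\<le>m. bernoulli j / fact j * (of_nat n ^ (m + 1 - j) / fact (m + 1 - j)))"
    by (simp add: fps_mult_nth B_def atLeast0AtMost Suc_diff_le) (simp add: mult_ac)
  finally show ?thesis
    unfolding divide_eq_eq by (simp only: fact_nonzero not_False_eq_True if_True mult.commute[of "fact m"])
qed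

text \<open>The coefficient of \<open>X^(k + 1)\<close> in \<open>bernoulli_gf\<close>, solved for
  the term with \<open>j = k\<close>.\<close>

lemma bernoulli_rec:
  "bernoulli k = fact k * ((if k = 0 then 1 else 0) - (\<Sum>j<k. bernoulli j * (1 / fact j) * (1 / fact (k + 1 - j))))"
proof -
  have "fps_nth (Abs_fps (\<lambda>j. bernoulli j / fact j) * (fps_exp 1 - 1)) (Suc k) = fps_nth fps_X (Suc k)"
    by (simp add: bernoulli_gf)
  also have "fps_nth (Abs_fps (\<lambda>j. bernoulli j / fact j) * (fps_exp 1 - 1)) (Suc k)
     = (\<Sum>j<k. bernoulli j * (1 / fact j) * (1 / fact (k + 1 - j))) + bernoulli k / fact k"
    by (simp add: fps_mult_nth atLeast0AtMost Suc_diff_le flip: lessThan_Suc_atMost) (simp add: mult_ac)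
  finally have "bernoulli k / fact k = (if k = 0 then 1 else 0) - (\<Sum>j<k. bernoulli j * (1 / fact j) * (1 / fact (k + 1 - j)))"
    by (simp only: fps_X_nth) simp
  thus ?thesis
    unfolding divide_eq_eq by (simp only: fact_nonzero not_False_eq_True if_True mult.commute[of "fact k"])
qed

context prime_ge5 begin

lemma J_inverse_fact: "i < p \<Longrightarrow> 1 / fact i \<in> J 0"
  using J_inverse_dvd[of "fact i"] prime_dvd_fact_iff[OF prime_p, of i] by simp

lemma J_fact: "fact i \<in> J 0"
  using J_of_nat[of "fact i"] by simp

text \<open>The recursion divides only by factorials of numbers at most
  \<open>k + 1 < p\<close>.\<close>

lemma bernoulli_integral: "k + 1 < p \<Longrightarrow> bernoulli k \<in> J 0"
proof (induction k rule: less_induct)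
  case (less k)
  have "(\<Sum>j<k. bernoulli j * (1 / fact j) * (1 / fact (k + 1 - j))) \<in> J 0"
    using less by (intro J_sum J_mult_left[of _ _ 0] J_inverse_fact) auto
  thus ?case by (subst bernoulli_rec) (intro J_mult_left J_fact J_diff, auto)
qed

text \<open>In Faulhaber's formula at \<open>n = p\<close> the term \<open>j = m\<close> is
  \<open>p * bernoulli m\<close>; every earlier term contains p^2, and its other factors are
  integral because \<open>m + 1 < p\<close>. As \<open>m > 0\<close>, the summand at 0
  vanishes.\<close>

lemma sum_powers_p:
  assumes "0 < m" "m + 1 < p"
  shows "(\<Sum>u\<in>units p. of_nat u ^ m) - of_nat p * bernoulli m \<in> J 2"
proof -
  let ?t = "\<lambda>j. bernoulli j / fact j * (of_nat p ^ (m + 1 - j) / fact (m + 1 - j)) :: rat"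
  have "{..<p} = insert 0 (units p)" using p_pos by (auto simp: units_p)
  hence "(\<Sum>u\<in>units p. of_nat u ^ m) = (\<Sum>u<p. of_nat u ^ m :: rat)"
    using assms(1) by (simp add: units_p)
  also have "\<dots> = fact m * (\<Sum>j<m. ?t j) + of_nat p * bernoulli m"
    unfolding sum_powers_bernoulli
    by (simp add: lessThan_Suc_atMost[symmetric] field_simps)
  also have "\<dots> - of_nat p * bernoulli m = fact m * (\<Sum>j<m. ?t j)" by simp
  also have "\<dots> \<in> J 2"
  proof (rule J_mult_left[OF J_fact J_sum])
    fix j assume j: "j \<in> {..<m}"
    have "bernoulli j * (1 / fact j) * (1 / fact (m + 1 - j)) \<in> J 0"
      using j assms by (intro J_mult_left[of _ _ 0] J_inverse_fact bernoulli_integral) auto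
    moreover have "of_nat p ^ (m + 1 - j) \<in> J 2" using j by (intro J_mono[OF J_p_power]) auto
    ultimately have "(bernoulli j * (1 / fact j) * (1 / fact (m + 1 - j))) * of_nat p ^ (m + 1 - j) \<in> J 2"
      by (rule J_mult_left)
    thus "?t j \<in> J 2" by (simp add: mult_ac)
  qed
  finally show ?thesis .
qed

section \<open>Inverse power sums in terms of Bernoulli numbers\<close>

lemma fermat_J:
  assumes "\<not> p dvd u" shows "of_nat u ^ (p - 1) - 1 \<in> J 1"
proof -
  have "[u ^ (p - 1) = 1] (mod p)" using fermat_theorem[OF prime_p assms] .
  moreover have "u > 0" using assms by (auto intro: Nat.gr0I)
  ultimately have "p dvd u ^ (p - 1) - 1" by (subst cong_altdef_nat[symmetric]) auto
  from J_dvd[OF this] show ?thesis using \<open>u > 0\<close> by (simp add: of_nat_diff)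
qed

text \<open>The counterpart of \<open>H_double\<close> for positive exponents: expand
  \<open>(2 u - p * carry) ^ m\<close> to first order. The overall factor 2 turns
  \<open>2 ^ (m - 1)\<close> into \<open>2 ^ m\<close>.\<close>

lemma sum_powers_double:
  "2 * (1 - 2 ^ m) * (\<Sum>u\<in>units p. of_nat u ^ m)
     + of_nat m * of_nat p * 2 ^ m * (\<Sum>u\<in>units p. of_nat (2 * u div p) * of_nat u ^ (m - 1)) \<in> J 2"
    (is "2 * (1 - 2 ^ m) * ?S + of_nat m * of_nat p * 2 ^ m * ?T \<in> J 2")
proof -
  have "2 * ?S - (\<Sum>u\<in>units p. 2 * 2 ^ m * of_nat u ^ m
      - (of_nat m * of_nat p * 2 ^ m) * (of_nat (2 * u div p) * of_nat u ^ (m - 1))) \<in> J 2"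
    unfolding sum_double[of "\<lambda>a. of_nat a ^ m", symmetric] sum_distrib_left[of 2]
  proof (intro J_sum_cong)
    fix u assume u: "u \<in> units p"
    let ?X = "of_nat (2 * u) :: rat" and ?Y = "- (of_nat p * of_nat (2 * u div p)) :: rat"
    have Y: "?Y \<in> J 1" by (simp only: J_uminus_iff) (intro J_mult_right J_p J_of_nat)
    from J_mult_left[OF J_numeral[of "num.Bit0 num.One"] J_power_first_order[OF J_of_nat[of "2 * u"] Y, of m]]
    have "2 * ((?X + ?Y) ^ m - (?X ^ m + of_nat m * ?X ^ (m - 1) * ?Y)) \<in> J 2" .
    also have "2 * ((?X + ?Y) ^ m - (?X ^ m + of_nat m * ?X ^ (m - 1) * ?Y)) =
      2 * (of_nat (2 * u mod p)) ^ m - (2 * 2 ^ m * of_nat u ^ m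
      - (of_nat m * of_nat p * 2 ^ m) * (of_nat (2 * u div p) * of_nat u ^ (m - 1)))"
      unfolding of_nat_double_mod by (cases m) (simp_all add: power_mult_distrib algebra_simps)
    finally show "2 * (of_nat (2 * u mod p)) ^ m - (2 * 2 ^ m * of_nat u ^ m
      - (of_nat m * of_nat p * 2 ^ m) * (of_nat (2 * u div p) * of_nat u ^ (m - 1))) \<in> J 2" .
  qed
  also have "(\<Sum>u\<in>units p. 2 * 2 ^ m * of_nat u ^ m
      - (of_nat m * of_nat p * 2 ^ m) * (of_nat (2 * u div p) * of_nat u ^ (m - 1)))
      = 2 * 2 ^ m * ?S - of_nat m * of_nat p * 2 ^ m * ?T"
    by (simp only: sum_subtractf sum_distrib_left)
  finally show ?thesis by (simp add: algebra_simps)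
qed

text \<open>For \<open>m = p - 1 - k\<close>, Fermat gives \<open>u ^ (m - 1)\<close> \<equiv>
  \<open>1 / u ^ (k + 1)\<close> modulo \<open>p\<close>, so \<open>H_double\<close> and
  \<open>sum_powers_double\<close> contain the same sum over the upper half of the units.
  Eliminating it relates \<open>H k p\<close> to the sum of m-th powers, which is
  \<open>p * bernoulli m\<close> modulo p^2.\<close>

lemma H_bernoulli:
  assumes k: "0 < k" "k + 1 < p - 1" and cop: "coprime (2 ^ k - 1) p"
  shows "of_nat (k + 1) * H k p - of_nat k * (of_nat p * bernoulli (p - 1 - k)) \<in> J 2"
proof -
  define m where "m = p - 1 - k"
  have m: "0 < m" "m + 1 < p" "m - 1 + (k + 1) = p - 1" "m + k = p - 1" "m + (k + 1) = p"
    using k by (auto simp: m_def)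
  define S where "S = (\<Sum>u\<in>units p. of_nat u ^ m :: rat)"
  define T where "T = (\<Sum>u\<in>units p. of_nat (2 * u div p) * of_nat u ^ (m - 1) :: rat)"
  let ?p = "of_nat p :: rat"
  have SB: "S - ?p * bernoulli m \<in> J 2" unfolding S_def using sum_powers_p m by blast
  have "?p * bernoulli m \<in> J 1" using bernoulli_integral m by (intro J_mult_right J_p) auto
  with J_mono[OF SB, of 1] have S1: "S \<in> J 1" using J_add[of "S - ?p * bernoulli m" 1] by fastforce
  have T0: "T \<in> J 0" unfolding T_def by (intro J_sum J_mult_left J_power J_of_nat)
  have TPhi: "T - Phi (k + 1) \<in> J 1" unfolding T_def Phi_def
  proof (rule J_sum_cong)
    fix u assume u: "u \<in> units p"
    have "of_nat (2 * u div p) * (1 / of_nat u) ^ (k + 1) * (of_nat u ^ (p - 1) - 1) \<in> J 1"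
      using u by (intro J_mult_left J_mult_left[of _ _ 0] J_of_nat J_power J_inverse_units[OF u] fermat_J)
        (auto simp: in_units_iff)
    also have "of_nat u ^ (p - 1) = (of_nat u ^ (m - 1) * of_nat u ^ (k + 1) :: rat)"
      unfolding power_add[symmetric] m ..
    also have "of_nat (2 * u div p) * (1 / of_nat u) ^ (k + 1) * (of_nat u ^ (m - 1) * of_nat u ^ (k + 1) - 1)
      = (of_nat (2 * u div p) * of_nat u ^ (m - 1) - of_nat (2 * u div p) * (1 / of_nat u) ^ (k + 1) :: rat)"
      using units_pos(2)[OF u] by (simp add: power_one_over field_simps)
    finally show "(of_nat (2 * u div p) * of_nat u ^ (m - 1) - of_nat (2 * u div p) * (1 / of_nat u) ^ (k + 1) :: rat) \<in> J 1" .
  qed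
  have F: "2 ^ (p - 1) - 1 \<in> J 1" using fermat_J[of 2] coprime_2 by (simp add: coprime_p_iff)
  have E1: "2 * (2 ^ k - 1) * H k p - of_nat k * ?p * Phi (k + 1) \<in> J 2" by (rule H_double)
  have E2: "2 ^ k * (2 * (1 - 2 ^ m) * S + of_nat m * ?p * 2 ^ m * T) \<in> J 2"
    unfolding S_def T_def by (intro J_mult_left[OF J_power sum_powers_double] J_numeral)
  have J_mult_J1: "x * y \<in> J 2" if "x \<in> J 1" "y \<in> J 1" for x y
    using J_mult[OF that] by (simp add: numeral_2_eq_2)
  have E3: "(2 ^ (p - 1) - 1) * S \<in> J 2" by (rule J_mult_J1[OF F S1])
  have E4: "T * (?p * (2 ^ (p - 1) - 1)) \<in> J 2" by (rule J_mult_left[OF T0 J_mult_J1[OF J_p F]])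
  have E5: "?p * (T - Phi (k + 1)) \<in> J 2" by (rule J_mult_J1[OF J_p TPhi])
  have E6: "Phi (k + 1) * (?p * ?p) \<in> J 2" 
    by (rule J_mult_left[OF _ J_mult_J1[OF J_p J_p]]) (use J_diff[OF T0 J_mono[OF TPhi]] in simp)
  have mp: "of_nat m = ?p - of_nat (k + 1)" using m(5) by (metis add_diff_cancel_right' of_nat_add)
  have pw: "2 ^ (p - 1) = (2 ^ m * 2 ^ k :: rat)" by (metis m(4) power_add)
  \<comment> \<open>\<open>k + 1\<close> times \<open>E1\<close> minus \<open>k\<close> times
    \<open>E2\<close>; the other terms replace \<open>2 ^ (p - 1)\<close> by 1, \<open>T\<close> by
    \<open>Phi (k + 1)\<close> and \<open>m\<close> by \<open>- (k + 1)\<close>, each at a cost in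
    p^2. The common factor \<open>2 * (2 ^ k - 1)\<close> is then cancelled.\<close>
  have "of_nat (2 ^ k - 1) * (of_nat 2 * (of_nat (k + 1) * H k p - of_nat k * S))
     = of_nat (k + 1) * (2 * (2 ^ k - 1) * H k p - of_nat k * ?p * Phi (k + 1))
     - of_nat k * (2 ^ k * (2 * (1 - 2 ^ m) * S + of_nat m * ?p * 2 ^ m * T)
         + of_nat 2 * ((2 ^ (p - 1) - 1) * S) - of_nat m * (T * (?p * (2 ^ (p - 1) - 1)))
         - of_nat m * (?p * (T - Phi (k + 1))) - Phi (k + 1) * (?p * ?p))"
    unfolding pw mp by (simp add: of_nat_diff algebra_simps)
  also have "\<dots> \<in> J 2"
    by (intro J_diff J_add E1 E2 E6 J_mult_left[OF J_of_nat] E3 E4 E5)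
  finally have "of_nat (k + 1) * H k p - of_nat k * S \<in> J 2"
    using J_cancel[OF cop] J_cancel[OF coprime_2] by blast
  from J_add[OF this J_mult_left[OF J_of_nat[of k] SB]] show ?thesis
    by (simp add: algebra_simps m_def)
qed

section \<open>Pairs of units\<close>

lemma sum_tuples2:
  assumes "p dvd q" shows "(\<Sum>xs\<in>tuples p 2 q. g xs) = (\<Sum>a\<in>units q. g [a, q - a])"
proof (rule sum.reindex_bij_witness[of _ "\<lambda>a. [a, q - a]" hd])
  fix xs assume "xs \<in> tuples p 2 q"
  then obtain a b where ab: "xs = [a, b]" "a \<in> prime_to p" "b \<in> prime_to p" "a + b = q"
    by (auto simp: tuples_def numeral_2_eq_2 length_Suc_conv)
  thus "[hd xs, q - hd xs] = xs" "hd xs \<in> units q" "g [hd xs, q - hd xs] = g xs"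
    by (auto simp: units_def prime_to_def)
next
  fix a assume a: "a \<in> units q"
  with reflect_in_units[OF assms this] show "[a, q - a] \<in> tuples p 2 q"
    by (auto simp: tuples_def units_def)
qed auto

lemma H2_prime_power: "H 2 (p ^ Suc r) - of_nat p ^ r * H 2 p \<in> J (r + 2)"
proof (induction r)
  case (Suc r)
  have "H 2 (p ^ Suc (Suc r)) - of_nat p ^ Suc r * H 2 p =
     (H 2 (p * p ^ Suc r) - of_nat p * H 2 (p ^ Suc r)) + of_nat p * (H 2 (p ^ Suc r) - of_nat p ^ r * H 2 p)"
    by (simp add: algebra_simps)
  also have "\<dots> \<in> J (Suc r + 2)"
    using J_mult[OF J_p Suc] by (intro J_add H2_lift) auto
  finally show ?case .
qed simp

text \<open>Expanding, \<open>1 / (a (q - a))\<close> is \<open>- (1 / a^2 + q / a^3)\<close> up to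
  q^2. The cubic sum gains a factor \<open>p\<close> by \<open>H_odd\<close>, leaving
  \<open>- H 2 q\<close>, which is reduced to \<open>H 2 p\<close> and evaluated by
  \<open>H_bernoulli\<close>.\<close>

lemma sum_tuples2_cong:
  assumes "r > 0"
  shows "(\<Sum>xs\<in>tuples p 2 (p ^ r). 1 / of_nat (prod_list xs)) + 2 / 3 * of_nat (p ^ r) * bernoulli (p - 3) \<in> J (r + 1)"
proof -
  obtain s where s: "r = Suc s" using assms by (cases r) auto
  define q where "q = p ^ r"
  have q: "p dvd q" using assms by (simp add: q_def)
  have qJ: "of_nat q \<in> J r" using J_p_power by (simp add: q_def)
  define S where "S = (\<Sum>xs\<in>tuples p 2 q. 1 / of_nat (prod_list xs) :: rat)"
  have "S - (\<Sum>a\<in>units q. - ((1 / of_nat a) ^ 2 + of_nat q * (1 / of_nat a) ^ 3)) \<in> J (r + r)"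
    unfolding S_def sum_tuples2[OF q]
  proof (rule J_sum_cong)
    fix a assume a: "a \<in> units q"
    note b = reflect_in_units[OF q a]
    have "1 / of_nat (prod_list [a, q - a]) - - ((1 / of_nat a) ^ 2 + of_nat q * (1 / of_nat a) ^ 3)
       = (of_nat q * of_nat q) * ((1 / of_nat a) ^ 3 * (1 / of_nat (q - a)) :: rat)"
    proof -
      have "1 / (x * (y - x)) - - ((1 / x) ^ 2 + y * (1 / x) ^ 3) = (y * y) * ((1 / x) ^ 3 * (1 / (y - x)))"
        if "x \<noteq> 0" "y - x \<noteq> 0" for x y :: rat
        using that by (simp add: divide_simps) (simp add: algebra_simps eval_nat_numeral)
      from this[of "of_nat a" "of_nat q"] units_pos(2)[OF a] units_pos(2)[OF b] a
      show ?thesis by (simp add: in_units_iff of_nat_diff)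
    qed
    also have "\<dots> \<in> J (r + r)"
      by (intro J_mult_right J_mult[OF qJ qJ] J_mult_left[of _ _ 0] J_power
           J_inverse_units[OF a] J_inverse_units[OF b])
    finally show "1 / of_nat (prod_list [a, q - a]) - - ((1 / of_nat a) ^ 2 + of_nat q * (1 / of_nat a) ^ 3)
       \<in> J (r + r)" .
  qed
  hence "S - (- (H 2 q + of_nat q * H 3 q)) \<in> J (r + r)"
    by (simp only: H_def sum_negf sum.distrib sum_distrib_left)
  moreover have "S - (- (H 2 q + of_nat q * H 3 q)) = S + H 2 q + of_nat q * H 3 q" by simp
  ultimately have "S + H 2 q + of_nat q * H 3 q \<in> J (r + r)" by metis
  hence 1: "S + H 2 q + of_nat q * H 3 q \<in> J (r + 1)" by (rule J_mono) (use assms in simp)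
  have 2: "of_nat q * H 3 q \<in> J (r + 1)"
    by (intro J_mult qJ H_odd J_dvd q) auto
  have 3: "H 2 q - of_nat p ^ s * H 2 p \<in> J (r + 1)"
    using H2_prime_power[of s] by (simp add: q_def s)
  \<comment> \<open>With exponent 2 the bound required by \<open>H_bernoulli\<close> is
    \<open>3 < p - 1\<close>, valid from \<open>p = 5\<close> on.\<close>
  have "of_nat (2 + 1) * H 2 p - of_nat 2 * (of_nat p * bernoulli (p - 1 - 2)) \<in> J 2"
    using p_ge5 coprime_3 by (intro H_bernoulli) auto
  hence 4: "of_nat p ^ s * (3 * H 2 p - 2 * (of_nat p * bernoulli (p - 3))) \<in> J (r + 1)"
    using J_p_power_mult[of _ 2 s] p_ge5 by (simp add: s numeral_3_eq_3)
  have "of_nat 3 * (S + 2 / 3 * of_nat q * bernoulli (p - 3)) = of_nat 3 * (S + H 2 q + of_nat q * H 3 q)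
      - of_nat 3 * (of_nat q * H 3 q) - of_nat 3 * (H 2 q - of_nat p ^ s * H 2 p)
      - of_nat p ^ s * (3 * H 2 p - 2 * (of_nat p * bernoulli (p - 3)))"
    by (simp add: q_def s algebra_simps)
  also have "\<dots> \<in> J (r + 1)"
    by (intro J_diff 4 J_mult_left[OF J_of_nat] 1 2 3)
  finally show ?thesis unfolding S_def q_def by (rule J_cancel[OF coprime_3])
qed

section \<open>Quadruples of units\<close>

text \<open>A predicate on the sum, rather than a fixed value, lets the same lemmas serve both the
  condition \<open>s = m * q\<close> and the condition \<open>q dvd s\<close>, of which only the
  latter is stable under doubling.\<close>

definition quads :: "(nat \<Rightarrow> bool) \<Rightarrow> nat \<Rightarrow> (nat \<times> nat \<times> nat \<times> nat) set" where
  "quads R q = {(a, b, c, d) \<in> units q \<times> units q \<times> units q \<times> units q. R (a + b + c + d)}"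

lemma finite_quads [simp]: "finite (quads R q)"
  by (rule finite_subset[of _ "units q \<times> units q \<times> units q \<times> units q"]) (auto simp: quads_def)

lemma in_quads_iff: "(a, b, c, d) \<in> quads R q \<longleftrightarrow>
    a \<in> units q \<and> b \<in> units q \<and> c \<in> units q \<and> d \<in> units q \<and> R (a + b + c + d)"
  by (auto simp: quads_def)

definition qsum :: "(nat \<Rightarrow> bool) \<Rightarrow> nat \<Rightarrow> (nat \<Rightarrow> nat \<Rightarrow> nat \<Rightarrow> nat \<Rightarrow> rat) \<Rightarrow> rat" where
  "qsum R q g = (\<Sum>(a, b, c, d)\<in>quads R q. g a b c d)"

lemma qsum_add: "qsum R q (\<lambda>a b c d. g a b c d + h a b c d) = qsum R q g + qsum R q h"
  unfolding qsum_def by (simp add: sum.distrib case_prod_unfold)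

lemma qsum_diff: "qsum R q (\<lambda>a b c d. g a b c d - h a b c d) = qsum R q g - qsum R q h"
  unfolding qsum_def by (simp add: sum_subtractf case_prod_unfold)

lemma qsum_cmult: "qsum R q (\<lambda>a b c d. k * g a b c d) = k * qsum R q g"
  unfolding qsum_def by (simp add: sum_distrib_left case_prod_unfold)

lemma qsum_cong:
  assumes "\<And>a b c d. a \<in> units q \<Longrightarrow> b \<in> units q \<Longrightarrow> c \<in> units q \<Longrightarrow> d \<in> units q \<Longrightarrow>
    R (a + b + c + d) \<Longrightarrow> g a b c d = h a b c d"
  shows "qsum R q g = qsum R q h"
  unfolding qsum_def using assms by (auto intro!: sum.cong simp: in_quads_iff)

lemma J_qsum:
  assumes "\<And>a b c d. a \<in> units q \<Longrightarrow> b \<in> units q \<Longrightarrow> c \<in> units q \<Longrightarrow> d \<in> units q \<Longrightarrow>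
    R (a + b + c + d) \<Longrightarrow> g a b c d \<in> J k"
  shows "qsum R q g \<in> J k"
  unfolding qsum_def using assms by (auto intro!: J_sum simp: in_quads_iff)

lemma J_qsum_cong:
  assumes "\<And>a b c d. a \<in> units q \<Longrightarrow> b \<in> units q \<Longrightarrow> c \<in> units q \<Longrightarrow> d \<in> units q \<Longrightarrow>
    R (a + b + c + d) \<Longrightarrow> g a b c d - h a b c d \<in> J k"
  shows "qsum R q g - qsum R q h \<in> J k"
  unfolding qsum_diff[symmetric] using assms by (rule J_qsum)

text \<open>These transpositions bring a distinguished variable to the first place, or, with
  \<open>a\<close> fixed, to the second place.\<close>

lemma qsum_swap:
  "qsum R q (\<lambda>a b c d. g b a c d) = qsum R q g"
  "qsum R q (\<lambda>a b c d. g c b a d) = qsum R q g"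
  "qsum R q (\<lambda>a b c d. g d b c a) = qsum R q g"
  "qsum R q (\<lambda>a b c d. g a c b d) = qsum R q g"
  "qsum R q (\<lambda>a b c d. g a d c b) = qsum R q g"
  unfolding qsum_def
  by (rule sum.reindex_bij_witness[of _ "\<lambda>(a, b, c, d). (b, a, c, d)" "\<lambda>(a, b, c, d). (b, a, c, d)"],
      auto simp: quads_def ac_simps)
     (rule sum.reindex_bij_witness[of _ "\<lambda>(a, b, c, d). (c, b, a, d)" "\<lambda>(a, b, c, d). (c, b, a, d)"],
      auto simp: quads_def ac_simps,
      rule sum.reindex_bij_witness[of _ "\<lambda>(a, b, c, d). (d, b, c, a)" "\<lambda>(a, b, c, d). (d, b, c, a)"],
      auto simp: quads_def ac_simps,
      rule sum.reindex_bij_witness[of _ "\<lambda>(a, b, c, d). (a, c, b, d)" "\<lambda>(a, b, c, d). (a, c, b, d)"],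
      auto simp: quads_def ac_simps,
      rule sum.reindex_bij_witness[of _ "\<lambda>(a, b, c, d). (a, d, c, b)" "\<lambda>(a, b, c, d). (a, d, c, b)"],
      auto simp: quads_def ac_simps)

lemma sum_tuples4:
  "(\<Sum>xs\<in>tuples p 4 q. g xs) = qsum (\<lambda>s. s = q) q (\<lambda>a b c d. g [a, b, c, d])"
  unfolding qsum_def
proof (rule sum.reindex_bij_witness[of _ "\<lambda>(a, b, c, d). [a, b, c, d]" "\<lambda>xs. (xs ! 0, xs ! 1, xs ! 2, xs ! 3)"])
  fix xs assume "xs \<in> tuples p 4 q"
  then obtain a b c d where ab: "xs = [a, b, c, d]" "{a, b, c, d} \<subseteq> prime_to p" "a + b + c + d = q"
    by (auto simp: tuples_def numeral_eq_Suc length_Suc_conv)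
  thus "(case (xs ! 0, xs ! 1, xs ! 2, xs ! 3) of (a, b, c, d) \<Rightarrow> [a, b, c, d]) = xs"
    "(xs ! 0, xs ! 1, xs ! 2, xs ! 3) \<in> quads (\<lambda>s. s = q) q"
    "(case (xs ! 0, xs ! 1, xs ! 2, xs ! 3) of (a, b, c, d) \<Rightarrow> g [a, b, c, d]) = g xs"
    by (auto simp: units_def prime_to_def quads_def)
next
  fix x assume "x \<in> quads (\<lambda>s. s = q) q"
  thus "(case x of (a, b, c, d) \<Rightarrow> [a, b, c, d]) \<in> tuples p 4 q"
    by (auto simp: tuples_def units_def quads_def)
qed auto

lemma multiple_of_four_lt:
  assumes "(q :: nat) dvd s" "0 < s" "s < 4 * q" shows "s = q \<or> s = 2 * q \<or> s = 3 * q"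
proof -
  obtain k where "s = q * k" using assms by (rule_tac dvdE)
  hence "0 < k" "k < 4" using assms by (auto simp: mult.commute)
  thus ?thesis using \<open>s = q * k\<close> by (auto simp: numeral_eq_Suc less_Suc_eq)
qed

lemma sum_bounds_units:
  assumes "a \<in> units q" "b \<in> units q" "c \<in> units q" "d \<in> units q"
  shows "0 < a + b + c + d" "a + b + c + d < 4 * q"
  using assms units_pos(1)[of a q] by (auto simp: in_units_iff)

text \<open>Four units below \<open>q\<close> have a sum strictly between 0 and
  \<open>4 * q\<close>, which leaves three multiples of \<open>q\<close>.\<close>

lemma qsum_dvd:
  assumes "q > 0"
  shows "qsum (\<lambda>s. q dvd s) q g =
     qsum (\<lambda>s. s = q) q g + qsum (\<lambda>s. s = 2 * q) q g + qsum (\<lambda>s. s = 3 * q) q g"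
proof -
  have U: "quads (\<lambda>s. q dvd s) q = quads (\<lambda>s. s = q) q \<union> quads (\<lambda>s. s = 2 * q) q \<union> quads (\<lambda>s. s = 3 * q) q"
  proof (intro equalityI subsetI)
    fix x assume "x \<in> quads (\<lambda>s. q dvd s) q"
    then obtain a b c d where x: "x = (a, b, c, d)" "a \<in> units q" "b \<in> units q" "c \<in> units q" "d \<in> units q"
      "q dvd a + b + c + d" by (auto simp: quads_def)
    with multiple_of_four_lt[OF x(6) sum_bounds_units[OF x(2-5)]]
    show "x \<in> quads (\<lambda>s. s = q) q \<union> quads (\<lambda>s. s = 2 * q) q \<union> quads (\<lambda>s. s = 3 * q) q"
      by (auto simp: in_quads_iff)
  qed (auto simp: quads_def)
  have D: "quads (\<lambda>s. s = q) q \<inter> quads (\<lambda>s. s = 2 * q) q = {}"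
    "(quads (\<lambda>s. s = q) q \<union> quads (\<lambda>s. s = 2 * q) q) \<inter> quads (\<lambda>s. s = 3 * q) q = {}"
    using assms by (auto simp: quads_def)
  show ?thesis unfolding U qsum_def by (simp add: sum.union_disjoint D)
qed

definition V :: "nat \<Rightarrow> nat \<Rightarrow> nat \<Rightarrow> nat \<Rightarrow> rat" where
  "V a b c d = 1 / of_nat a * (1 / of_nat b) * (1 / of_nat c) * (1 / of_nat d)"

definition S :: "nat \<Rightarrow> nat \<Rightarrow> rat" where
  "S m q = qsum (\<lambda>s. s = m * q) q V"

definition Q :: "nat \<Rightarrow> nat \<Rightarrow> rat" where
  "Q m q = qsum (\<lambda>s. s = m * q) q (\<lambda>a b c d. 1 / of_nat a * V a b c d)"

definition U :: "nat \<Rightarrow> rat" where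
  "U q = qsum (\<lambda>s. q dvd s) q V"

definition W :: "nat \<Rightarrow> rat" where
  "W q = qsum (\<lambda>s. q dvd s) q (\<lambda>a b c d. 1 / of_nat a * V a b c d)"

lemma J_V: "a \<in> units q \<Longrightarrow> b \<in> units q \<Longrightarrow> c \<in> units q \<Longrightarrow> d \<in> units q \<Longrightarrow> V a b c d \<in> J 0"
  unfolding V_def by (intro J_mult_left[of _ _ 0]) (auto simp: J_inverse_units)

lemma J_Q: "Q m q \<in> J 0"
  unfolding Q_def by (intro J_qsum J_mult_left[of _ _ 0] J_V J_inverse_units; assumption)

lemma U_eq: "q > 0 \<Longrightarrow> U q = S 1 q + S 2 q + S 3 q"
  and W_eq: "q > 0 \<Longrightarrow> W q = Q 1 q + Q 2 q + Q 3 q"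
  unfolding U_def W_def S_def Q_def by (simp_all add: qsum_dvd)

text \<open>Reflecting all four variables sends the sum \<open>s\<close> to
  \<open>4 * q - s\<close>.\<close>

lemma qsum_reflect:
  assumes "p dvd q"
  shows "qsum (\<lambda>s. s = q) q (\<lambda>a b c d. g (q - a) (q - b) (q - c) (q - d)) = qsum (\<lambda>s. s = 3 * q) q g"
  unfolding qsum_def
  by (rule sum.reindex_bij_witness[of _ "\<lambda>(a, b, c, d). (q - a, q - b, q - c, q - d)"
          "\<lambda>(a, b, c, d). (q - a, q - b, q - c, q - d)"])
     (auto simp: in_quads_iff reflect_in_units[OF assms], auto simp: in_units_iff)

text \<open>Modulo \<open>p\<close> reflection changes the sign of each inverse, and the summand of
  \<open>Q\<close> is a product of five of them.\<close>

lemma Q_reflect: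
  assumes "p dvd q" shows "Q 3 q + Q 1 q \<in> J 1"
proof -
  have q: "of_nat q \<in> J 1" using J_dvd assms by blast
  have "Q 3 q - qsum (\<lambda>s. s = q) q (\<lambda>a b c d. (- (1 / of_nat a)) * ((- (1 / of_nat a)) * (- (1 / of_nat b)) *
     (- (1 / of_nat c)) * (- (1 / of_nat d)))) \<in> J 1"
    unfolding Q_def V_def qsum_reflect[OF assms, symmetric]
  proof (rule J_qsum_cong)
    fix a b c d assume u: "a \<in> units q" "b \<in> units q" "c \<in> units q" "d \<in> units q"
    have r: "1 / of_nat (q - x) - (- (1 / of_nat x)) \<in> J 1" "1 / of_nat (q - x) \<in> J 0" "- (1 / of_nat x) \<in> J 0"
      if "x \<in> units q" for x
      using inverse_reflect[OF q assms that] J_inverse_units[OF reflect_in_units[OF assms that]]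
        J_inverse_units[OF that] by (auto simp del: minus_divide_left)
    show "1 / of_nat (q - a) * (1 / of_nat (q - a) * (1 / of_nat (q - b)) * (1 / of_nat (q - c)) * (1 / of_nat (q - d)))
       - - (1 / of_nat a) * (- (1 / of_nat a) * - (1 / of_nat b) * - (1 / of_nat c) * - (1 / of_nat d)) \<in> J 1"
      by (intro J_mult_cong r J_mult_left[of _ _ 0] u)
  qed
  moreover have "qsum (\<lambda>s. s = q) q (\<lambda>a b c d. (- (1 / of_nat a)) * ((- (1 / of_nat a)) * (- (1 / of_nat b)) *
     (- (1 / of_nat c)) * (- (1 / of_nat d)))) = - Q 1 q"
    unfolding Q_def V_def using qsum_cmult[of "\<lambda>s. s = q" q "- 1"] by simp
  ultimately show ?thesis by simp
qed

end

section \<open>The sum over quadruples adding up to \<open>p\<close>\<close>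

text \<open>Since \<open>1 / 0 = 0\<close>, \<open>F\<close> is the series of
  \<open>- log (1 - X)\<close>, with derivative \<open>1 / (1 - X)\<close>. Differentiating
  \<open>F ^ Suc k\<close> gives \<open>Suc k * F ^ k / (1 - X)\<close>, and division by
  \<open>1 - X\<close> forms partial sums of coefficients.\<close>

lemma fps_log_power_nth:
  defines "F \<equiv> Abs_fps (\<lambda>i. 1 / of_nat i :: rat)"
  shows "of_nat (Suc n) * fps_nth (F ^ Suc k) (Suc n) = of_nat (Suc k) * (\<Sum>i\<le>n. fps_nth (F ^ k) i)"
proof -
  have D: "fps_deriv F = Abs_fps (\<lambda>_. 1)" by (rule fps_ext) (simp add: F_def)
  have "of_nat (Suc n) * fps_nth (F ^ Suc k) (Suc n) = fps_nth (fps_deriv (F ^ Suc k)) n"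
    by (simp only: fps_deriv_nth Suc_eq_plus1)
  also have "fps_deriv (F ^ Suc k) = fps_const (of_nat (Suc k)) * (F ^ k * Abs_fps (\<lambda>_. 1))"
    by (simp add: fps_deriv_power D mult_ac del: power_Suc)
  also have "fps_nth \<dots> n = of_nat (Suc k) * (\<Sum>i\<le>n. fps_nth (F ^ k) i)"
    by (simp add: fps_mult_nth[of "F ^ k"] atLeast0AtMost del: of_nat_Suc)
  finally show ?thesis .
qed

text \<open>The coefficient is \<open>24 / (n + 1)\<close> times the third elementary symmetric polynomial of
\<open>1, 1/2, \<dots>, 1/n\<close>, written in power sums by Newton's identity.\<close>
lemma fps_log_power4_nth:
  defines "F \<equiv> Abs_fps (\<lambda>i. 1 / of_nat i :: rat)"
  defines "h \<equiv> (\<lambda>k n. \<Sum>i\<in>{0<..n}. (1 / of_nat i :: rat) ^ k)"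
  shows "of_nat (Suc n) * fps_nth (F ^ 4) (Suc n) = 4 * (h 1 n ^ 3 - 3 * h 1 n * h 2 n + 2 * h 3 n)"
proof -
  note R = fps_log_power_nth[folded F_def]
  have set: "{0<..Suc n} = insert (Suc n) {0<..n}" for n by auto
  have h: "h k (Suc n) = h k n + (1 / of_nat (Suc n)) ^ k" for k n
    unfolding h_def set by simp
  have h0: "h k 0 = 0" for k by (simp add: h_def)
  have F0: "fps_nth (F ^ Suc k) 0 = 0" for k by (simp add: F_def)
  have step: "fps_nth (F ^ Suc k) (Suc n) = 1 / of_nat (Suc n) * (of_nat (Suc k) * (\<Sum>i\<le>n. fps_nth (F ^ k) i))" for k n
    using R[of n k] by (simp add: field_simps del: of_nat_Suc power_Suc)
  \<comment> \<open>\<open>G0\<close> to \<open>G3\<close>: the partial sums for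
    \<open>F ^ k\<close> are \<open>k!\<close> times the k-th elementary symmetric polynomial of
    \<open>1, 1/2, ..., 1/n\<close>.\<close>
  have G0: "(\<Sum>i\<le>n. fps_nth (F ^ 0) i) = 1" for n
    by (induction n) auto
  have G1: "(\<Sum>i\<le>n. fps_nth (F ^ Suc 0) i) = h 1 n" for n
    by (induction n) (simp_all add: h h0 F_def del: of_nat_Suc)
  have G2: "(\<Sum>i\<le>n. fps_nth (F ^ Suc (Suc 0)) i) = h 1 n ^ 2 - h 2 n" for n
  proof (induction n)
    case (Suc n)
    obtain x :: rat where x: "1 / of_nat (Suc n) = x" by simp
    show ?case unfolding sum.atMost_Suc Suc step G1 h x by (simp add: power2_eq_square algebra_simps)
  qed (simp add: h0 F0 del: power_Suc)
  have G3: "(\<Sum>i\<le>n. fps_nth (F ^ Suc (Suc (Suc 0))) i) = h 1 n ^ 3 - 3 * h 1 n * h 2 n + 2 * h 3 n" for n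
  proof (induction n)
    case (Suc n)
    obtain x :: rat where x: "1 / of_nat (Suc n) = x" by simp
    show ?case unfolding sum.atMost_Suc Suc step G2 h x
      by (simp add: power2_eq_square power3_eq_cube algebra_simps)
  qed (simp add: h0 F0 del: power_Suc)
  show ?thesis using R[of n "Suc (Suc (Suc 0))"] unfolding G3 by (simp add: numeral_eq_Suc)
qed

context prime_ge5 begin

text \<open>\<open>S 1 p\<close> is the coefficient of \<open>X^p\<close> in \<open>F ^ 4\<close>:
  compositions with a zero part contribute nothing because \<open>1 / 0 = 0\<close>, and otherwise
  all parts lie strictly between 0 and \<open>p\<close>, hence are units.\<close>

lemma S1_p: "of_nat p * S 1 p = 4 * (H 1 p ^ 3 - 3 * H 1 p * H 2 p + 2 * H 3 p)"
proof -
  define F where "F = Abs_fps (\<lambda>i. 1 / of_nat i :: rat)"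
  have "fps_nth (F ^ 4) p = (\<Sum>v\<in>natpermute p 4. \<Prod>j\<in>{0..3}. fps_nth F (v ! j))"
    by (simp add: fps_power_nth)
  also have "\<dots> = (\<Sum>v\<in>natpermute p 4. 1 / of_nat (prod_list v))"
  proof (rule sum.cong[OF refl])
    fix v assume "v \<in> natpermute p 4"
    then obtain a b c d where "v = [a, b, c, d]"
      by (auto simp: natpermute_def numeral_eq_Suc length_Suc_conv)
    thus "(\<Prod>j\<in>{0..3}. fps_nth F (v ! j)) = 1 / of_nat (prod_list v)"
      by (simp add: numeral_eq_Suc F_def)
  qed
  also have "\<dots> = (\<Sum>v\<in>tuples p 4 p. 1 / of_nat (prod_list v))"
  proof (rule sum.mono_neutral_right)
    show "finite (natpermute p 4)" by (rule natpermute_finite)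
    show "tuples p 4 p \<subseteq> natpermute p 4" by (auto simp: tuples_def natpermute_def)
    show "\<forall>v\<in>natpermute p 4 - tuples p 4 p. 1 / of_nat (prod_list v) = (0 :: rat)"
    proof
      fix v assume v: "v \<in> natpermute p 4 - tuples p 4 p"
      then obtain a b c d where abcd: "v = [a, b, c, d]" "a + b + c + d = p"
        by (auto simp: natpermute_def numeral_eq_Suc length_Suc_conv)
      have "a = 0 \<or> b = 0 \<or> c = 0 \<or> d = 0"
      proof (rule ccontr)
        assume "\<not> ?thesis"
        hence "0 < x \<and> x < p" if "x \<in> set v" for x using abcd that by auto
        hence "set v \<subseteq> prime_to p" using coprime_small by (auto simp: prime_to_def)
        with v abcd show False by (auto simp: tuples_def)
      qed
      thus "1 / of_nat (prod_list v) = (0 :: rat)" using abcd by auto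
    qed
  qed
  also have "\<dots> = S 1 p"
    unfolding sum_tuples4 S_def V_def by (simp add: mult_ac)
  finally have "of_nat p * S 1 p = of_nat (Suc (p - 1)) * fps_nth (F ^ 4) (Suc (p - 1))"
    using p_pos by simp
  also have "{0<..p - 1} = units p" using p_pos by (auto simp: units_p)
  hence "of_nat (Suc (p - 1)) * fps_nth (F ^ 4) (Suc (p - 1))
      = 4 * (H 1 p ^ 3 - 3 * H 1 p * H 2 p + 2 * H 3 p)"
    unfolding F_def fps_log_power4_nth H_def by simp
  finally show ?thesis .
qed

lemma J_Phi: "Phi k \<in> J 0"
  unfolding Phi_def by (intro J_sum J_mult_left J_of_nat J_power J_inverse_units)

lemma J_mult_J1: "x \<in> J 1 \<Longrightarrow> y \<in> J 1 \<Longrightarrow> x * y \<in> J 2"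
  using J_mult[of x 1 y 1] by (simp add: numeral_2_eq_2)

lemma H_J1: "coprime (2 ^ k - 1) p \<Longrightarrow> H k p \<in> J 1"
proof -
  assume c: "coprime (2 ^ k - 1) p"
  have "of_nat 2 * (of_nat (2 ^ k - 1) * H k p) =
      (2 * (2 ^ k - 1) * H k p - of_nat k * of_nat p * Phi (k + 1)) + of_nat k * Phi (k + 1) * of_nat p"
    by (simp add: of_nat_diff algebra_simps)
  also have "\<dots> \<in> J 1"
    by (intro J_add J_mono[OF H_double] J_mult_left[OF _ J_p] J_mult_left J_of_nat J_Phi) simp
  finally show ?thesis using J_cancel[OF c] J_cancel[OF coprime_2] by blast
qed

lemma H2_J1: "H 2 p \<in> J 1"
  using coprime_3 by (intro H_J1) simp

text \<open>Wolstenholme's theorem: pairing \<open>a\<close> with \<open>p - a\<close> gives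
  \<open>2 * H 1 p\<close> as \<open>p\<close> times a sum that is \<open>- H 2 p\<close> modulo
  \<open>p\<close>.\<close>

lemma H1_J2: "H 1 p \<in> J 2"
proof -
  have "2 * H 1 p = (\<Sum>a\<in>units p. 1 / of_nat (p - a) + 1 / of_nat a)"
    unfolding H_def sum.distrib sum_units_reflect[OF dvd_refl, of "\<lambda>a. 1 / of_nat a"] by simp
  also have "\<dots> = of_nat p * (\<Sum>a\<in>units p. 1 / of_nat a * (1 / of_nat (p - a)))"
    unfolding sum_distrib_left
  proof (rule sum.cong[OF refl])
    fix a assume a: "a \<in> units p"
    thus "1 / of_nat (p - a) + 1 / of_nat a = of_nat p * (1 / of_nat a * (1 / of_nat (p - a)) :: rat)"
      using units_pos[OF a] units_pos[OF reflect_in_units[OF dvd_refl a]]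
      by (simp add: field_simps of_nat_diff units_p)
  qed
  also have "\<dots> \<in> J 2"
  proof (rule J_mult_J1[OF J_p])
    have "(\<Sum>a\<in>units p. 1 / of_nat a * (1 / of_nat (p - a))) - (\<Sum>a\<in>units p. - ((1 / of_nat a) ^ 2)) \<in> J 1"
    proof (rule J_sum_cong)
      fix a assume a: "a \<in> units p"
      have "1 / of_nat a * (1 / of_nat (p - a)) - - ((1 / of_nat a) ^ 2)
          = 1 / of_nat a * (1 / of_nat (p - a) + 1 / of_nat a :: rat)"
        by (simp add: power2_eq_square algebra_simps)
      also have "\<dots> \<in> J 1"
        using J_p by (intro J_mult_left J_inverse_units[OF a] inverse_reflect a) auto
      finally show "1 / of_nat a * (1 / of_nat (p - a)) - - ((1 / of_nat a :: rat) ^ 2) \<in> J 1" .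
    qed
    hence "(\<Sum>a\<in>units p. 1 / of_nat a * (1 / of_nat (p - a))) + H 2 p \<in> J 1"
      by (simp add: sum_negf H_def)
    from J_diff[OF this H2_J1] show "(\<Sum>a\<in>units p. 1 / of_nat a * (1 / of_nat (p - a))) \<in> J 1" by simp
  qed
  finally show ?thesis using J_cancel[OF coprime_2] by simp
qed

text \<open>Pair \<open>a\<close> with \<open>p - a\<close> and expand \<open>1 / (p - a)^3\<close>
  to second order in \<open>p\<close>. The second-order term is a multiple of
  \<open>p^2 * H 5 p\<close>, which \<open>H_odd\<close> puts into \<open>J 3\<close>.\<close>

lemma H3_J3: "2 * H 3 p + 3 * of_nat p * H 4 p \<in> J 3"
proof -
  have id: "(1 / (y - x)) ^ 3 + (1 / x) ^ 3 + 3 * y * (1 / x) ^ 4 + 6 * y ^ 2 * (1 / x) ^ 5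
     = y ^ 3 * ((10 * x ^ 2 - 15 * x * y + 6 * y ^ 2) * (1 / x) ^ 5 * (1 / (y - x)) ^ 3)"
    if "x \<noteq> 0" "y - x \<noteq> 0" for x y :: rat
  proof -
    define z where "z = y - x"
    have "y = z + x" by (simp add: z_def)
    thus ?thesis using that by (simp add: divide_simps) (simp add: algebra_simps eval_nat_numeral)
  qed
  have "2 * H 3 p = (\<Sum>a\<in>units p. (1 / of_nat (p - a)) ^ 3 + (1 / of_nat a) ^ 3)"
    unfolding H_def sum.distrib sum_units_reflect[OF dvd_refl, of "\<lambda>a. (1 / of_nat a) ^ 3"] by simp
  hence "2 * H 3 p + 3 * of_nat p * H 4 p + 6 * of_nat p ^ 2 * H 5 p = (\<Sum>a\<in>units p.
     (1 / of_nat (p - a)) ^ 3 + (1 / of_nat a) ^ 3 + 3 * of_nat p * (1 / of_nat a) ^ 4 + 6 * of_nat p ^ 2 * (1 / of_nat a) ^ 5)"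
    unfolding H_def by (simp only: sum.distrib sum_distrib_left)
  also have "\<dots> \<in> J 3"
  proof (rule J_sum)
    fix a assume a: "a \<in> units p"
    note b = reflect_in_units[OF dvd_refl a]
    have "of_nat (p - a) = (of_nat p - of_nat a :: rat)" using a by (simp add: units_p of_nat_diff)
    hence "(1 / of_nat (p - a)) ^ 3 + (1 / of_nat a) ^ 3 + 3 * of_nat p * (1 / of_nat a) ^ 4 + 6 * of_nat p ^ 2 * (1 / of_nat a) ^ 5
       = of_nat p ^ 3 * ((10 * of_nat a ^ 2 - 15 * of_nat a * of_nat p + 6 * of_nat p ^ 2)
           * (1 / of_nat a) ^ 5 * (1 / of_nat (p - a)) ^ 3 :: rat)"
      using id[of "of_nat a" "of_nat p"] units_pos(2)[OF a] units_pos(2)[OF b] by simp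
    also have "\<dots> \<in> J 3"
      by (intro J_mult_right[OF _ J_p_power] J_mult_left[of _ _ 0] J_add[of _ 0] J_diff[of _ 0] J_numeral J_power J_of_nat
          J_inverse_units[OF a] J_inverse_units[OF b])
    finally show "(1 / of_nat (p - a)) ^ 3 + (1 / of_nat a) ^ 3 + 3 * of_nat p * (1 / of_nat a) ^ 4
      + 6 * of_nat p ^ 2 * (1 / of_nat a) ^ 5 \<in> (J 3 :: rat set)" .
  qed
  finally have 1: "2 * H 3 p + 3 * of_nat p * H 4 p + 6 * of_nat p ^ 2 * H 5 p \<in> J 3" .
  have "6 * (of_nat p ^ 2 * H 5 p) \<in> J (2 + 1)"
    using J_p by (intro J_mult_left[OF J_numeral] J_mult J_p_power H_odd) auto
  hence "6 * (of_nat p ^ 2 * H 5 p) \<in> J 3" by simp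
  from J_diff[OF 1[unfolded mult.assoc[of 6]] this] show ?thesis by simp
qed

text \<open>In \<open>S1_p\<close> the terms with \<open>H 1 p\<close> vanish modulo p^3, and
  \<open>8 * H 3 p\<close> becomes \<open>- 12 * p * H 4 p\<close>. Cancelling \<open>p\<close>
  costs one power of the modulus.\<close>

lemma S1_H4: "S 1 p + 12 * H 4 p \<in> J 2"
proof -
  have 1: "H 1 p ^ 3 \<in> J 3"
    unfolding power3_eq_cube by (rule J_mono[OF J_mult[OF J_mult[OF H1_J2 H1_J2] H1_J2]]) simp
  have 2: "H 1 p * H 2 p \<in> J 3" using J_mult[OF H1_J2 H2_J1] by simp
  have "of_nat p ^ 1 * (S 1 p + 12 * H 4 p) = 4 * (H 1 p ^ 3) - 12 * (H 1 p * H 2 p) + 4 * (2 * H 3 p + 3 * of_nat p * H 4 p)"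
    using S1_p by (simp add: algebra_simps)
  also have "\<dots> \<in> J 3"
    by (intro J_add J_diff J_mult_left[OF J_numeral] 1 2 H3_J3)
  finally show ?thesis by (intro J_cancel_p[of 1 _ 2]) (simp add: eval_nat_numeral)
qed

section \<open>Convolutions of inverse powers modulo \<open>p\<close>\<close>

text \<open>Reducing \<open>n\<close> first makes \<open>w k\<close> exactly periodic, so that its sums over a full period are
exactly, not only modulo \<open>p\<close>, invariant under shifts.\<close>
definition w :: "nat \<Rightarrow> nat \<Rightarrow> rat" where
  "w k n = (if p dvd n then 0 else (1 / of_nat (n mod p)) ^ k)"

lemma w_mod: "w k (n mod p) = w k n"
  by (simp add: w_def dvd_mod_iff)

lemma w_add_dvd: "p dvd c \<Longrightarrow> w k (t + c) = w k t"
  using w_mod[of k "t + c"] w_mod[of k t] by (auto simp: dvd_def)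

lemma w_units: "u \<in> units p \<Longrightarrow> w k u = (1 / of_nat u) ^ k"
  by (simp add: w_def in_units_iff)

lemma J_w: "w k n \<in> J 0"
  unfolding w_def using p_pos
  by (auto intro!: J_power J_inverse_dvd simp: dvd_mod_iff simp del: power_one_over)

lemma w_Suc: "w (Suc k) n = w 1 n * w k n"
  by (simp add: w_def)

lemma w2: "w 2 n = w 1 n * w 1 n"
  by (simp add: w_def power2_eq_square)

lemma w1_inverse:
  assumes "\<not> p dvd n" shows "of_nat n * w 1 n - 1 \<in> J 1"
proof -
  have "n mod p \<noteq> 0" using assms by (simp add: dvd_eq_mod_eq_0)
  have "of_nat n = (of_nat p * of_nat (n div p) + of_nat (n mod p) :: rat)"
    by (metis mult_div_mod_eq of_nat_add of_nat_mult)
  hence "of_nat n * w 1 n - 1 = of_nat (n div p) * w 1 n * of_nat p"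
    using assms \<open>n mod p \<noteq> 0\<close> by (simp add: w_def field_simps)
  also have "\<dots> \<in> J 1" by (intro J_mult_left[OF _ J_p] J_mult_left[of _ _ 0] J_of_nat J_w)
  finally show ?thesis .
qed

lemma w1_neg:
  assumes "p dvd m + n" shows "w 1 m + w 1 n \<in> J 1"
proof (cases "p dvd m")
  case True
  thus ?thesis using assms by (simp add: w_def dvd_add_right_iff)
next
  case False
  hence n: "\<not> p dvd n" using assms dvd_add_left_iff[of p n m] by blast
  have "w 1 m + w 1 n = w 1 m * w 1 n * of_nat (m + n) - w 1 n * (of_nat m * w 1 m - 1) - w 1 m * (of_nat n * w 1 n - 1)"
    by (simp add: algebra_simps)
  also have "\<dots> \<in> J 1"
    by (intro J_diff J_mult_left[OF _ J_dvd] J_mult_left[OF _ w1_inverse] J_mult_left[of _ _ 0] J_w assms False n)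
  finally show ?thesis .
qed

lemma sum_shift_mod:
  assumes "\<And>n. g (n mod p) = g n"
  shows "(\<Sum>c<p. g (t + c)) = (\<Sum>c<p. g c :: rat)"
proof (induction t)
  case (Suc t)
  have "(\<Sum>c<p. g (Suc t + c)) + g t = (\<Sum>c<Suc p. g (t + c))"
    unfolding sum.lessThan_Suc_shift by simp
  also have "\<dots> = (\<Sum>c<p. g (t + c)) + g t"
    using assms[of "t + p"] assms[of t] by simp
  finally show ?case using Suc by simp
qed simp

lemma sum_w: "(\<Sum>c<p. w k c) = H k p"
proof -
  have "{..<p} = insert 0 (units p)" using p_pos by (auto simp: units_p)
  thus ?thesis unfolding H_def by (simp add: w_units in_units_iff) (simp add: w_def)
qed

lemma sum_shift_w: "(\<Sum>c<p. w k (t + c)) = H k p"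
  using sum_shift_mod[of "w k" t] by (simp add: w_mod sum_w)

definition delta :: "nat \<Rightarrow> rat" where
  "delta n = of_bool (p dvd n)"

lemma sum_delta: "(\<Sum>c<p. delta c) = 1"
proof -
  have "(\<Sum>c<p. delta c) = (\<Sum>c<p. if c = 0 then 1 else 0)"
    by (rule sum.cong) (auto simp: delta_def nat_dvd_not_less)
  thus ?thesis using p_pos by simp
qed

lemma sum_shift_delta: "(\<Sum>c<p. delta (t + c)) = 1"
  using sum_shift_mod[of delta t] p_pos by (simp add: delta_def dvd_mod_iff sum_delta[unfolded delta_def])

text \<open>\<open>1 / (c (t + c)) = (1 / c - 1 / (t + c)) / t\<close>, where the \<open>delta\<close> terms account for the junk value of
\<open>w\<close> at multiples of \<open>p\<close>.\<close>
lemma w_partial_fraction: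
  assumes t: "\<not> p dvd t"
  shows "of_nat t * (w 1 c * w 1 (t + c)) - (w 1 c - w 1 (t + c) + delta c * w 1 t + delta (t + c) * w 1 t) \<in> J 1"
proof (cases "p dvd c")
  case True
  hence "\<not> p dvd t + c" "w 1 c = 0" "w 1 (t + c) = w 1 t"
    using t by (simp_all add: w_add_dvd dvd_add_left_iff) (simp add: w_def)
  thus ?thesis using True by (simp add: delta_def)
next
  case c: False
  show ?thesis
  proof (cases "p dvd t + c")
    case True
    hence "w 1 (t + c) = 0" by (simp add: w_def)
    thus ?thesis using c J_uminus[OF w1_neg[of c t]] True by (simp add: delta_def add.commute)
  next
    case False
    have "of_nat t * (w 1 c * w 1 (t + c)) - (w 1 c - w 1 (t + c)) =
      w 1 c * (of_nat (t + c) * w 1 (t + c) - 1) - w 1 (t + c) * (of_nat c * w 1 c - 1)"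
      by (simp add: algebra_simps)
    also have "\<dots> \<in> J 1"
      by (intro J_diff J_mult_left[OF _ w1_inverse] J_w False c)
    finally show ?thesis using c False by (simp add: delta_def)
  qed
qed

lemma J1_cancel_left:
  assumes "\<not> p dvd t" "of_nat t * x - y \<in> J 1" "x \<in> J 0"
  shows "x - w 1 t * y \<in> J 1"
proof -
  have "x - w 1 t * y = w 1 t * (of_nat t * x - y) - x * (of_nat t * w 1 t - 1)"
    by (simp add: algebra_simps)
  also have "\<dots> \<in> J 1" using assms by (intro J_diff J_mult_left[OF _ w1_inverse] J_mult_left[OF _ assms(2)] J_w)
  finally show ?thesis .
qed

text \<open>Sum \<open>w_partial_fraction\<close> over \<open>c\<close>: the two power sums are
  equal and cancel, and each \<open>delta\<close> term yields \<open>w 1 t\<close>. If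
  \<open>p dvd t\<close>, the convolution is \<open>H 2 p\<close>, which vanishes modulo
  \<open>p\<close>.\<close>

lemma conv_w11: "(\<Sum>c<p. w 1 c * w 1 (t + c)) - 2 * w 2 t \<in> J 1"
proof (cases "p dvd t")
  case True
  hence "w 1 (t + c) = w 1 c" for c
    using w_add_dvd[of t 1 c] by (simp add: add.commute)
  moreover have "(\<Sum>c<p. w 1 c * w 1 c) = H 2 p" by (simp only: sum_w w2[symmetric])
  ultimately show ?thesis using True H2_J1 by (simp add: w_def[of _ t])
next
  case False
  have "of_nat t * (\<Sum>c<p. w 1 c * w 1 (t + c)) -
     (\<Sum>c<p. w 1 c - w 1 (t + c) + delta c * w 1 t + delta (t + c) * w 1 t) \<in> J 1"
    unfolding sum_distrib_left by (intro J_sum_cong w_partial_fraction False)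
  hence "of_nat t * (\<Sum>c<p. w 1 c * w 1 (t + c)) - 2 * w 1 t \<in> J 1"
    by (simp add: sum.distrib sum_subtractf sum_w sum_shift_w sum_delta sum_shift_delta flip: sum_distrib_right)
  from J1_cancel_left[OF False this] show ?thesis
    by (simp add: w2 mult_ac J_sum J_mult_left J_w)
qed

text \<open>Multiples of the error in \<open>w_partial_fraction\<close>, with
  \<open>a = w 1 c\<close>, \<open>b = w 1 (t + c)\<close>, \<open>s = w 1 t\<close> and
  \<open>d\<close>, \<open>e\<close> the two \<open>delta\<close> values. The premises evaluate the
  products of \<open>delta\<close> with \<open>w\<close>.\<close>

lemma partial_fraction_algebra:
  fixes a b d e s t :: rat
  shows "d * b = d * s \<Longrightarrow> e * b = 0 \<Longrightarrow>
      t * (a * (b * b)) - (a * b - b * b + d * (s * s)) = b * (t * (a * b) - (a - b + d * s + e * s))"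
    "d * a = 0 \<Longrightarrow> e * b = 0 \<Longrightarrow>
      t * (a * a * (b * b)) - (a * a * b - a * (b * b)) = a * b * (t * (a * b) - (a - b + d * s + e * s))"
    "d * a = 0 \<Longrightarrow>
      t * (a * a * b) - (a * a - a * b + e * a * s) = a * (t * (a * b) - (a - b + d * s + e * s))"
  by (auto simp: algebra_simps)

text \<open>Multiplying the partial fraction by \<open>w 1 (t + c)\<close> reduces the exponent:
  \<open>conv_w11\<close> contributes 2, the remaining \<open>delta\<close> term contributes 1, and
  \<open>H 2 p\<close> vanishes.\<close>

lemma conv_w12:
  assumes t: "\<not> p dvd t" shows "(\<Sum>c<p. w 1 c * w 2 (t + c)) - 3 * w 3 t \<in> J 1"
proof -
  have "of_nat t * (\<Sum>c<p. w 1 c * w 2 (t + c)) -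
     (\<Sum>c<p. w 1 c * w 1 (t + c) - w 2 (t + c) + delta c * w 2 t) \<in> J 1"
    unfolding sum_distrib_left
  proof (rule J_sum_cong)
    fix c
    have "delta c * w 1 (t + c) = delta c * w 1 t"
      by (simp add: delta_def w_add_dvd)
    moreover have "delta (t + c) * w 1 (t + c) = 0" by (simp add: delta_def w_def)
    ultimately have "of_nat t * (w 1 c * w 2 (t + c)) - (w 1 c * w 1 (t + c) - w 2 (t + c) + delta c * w 2 t)
      = w 1 (t + c) * (of_nat t * (w 1 c * w 1 (t + c)) - (w 1 c - w 1 (t + c) + delta c * w 1 t + delta (t + c) * w 1 t))"
      unfolding w2 by (rule partial_fraction_algebra)
    also have "\<dots> \<in> J 1" by (intro J_mult_left[OF J_w] w_partial_fraction t)
    finally show "of_nat t * (w 1 c * w 2 (t + c)) - (w 1 c * w 1 (t + c) - w 2 (t + c) + delta c * w 2 t) \<in> J 1" .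
  qed
  hence "of_nat t * (\<Sum>c<p. w 1 c * w 2 (t + c)) - ((\<Sum>c<p. w 1 c * w 1 (t + c)) - H 2 p + w 2 t) \<in> J 1"
    by (simp add: sum.distrib sum_subtractf sum_w sum_shift_w sum_delta flip: sum_distrib_right)
  from J_add[OF J_diff[OF this H2_J1] conv_w11[of t]]
  have "of_nat t * (\<Sum>c<p. w 1 c * w 2 (t + c)) - 3 * w 2 t \<in> J 1" by (simp add: algebra_simps)
  from J1_cancel_left[OF t this] show ?thesis
    using w_Suc[of 2 t] by (simp add: mult_ac J_sum J_mult_left J_w eval_nat_numeral)
qed

text \<open>Multiplying the partial fraction by both inverses leaves the difference of the
  convolutions with exponents (2, 1) and (1, 2), which are \<open>- 3 * w 3 t\<close> and
  \<open>3 * w 3 t\<close> modulo \<open>p\<close>.\<close>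

lemma conv_w22:
  assumes t: "\<not> p dvd t" shows "(\<Sum>c<p. w 2 c * w 2 (t + c)) + 6 * w 4 t \<in> J 1"
proof -
  have "of_nat t * (\<Sum>c<p. w 2 c * w 2 (t + c)) -
     (\<Sum>c<p. w 2 c * w 1 (t + c) - w 1 c * w 2 (t + c)) \<in> J 1"
    unfolding sum_distrib_left
  proof (rule J_sum_cong)
    fix c
    have "delta c * w 1 c = 0" "delta (t + c) * w 1 (t + c) = 0" by (simp_all add: delta_def w_def)
    hence "of_nat t * (w 2 c * w 2 (t + c)) - (w 2 c * w 1 (t + c) - w 1 c * w 2 (t + c))
      = w 1 c * w 1 (t + c) * (of_nat t * (w 1 c * w 1 (t + c)) - (w 1 c - w 1 (t + c) + delta c * w 1 t + delta (t + c) * w 1 t))"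
      unfolding w2 by (rule partial_fraction_algebra)
    also have "\<dots> \<in> J 1" by (intro J_mult_left w_partial_fraction t J_w)
    finally show "of_nat t * (w 2 c * w 2 (t + c)) - (w 2 c * w 1 (t + c) - w 1 c * w 2 (t + c)) \<in> J 1" .
  qed
  hence 1: "of_nat t * (\<Sum>c<p. w 2 c * w 2 (t + c)) -
     ((\<Sum>c<p. w 2 c * w 1 (t + c)) - (\<Sum>c<p. w 1 c * w 2 (t + c))) \<in> J 1"
    by (simp add: sum_subtractf)
  have "(\<Sum>c<p. w 2 c * w 1 (t + c)) + 3 * w 3 t \<in> J 1"
  proof -
    have "of_nat t * (\<Sum>c<p. w 2 c * w 1 (t + c)) -
       (\<Sum>c<p. w 2 c - w 1 c * w 1 (t + c) + delta (t + c) * w 1 c * w 1 t) \<in> J 1"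
      unfolding sum_distrib_left
    proof (rule J_sum_cong)
      fix c
      have "delta c * w 1 c = 0" by (simp add: delta_def w_def)
      hence "of_nat t * (w 2 c * w 1 (t + c)) - (w 2 c - w 1 c * w 1 (t + c) + delta (t + c) * w 1 c * w 1 t)
        = w 1 c * (of_nat t * (w 1 c * w 1 (t + c)) - (w 1 c - w 1 (t + c) + delta c * w 1 t + delta (t + c) * w 1 t))"
        unfolding w2 by (rule partial_fraction_algebra)
      also have "\<dots> \<in> J 1" by (intro J_mult_left[OF J_w] w_partial_fraction t)
      finally show "of_nat t * (w 2 c * w 1 (t + c)) - (w 2 c - w 1 c * w 1 (t + c) + delta (t + c) * w 1 c * w 1 t) \<in> J 1" .
    qed
    \<comment> \<open>Where \<open>delta (t + c)\<close> is nonzero, \<open>c\<close> is congruent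
      to \<open>- t\<close>, so \<open>w 1 c\<close> may be replaced by
      \<open>- w 1 t\<close>.\<close>
    moreover have "(\<Sum>c<p. w 2 c - w 1 c * w 1 (t + c) + delta (t + c) * w 1 c * w 1 t)
       - (\<Sum>c<p. w 2 c - w 1 c * w 1 (t + c) - delta (t + c) * w 2 t) \<in> J 1"
    proof (rule J_sum_cong)
      fix c
      have "delta (t + c) * (w 1 t + w 1 c) \<in> J 1"
        using w1_neg[of t c] by (simp add: delta_def)
      from J_mult_left[OF J_w[of 1 t] this]
      show "w 2 c - w 1 c * w 1 (t + c) + delta (t + c) * w 1 c * w 1 t
          - (w 2 c - w 1 c * w 1 (t + c) - delta (t + c) * w 2 t) \<in> J 1"
        unfolding w2 by (simp add: algebra_simps)
    qed
    ultimately have "of_nat t * (\<Sum>c<p. w 2 c * w 1 (t + c)) -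
       (\<Sum>c<p. w 2 c - w 1 c * w 1 (t + c) - delta (t + c) * w 2 t) \<in> J 1" by (rule J_trans)
    hence "of_nat t * (\<Sum>c<p. w 2 c * w 1 (t + c)) - (H 2 p - (\<Sum>c<p. w 1 c * w 1 (t + c)) - w 2 t) \<in> J 1"
      by (simp add: sum.distrib sum_subtractf sum_w sum_shift_delta flip: sum_distrib_right)
    from J_diff[OF J_add[OF this H2_J1] conv_w11[of t]]
    have "of_nat t * (\<Sum>c<p. w 2 c * w 1 (t + c)) - (- 3 * w 2 t) \<in> J 1" by (simp add: algebra_simps)
    from J1_cancel_left[OF t this] show ?thesis
      using w_Suc[of 2 t] by (simp add: mult_ac J_sum J_mult_left J_w eval_nat_numeral)
  qed
  from J_diff[OF J_add[OF 1 this] conv_w12[OF t]]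
  have "of_nat t * (\<Sum>c<p. w 2 c * w 2 (t + c)) - (- 6 * w 3 t) \<in> J 1" by (simp add: algebra_simps)
  from J1_cancel_left[OF t this] show ?thesis
    using w_Suc[of 3 t] by (simp add: mult_ac J_sum J_mult_left J_w eval_nat_numeral)
qed

section \<open>Quadruple sums modulo \<open>p\<close> as iterated convolutions\<close>

lemma qsum_nested:
  "qsum R q g = (\<Sum>a\<in>units q. \<Sum>b\<in>units q. \<Sum>c\<in>units q. \<Sum>d\<in>units q. of_bool (R (a + b + c + d)) * g a b c d)"
proof -
  have "qsum R q g = (\<Sum>(a, b, c, d)\<in>units q \<times> units q \<times> units q \<times> units q. of_bool (R (a + b + c + d)) * g a b c d)"
    unfolding qsum_def by (rule sum.mono_neutral_cong_left) (auto simp: quads_def)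
  thus ?thesis by (simp only: sum.cartesian_product)
qed

lemma sum_units_eq: "h 0 = 0 \<Longrightarrow> (\<Sum>d\<in>units p. h d) = (\<Sum>d<p. h d :: rat)"
proof -
  assume "h 0 = 0"
  moreover have "{..<p} = insert 0 (units p)" using p_pos by (auto simp: units_p)
  ultimately show ?thesis by (simp add: in_units_iff)
qed

lemma w_0: "w k 0 = 0"
  by (simp add: w_def)

text \<open>Only \<open>d\<close> congruent to \<open>- s\<close> modulo \<open>p\<close>
  contributes, and its inverse is \<open>- w 1 s\<close>.\<close>

lemma sum_delta_inverse: "(\<Sum>d\<in>units p. delta (s + d) * (1 / of_nat d)) + w 1 s \<in> J 1"
proof -
  have "(\<Sum>d\<in>units p. delta (s + d) * (1 / of_nat d)) = (\<Sum>d<p. delta (s + d) * w 1 d)"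
    by (subst sum_units_eq[symmetric]) (simp_all add: w_0 w_units del: One_nat_def)
  moreover have "(\<Sum>d<p. delta (s + d) * w 1 d) - (\<Sum>d<p. delta (s + d) * (- w 1 s)) \<in> J 1"
  proof (rule J_sum_cong)
    fix d
    have "delta (s + d) * (w 1 s + w 1 d) \<in> J 1"
      using w1_neg[of s d] by (simp add: delta_def)
    thus "delta (s + d) * w 1 d - delta (s + d) * (- w 1 s) \<in> J 1" by (simp add: algebra_simps)
  qed
  moreover have "(\<Sum>d<p. delta (s + d) * (- w 1 s)) = - w 1 s"
    by (simp add: sum_shift_delta flip: sum_distrib_right del: mult_minus_right)
  ultimately show ?thesis by simp
qed

text \<open>The sum over \<open>d\<close> gives \<open>- w 1 (a + b + c)\<close> by
  \<open>sum_delta_inverse\<close>, and the sum over \<open>c\<close> then gives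
  \<open>- 2 * w 2 (a + b)\<close> by \<open>conv_w11\<close>. The weights on \<open>a\<close> and
  \<open>b\<close> stay arbitrary.\<close>

lemma qsum_p_conv:
  assumes F: "\<And>a. a \<in> units p \<Longrightarrow> F a \<in> J 0" and G: "\<And>b. b \<in> units p \<Longrightarrow> G b \<in> J 0"
  shows "qsum (\<lambda>s. p dvd s) p (\<lambda>a b c d. F a * G b * (1 / of_nat c) * (1 / of_nat d))
    - (- 2) * (\<Sum>a\<in>units p. \<Sum>b\<in>units p. F a * G b * w 2 (a + b)) \<in> J 1"
proof -
  let ?A = "\<Sum>a\<in>units p. \<Sum>b\<in>units p. F a * G b * (\<Sum>c\<in>units p. 1 / of_nat c *
        (\<Sum>d\<in>units p. delta (a + b + c + d) * (1 / of_nat d)))"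
  have eq: "qsum (\<lambda>s. p dvd s) p (\<lambda>a b c d. F a * G b * (1 / of_nat c) * (1 / of_nat d))
    = ?A"
    unfolding qsum_nested sum_distrib_left delta_def by (simp add: mult_ac)
  have "?A - (\<Sum>a\<in>units p. \<Sum>b\<in>units p. F a * G b * (- 2 * w 2 (a + b))) \<in> J 1"
  proof (intro J_sum_cong)
    fix a b assume ab: "a \<in> units p" "b \<in> units p"
    have "(\<Sum>c\<in>units p. 1 / of_nat c * (\<Sum>d\<in>units p. delta (a + b + c + d) * (1 / of_nat d)))
        - (\<Sum>c\<in>units p. 1 / of_nat c * (- w 1 (a + b + c))) \<in> J 1"
    proof (rule J_sum_cong)
      fix c assume c: "c \<in> units p"
      from J_mult_left[OF J_inverse_units[OF c] sum_delta_inverse[of "a + b + c"]]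
      show "1 / of_nat c * (\<Sum>d\<in>units p. delta (a + b + c + d) * (1 / of_nat d))
        - 1 / of_nat c * (- w 1 (a + b + c)) \<in> J 1" by (simp add: algebra_simps)
    qed
    moreover have "(\<Sum>c\<in>units p. 1 / of_nat c * (- w 1 (a + b + c))) = - (\<Sum>c<p. w 1 c * w 1 (a + b + c))"
      by (subst sum_units_eq[symmetric]) (simp_all add: w_0 w_units sum_negf del: One_nat_def)
    ultimately have "(\<Sum>c\<in>units p. 1 / of_nat c * (\<Sum>d\<in>units p. delta (a + b + c + d) * (1 / of_nat d)))
      - - (\<Sum>c<p. w 1 c * w 1 (a + b + c)) \<in> J 1" by (simp only:)
    from J_diff[OF this conv_w11[of "a + b"]]
    have *: "(\<Sum>c\<in>units p. 1 / of_nat c * (\<Sum>d\<in>units p. delta (a + b + c + d) * (1 / of_nat d)))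
      - (- 2 * w 2 (a + b)) \<in> J 1" by simp
    from J_mult_left[OF J_mult_left[OF F[OF ab(1)] G[OF ab(2)]] *]
    show "F a * G b * (\<Sum>c\<in>units p. 1 / of_nat c * (\<Sum>d\<in>units p. delta (a + b + c + d) * (1 / of_nat d)))
       - F a * G b * (- 2 * w 2 (a + b)) \<in> J 1" by (simp only: right_diff_distrib)
  qed
  thus ?thesis unfolding eq by (simp only: sum_distrib_left mult.left_commute[of _ "- 2"])
qed

text \<open>The weight sits on the squared variable \<open>a\<close>, so \<open>b\<close> is summed
  by \<open>conv_w12\<close>; the constant is \<open>- 2 * 3\<close>.\<close>

lemma qsum_p_first:
  assumes f: "\<And>a. f a \<in> J 0"
  shows "qsum (\<lambda>s. p dvd s) p (\<lambda>a b c d. f a * (1 / of_nat a) * V a b c d)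
    + 6 * (\<Sum>a\<in>units p. f a * (1 / of_nat a) ^ 5) \<in> J 1"
proof -
  have "qsum (\<lambda>s. p dvd s) p (\<lambda>a b c d. f a * (1 / of_nat a) * V a b c d) =
    qsum (\<lambda>s. p dvd s) p (\<lambda>a b c d. f a * (1 / of_nat a) ^ 2 * (1 / of_nat b) * (1 / of_nat c) * (1 / of_nat d))"
    by (rule qsum_cong) (simp add: V_def power2_eq_square)
  also have "\<dots> - (- 2) * (\<Sum>a\<in>units p. \<Sum>b\<in>units p. f a * (1 / of_nat a) ^ 2 * (1 / of_nat b) * w 2 (a + b)) \<in> J 1"
    by (intro qsum_p_conv J_mult_left[OF f] J_power J_inverse_units)
  finally have 1: "qsum (\<lambda>s. p dvd s) p (\<lambda>a b c d. f a * (1 / of_nat a) * V a b c d)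
     - (- 2) * (\<Sum>a\<in>units p. \<Sum>b\<in>units p. f a * (1 / of_nat a) ^ 2 * (1 / of_nat b) * w 2 (a + b)) \<in> J 1" .
  have "(\<Sum>a\<in>units p. \<Sum>b\<in>units p. f a * (1 / of_nat a) ^ 2 * (1 / of_nat b) * w 2 (a + b))
    - (\<Sum>a\<in>units p. 3 * (f a * (1 / of_nat a) ^ 5)) \<in> J 1"
  proof (rule J_sum_cong)
    fix a assume a: "a \<in> units p"
    have "(\<Sum>b\<in>units p. f a * (1 / of_nat a) ^ 2 * (1 / of_nat b) * w 2 (a + b))
      = f a * (1 / of_nat a) ^ 2 * (\<Sum>b<p. w 1 b * w 2 (a + b))"
      by (subst sum_units_eq[symmetric])
         (simp_all add: w_0 w_units[of _ 1] sum_distrib_left mult_ac del: One_nat_def)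
    moreover have "3 * (f a * (1 / of_nat a) ^ 5) = f a * (1 / of_nat a) ^ 2 * (3 * w 3 a)"
      using a by (simp add: w_units eval_nat_numeral mult_ac)
    moreover have "f a * (1 / of_nat a) ^ 2 * ((\<Sum>b<p. w 1 b * w 2 (a + b)) - 3 * w 3 a) \<in> J 1"
      using a by (intro J_mult_left[OF J_mult_left[OF f J_power[OF J_inverse_units[OF a]]]] conv_w12)
        (simp add: in_units_iff)
    ultimately show "(\<Sum>b\<in>units p. f a * (1 / of_nat a) ^ 2 * (1 / of_nat b) * w 2 (a + b))
      - 3 * (f a * (1 / of_nat a) ^ 5) \<in> J 1" by (simp only: right_diff_distrib)
  qed
  moreover have "(\<Sum>a\<in>units p. 3 * (f a * (1 / of_nat a) ^ 5)) = 3 * (\<Sum>a\<in>units p. f a * (1 / of_nat a) ^ 5)"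
    by (simp only: sum_distrib_left)
  ultimately have "(\<Sum>a\<in>units p. \<Sum>b\<in>units p. f a * (1 / of_nat a) ^ 2 * (1 / of_nat b) * w 2 (a + b))
    - 3 * (\<Sum>a\<in>units p. f a * (1 / of_nat a) ^ 5) \<in> J 1" by (simp only:)
  from J_diff[OF 1 J_mult_left[OF J_numeral[of "num.Bit0 num.One"] this]]
  show ?thesis by (simp add: right_diff_distrib)
qed

text \<open>The weight sits on \<open>b\<close>, so the squared variable \<open>a\<close> is summed
  by \<open>conv_w22\<close>; the constant is \<open>(- 2) * (- 6)\<close>.\<close>

lemma qsum_p_second:
  assumes f: "\<And>a. f a \<in> J 0"
  shows "qsum (\<lambda>s. p dvd s) p (\<lambda>a b c d. f b * (1 / of_nat a) * V a b c d)
    - 12 * (\<Sum>b\<in>units p. f b * (1 / of_nat b) ^ 5) \<in> J 1"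
proof -
  have "qsum (\<lambda>s. p dvd s) p (\<lambda>a b c d. f b * (1 / of_nat a) * V a b c d) =
    qsum (\<lambda>s. p dvd s) p (\<lambda>a b c d. (1 / of_nat a) ^ 2 * (f b * (1 / of_nat b)) * (1 / of_nat c) * (1 / of_nat d))"
    by (rule qsum_cong) (simp add: V_def power2_eq_square)
  also have "\<dots> - (- 2) * (\<Sum>a\<in>units p. \<Sum>b\<in>units p. (1 / of_nat a) ^ 2 * (f b * (1 / of_nat b)) * w 2 (a + b)) \<in> J 1"
    by (intro qsum_p_conv J_mult_left[OF f] J_power J_inverse_units)
  finally have 1: "qsum (\<lambda>s. p dvd s) p (\<lambda>a b c d. f b * (1 / of_nat a) * V a b c d)
     - (- 2) * (\<Sum>b\<in>units p. \<Sum>a\<in>units p. (1 / of_nat a) ^ 2 * (f b * (1 / of_nat b)) * w 2 (a + b)) \<in> J 1"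
    by (subst sum.swap)
  have "(\<Sum>b\<in>units p. \<Sum>a\<in>units p. (1 / of_nat a) ^ 2 * (f b * (1 / of_nat b)) * w 2 (a + b))
    - (\<Sum>b\<in>units p. - 6 * (f b * (1 / of_nat b) ^ 5)) \<in> J 1"
  proof (rule J_sum_cong)
    fix b assume b: "b \<in> units p"
    have "(\<Sum>a\<in>units p. (1 / of_nat a) ^ 2 * (f b * (1 / of_nat b)) * w 2 (a + b))
      = f b * (1 / of_nat b) * (\<Sum>a<p. w 2 a * w 2 (b + a))"
      by (subst sum_units_eq[symmetric])
         (simp_all add: w_0 w_units[of _ 2] sum_distrib_left mult_ac add.commute)
    moreover have "- 6 * (f b * (1 / of_nat b) ^ 5) = f b * (1 / of_nat b) * (- 6 * w 4 b)"
      using b by (simp add: w_units eval_nat_numeral mult_ac)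
    moreover have "f b * (1 / of_nat b) * ((\<Sum>a<p. w 2 a * w 2 (b + a)) - (- 6 * w 4 b)) \<in> J 1"
      using b conv_w22[of b] by (intro J_mult_left[OF J_mult_left[OF f J_inverse_units[OF b]]])
        (simp add: in_units_iff)
    ultimately show "(\<Sum>a\<in>units p. (1 / of_nat a) ^ 2 * (f b * (1 / of_nat b)) * w 2 (a + b))
      - - 6 * (f b * (1 / of_nat b) ^ 5) \<in> J 1" by (simp only: right_diff_distrib)
  qed
  moreover have "(\<Sum>b\<in>units p. - 6 * (f b * (1 / of_nat b) ^ 5)) = - 6 * (\<Sum>b\<in>units p. f b * (1 / of_nat b) ^ 5)"
    by (simp only: sum_distrib_left)
  ultimately have "(\<Sum>b\<in>units p. \<Sum>a\<in>units p. (1 / of_nat a) ^ 2 * (f b * (1 / of_nat b)) * w 2 (a + b))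
    - (- 6) * (\<Sum>b\<in>units p. f b * (1 / of_nat b) ^ 5) \<in> J 1" by (simp only:)
  from J_diff[OF 1 J_mult_left[OF J_numeral[of "num.Bit0 num.One"] this]]
  show ?thesis by (simp add: right_diff_distrib distrib_left)
qed

lemma W_p: "W p \<in> J 1"
proof -
  have "W p + 6 * H 5 p \<in> J 1" using qsum_p_first[of "\<lambda>_. 1"] by (simp add: W_def H_def)
  moreover have "6 * H 5 p \<in> J 1" by (intro J_mult_left[OF J_numeral] H_odd) (use J_p in auto)
  ultimately show ?thesis using J_diff by fastforce
qed

section \<open>Doubling modulo \<open>p\<close>\<close>

abbreviation dbl :: "nat \<Rightarrow> nat" where "dbl u \<equiv> 2 * u mod p"

lemma double_in_quads: 
  "(a, b, c, d) \<in> quads (\<lambda>s. p dvd s) p \<Longrightarrow> (dbl a, dbl b, dbl c, dbl d) \<in> quads (\<lambda>s. p dvd s) p"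
proof -
  assume x: "(a, b, c, d) \<in> quads (\<lambda>s. p dvd s) p"
  have "[dbl a + dbl b + dbl c + dbl d = 2 * a + 2 * b + 2 * c + 2 * d] (mod p)"
    by (intro cong_add) simp_all
  moreover have "p dvd 2 * a + 2 * b + 2 * c + 2 * d"
    using x dvd_mult[of p "a + b + c + d" 2] by (simp add: in_quads_iff)
  ultimately have "p dvd dbl a + dbl b + dbl c + dbl d"
    by (simp add: cong_dvd_iff)
  thus ?thesis using x double_in_units by (simp add: in_quads_iff)
qed

text \<open>Doubling modulo \<open>p\<close> is an injective self-map of a finite set. It preserves
  divisibility of the sum by \<open>p\<close>, but not the value of the sum.\<close>

lemma qsum_double: "qsum (\<lambda>s. p dvd s) p (\<lambda>a b c d. g (dbl a) (dbl b) (dbl c) (dbl d)) = qsum (\<lambda>s. p dvd s) p g"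
proof -
  let ?Z = "quads (\<lambda>s. p dvd s) p" and ?D = "\<lambda>(a, b, c, d). (dbl a, dbl b, dbl c, dbl d)"
  have inj: "inj_on ?D ?Z"
    using inj_double by (auto simp: inj_on_def in_quads_iff)
  have "?D ` ?Z \<subseteq> ?Z" using double_in_quads by auto
  from endo_inj_surj[OF finite_quads this inj] inj have "bij_betw ?D ?Z ?Z"
    by (simp add: bij_betw_def)
  from sum.reindex_bij_betw[OF this, of "\<lambda>(a, b, c, d). g a b c d"]
  show ?thesis unfolding qsum_def by (simp add: case_prod_unfold)
qed

lemma mult_first_order:
  assumes "A - (x + y) \<in> J s" "B - (x' + y') \<in> J s" "x \<in> J 0" "x' \<in> J 0" "y \<in> J r" "y' \<in> J r" "s = r + r"
  shows "A * B - (x * x' + (x * y' + x' * y)) \<in> J s"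
proof -
  have y: "y \<in> J 0" "y' \<in> J 0" using assms(5,6) J_mono by blast+
  have A: "A \<in> J 0" using J_add[OF J_mono[OF assms(1), of 0] J_add[OF assms(3) y(1)]] by simp
  have yy: "y * y' \<in> J s" using J_mult[OF assms(5,6)] assms(7) by simp
  have "A * B - (x * x' + (x * y' + x' * y)) = A * (B - (x' + y')) + (x' + y') * (A - (x + y)) + y * y'"
    by (simp add: algebra_simps)
  also have "\<dots> \<in> J s"
    by (intro J_add[of _ s] J_mult_left[OF A assms(2)] J_mult_left[OF J_add[OF assms(4) y(2)] assms(1)] yy)
  finally show ?thesis .
qed

text \<open>The product of four expansions from \<open>inverse_double\<close>. The main term has
  denominator 16 and each correction has denominator 32, whence the factor 32.\<close>

lemma V_double:
  assumes "a \<in> units p" "b \<in> units p" "c \<in> units p" "d \<in> units p"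
  shows "32 * V (dbl a) (dbl b) (dbl c) (dbl d) - (2 * V a b c d + of_nat p *
     (of_nat (2 * a div p) * (1 / of_nat a) * V a b c d + of_nat (2 * b div p) * (1 / of_nat b) * V a b c d
    + of_nat (2 * c div p) * (1 / of_nat c) * V a b c d + of_nat (2 * d div p) * (1 / of_nat d) * V a b c d)) \<in> J 2"
proof -
  define x where "x u = (1 / of_nat (2 * u) :: rat)" for u
  define y where "y u = (of_nat p * of_nat (2 * u div p) * x u ^ 2)" for u
  have x: "x u \<in> J 0" if "u \<in> units p" for u
    using that dvd_double_iff unfolding x_def by (intro J_inverse_dvd) (simp add: in_units_iff)
  have y: "y u \<in> J 1" if "u \<in> units p" for u
    unfolding y_def by (intro J_mult_right[OF _ J_mult_right[OF _ J_p]] J_of_nat J_power x that)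
  have D: "1 / of_nat (dbl u) - (x u + y u) \<in> J 2" if "u \<in> units p" for u
    using inverse_double[OF that] by (simp add: x_def y_def)
  have xx: "x u * x v \<in> J 0" if "u \<in> units p" "v \<in> units p" for u v
    by (intro J_mult_left x that)
  have xy: "x u * y v + x v * y u \<in> J 1" if "u \<in> units p" "v \<in> units p" for u v
    by (intro J_add J_mult_left x y that)
  \<comment> \<open>\<open>mult_first_order\<close> is applied to the pairs \<open>a\<close>,
    \<open>b\<close> and \<open>c\<close>, \<open>d\<close> and then to their products; the
    bracketing follows this.\<close>
  have "1 / of_nat (dbl a) * (1 / of_nat (dbl b)) * (1 / of_nat (dbl c) * (1 / of_nat (dbl d)))
     - (x a * x b * (x c * x d) + (x a * x b * (x c * y d + x d * y c) + x c * x d * (x a * y b + x b * y a))) \<in> J 2"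
    by (intro mult_first_order[where r = 1] D x y xx xy assms) simp_all
  from J_mult_left[OF J_numeral[of "num.Bit0 (num.Bit0 (num.Bit0 (num.Bit0 (num.Bit0 num.One))))"] this]
  show ?thesis by (simp add: V_def x_def y_def power2_eq_square algebra_simps)
qed

text \<open>Sum \<open>V_double\<close> over all quadruples. By symmetry the four corrections are
  equal sums \<open>X\<close>, so \<open>30 * U p\<close> is \<open>4 * p * X\<close> modulo p^2,
  and \<open>X\<close> is \<open>- 6 * Phi 5\<close> modulo \<open>p\<close>.\<close>

lemma U_double: "30 * U p + 24 * of_nat p * Phi 5 \<in> J 2"
proof -
  let ?f = "\<lambda>u. of_nat (2 * u div p) :: rat" and ?R = "\<lambda>s. p dvd s"
  define X where "X = qsum ?R p (\<lambda>a b c d. ?f a * (1 / of_nat a) * V a b c d)"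
  have X': "qsum ?R p (\<lambda>a b c d. ?f b * (1 / of_nat b) * V a b c d) = X"
    "qsum ?R p (\<lambda>a b c d. ?f c * (1 / of_nat c) * V a b c d) = X"
    "qsum ?R p (\<lambda>a b c d. ?f d * (1 / of_nat d) * V a b c d) = X"
    unfolding X_def
    using qsum_swap(1)[of ?R p "\<lambda>a b c d. ?f a * (1 / of_nat a) * V a b c d"]
      qsum_swap(2)[of ?R p "\<lambda>a b c d. ?f a * (1 / of_nat a) * V a b c d"]
      qsum_swap(3)[of ?R p "\<lambda>a b c d. ?f a * (1 / of_nat a) * V a b c d"]
    by (simp_all add: V_def mult_ac)
  have "qsum ?R p (\<lambda>a b c d. 32 * V (dbl a) (dbl b) (dbl c) (dbl d)) - qsum ?R p (\<lambda>a b c d. 2 * V a b c d + of_nat p *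
     (?f a * (1 / of_nat a) * V a b c d + ?f b * (1 / of_nat b) * V a b c d
    + ?f c * (1 / of_nat c) * V a b c d + ?f d * (1 / of_nat d) * V a b c d)) \<in> J 2"
    by (intro J_qsum_cong V_double)
  hence 1: "32 * U p - (2 * U p + of_nat p * (X + X + X + X)) \<in> J 2"
    by (simp only: qsum_cmult qsum_add qsum_double X' X_def[symmetric] U_def[symmetric])
  have "X + 6 * Phi 5 \<in> J 1"
    unfolding X_def Phi_def by (intro qsum_p_first J_of_nat)
  from J_add[OF 1 J_mult_left[OF J_numeral[of "num.Bit0 (num.Bit0 num.One)"] J_mult_J1[OF J_p this]]]
  show ?thesis by (simp add: algebra_simps)
qed

text \<open>The weight \<open>m = (a + b + c + d) / p\<close> separates the values of the sum;
  doubling replaces it by \<open>2 * m\<close> minus the four carries. Summation gives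
  \<open>30 * M\<close> \<equiv> \<open>- (X + 3 * Y)\<close>, where \<open>X\<close> and
  \<open>Y\<close> are \<open>- 6 * Phi 5\<close> and \<open>12 * Phi 5\<close> modulo
  \<open>p\<close>.\<close>

lemma M_double: "30 * (Q 1 p + 2 * Q 2 p + 3 * Q 3 p) + 30 * Phi 5 \<in> J 1"
proof -
  let ?f = "\<lambda>u. of_nat (2 * u div p) :: rat" and ?R = "\<lambda>s. p dvd s"
  define h where "h a b c d = 1 / of_nat a * V a b c d" for a b c d
  define m where "m a b c d = (of_nat ((a + b + c + d) div p) :: rat)" for a b c d
  define M where "M = qsum ?R p (\<lambda>a b c d. m a b c d * h a b c d)"
  define X where "X = qsum ?R p (\<lambda>a b c d. ?f a * (1 / of_nat a) * V a b c d)"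
  define Y where "Y = qsum ?R p (\<lambda>a b c d. ?f b * (1 / of_nat a) * V a b c d)"
  have XY: "qsum ?R p (\<lambda>a b c d. ?f a * h a b c d) = X"
    "qsum ?R p (\<lambda>a b c d. ?f b * h a b c d) = Y"
    "qsum ?R p (\<lambda>a b c d. ?f c * h a b c d) = Y"
    "qsum ?R p (\<lambda>a b c d. ?f d * h a b c d) = Y"
    unfolding X_def Y_def h_def
    using qsum_swap(4)[of ?R p "\<lambda>a b c d. ?f b * (1 / of_nat a) * V a b c d"]
      qsum_swap(5)[of ?R p "\<lambda>a b c d. ?f b * (1 / of_nat a) * V a b c d"]
    by (simp_all add: V_def mult_ac)
  have M: "M = Q 1 p + 2 * Q 2 p + 3 * Q 3 p"
  proof -
    have "qsum (\<lambda>s. s = k * p) p (\<lambda>a b c d. m a b c d * h a b c d) = of_nat k * Q k p" for k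
      unfolding Q_def qsum_cmult[symmetric] by (rule qsum_cong) (use p_pos in \<open>simp add: m_def h_def\<close>)
    from this[of 1] this[of 2] this[of 3] show ?thesis
      unfolding M_def using p_pos by (simp add: qsum_dvd)
  qed
  have "qsum ?R p (\<lambda>a b c d. 32 * (m (dbl a) (dbl b) (dbl c) (dbl d) * h (dbl a) (dbl b) (dbl c) (dbl d)))
     - qsum ?R p (\<lambda>a b c d. 2 * (m a b c d * h a b c d)
          - (?f a * h a b c d + ?f b * h a b c d + ?f c * h a b c d + ?f d * h a b c d)) \<in> J 1"
  proof (rule J_qsum_cong)
    fix a b c d assume u: "a \<in> units p" "b \<in> units p" "c \<in> units p" "d \<in> units p" and s: "p dvd a + b + c + d"
    have s': "p dvd dbl a + dbl b + dbl c + dbl d"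
      using double_in_quads[of a b c d] u s by (simp add: in_quads_iff)
    have div: "of_nat (t div p) = (of_nat t / of_nat p :: rat)" if "p dvd t" for t
      using that p_pos by (auto simp: dvd_def)
    have m: "m (dbl a) (dbl b) (dbl c) (dbl d) = 2 * m a b c d - (?f a + ?f b + ?f c + ?f d)"
      unfolding m_def div[OF s] div[OF s'] of_nat_add of_nat_double_mod using p_pos
      by (simp add: field_simps)
    have m0: "2 * m a b c d - (?f a + ?f b + ?f c + ?f d) \<in> J 0"
      unfolding m_def by (intro J_diff J_add J_mult_left[OF J_numeral] J_of_nat)
    have r: "1 / of_nat (dbl x) - 1 / of_nat (2 * x) \<in> J 1" "1 / of_nat (dbl x) \<in> J 0" "1 / of_nat (2 * x) \<in> J 0"
      if "x \<in> units p" for x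
    proof -
      show i: "1 / of_nat (2 * x) \<in> J 0"
        using that dvd_double_iff by (intro J_inverse_dvd) (simp add: in_units_iff)
      have "of_nat p * of_nat (2 * x div p) * (1 / of_nat (2 * x)) ^ 2 \<in> J 1"
        by (intro J_mult_right[OF _ J_mult_right[OF _ J_p]] J_of_nat J_power i)
      from J_add[OF J_mono[OF inverse_double[OF that], of 1] this]
      show "1 / of_nat (dbl x) - 1 / of_nat (2 * x) \<in> J 1" by simp
      show "1 / of_nat (dbl x) \<in> J 0" by (rule J_inverse_units[OF double_in_units[OF that]])
    qed
    have "h (dbl a) (dbl b) (dbl c) (dbl d) - h (2 * a) (2 * b) (2 * c) (2 * d) \<in> J 1"
      unfolding h_def V_def by (intro J_mult_cong r J_mult_left[of _ _ 0] u)
    hence "(2 * m a b c d - (?f a + ?f b + ?f c + ?f d)) *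
        (32 * (h (dbl a) (dbl b) (dbl c) (dbl d) - h (2 * a) (2 * b) (2 * c) (2 * d))) \<in> J 1"
      by (intro J_mult_left[OF m0] J_mult_left[OF J_numeral])
    moreover have "h a b c d = 32 * h (2 * a) (2 * b) (2 * c) (2 * d)" by (simp add: h_def V_def)
    ultimately show "32 * (m (dbl a) (dbl b) (dbl c) (dbl d) * h (dbl a) (dbl b) (dbl c) (dbl d)) -
        (2 * (m a b c d * h a b c d) - (?f a * h a b c d + ?f b * h a b c d + ?f c * h a b c d + ?f d * h a b c d)) \<in> J 1"
      unfolding m by (simp add: algebra_simps)
  qed
  hence 1: "32 * M - (2 * M - (X + Y + Y + Y)) \<in> J 1"
    unfolding qsum_cmult qsum_diff qsum_add XY M_def
    using qsum_double[of "\<lambda>a b c d. m a b c d * h a b c d"] by simp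
  have 2: "X + 6 * Phi 5 \<in> J 1"
    unfolding X_def Phi_def by (intro qsum_p_first J_of_nat)
  have 3: "Y - 12 * Phi 5 \<in> J 1"
    unfolding Y_def Phi_def by (intro qsum_p_second J_of_nat)
  from J_diff[OF J_diff[OF 1 2] J_mult_left[OF J_numeral[of "num.Bit1 num.One"] 3]]
  show ?thesis unfolding M by (simp add: algebra_simps)
qed

end

section \<open>Lifting from \<open>q\<close> to \<open>p q\<close>\<close>

lemma sum_interchange4:
  "(\<Sum>a\<in>A. \<Sum>x\<in>X. \<Sum>b\<in>A. \<Sum>y\<in>X. \<Sum>c\<in>A. \<Sum>z\<in>X. \<Sum>d\<in>A. \<Sum>t\<in>X. f a b c d x y z t) =
   (\<Sum>a\<in>A. \<Sum>b\<in>A. \<Sum>c\<in>A. \<Sum>d\<in>A. \<Sum>x\<in>X. \<Sum>y\<in>X. \<Sum>z\<in>X. \<Sum>t\<in>X. f a b c d x y z t)"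
proof -
  have 1: "(\<Sum>c\<in>A. \<Sum>z\<in>X. \<Sum>d\<in>A. g c z d) = (\<Sum>c\<in>A. \<Sum>d\<in>A. \<Sum>z\<in>X. g c z d)" for g
    by (rule sum.cong[OF refl]) (rule sum.swap)
  have 2: "(\<Sum>b\<in>A. \<Sum>y\<in>X. \<Sum>c\<in>A. \<Sum>d\<in>A. g b y c d) = (\<Sum>b\<in>A. \<Sum>c\<in>A. \<Sum>d\<in>A. \<Sum>y\<in>X. g b y c d)" for g
    by (rule sum.cong[OF refl], subst sum.swap, rule sum.cong[OF refl]) (rule sum.swap)
  have 3: "(\<Sum>x\<in>X. \<Sum>b\<in>A. \<Sum>c\<in>A. \<Sum>d\<in>A. g x b c d) = (\<Sum>b\<in>A. \<Sum>c\<in>A. \<Sum>d\<in>A. \<Sum>x\<in>X. g x b c d)" for g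
    by (subst sum.swap, rule sum.cong[OF refl], subst sum.swap, rule sum.cong[OF refl]) (rule sum.swap)
  show ?thesis unfolding 1 2 3 ..
qed

context prime_ge5 begin

text \<open>The sum over the leading digits when the four variables are lifted to
  \<open>a + q x\<close>, \<open>b + q y\<close>, \<open>c + q z\<close>, \<open>d + q t\<close>;
  the predicate constrains the digit sum.\<close>

definition dsum :: "(nat \<Rightarrow> bool) \<Rightarrow> (nat \<Rightarrow> nat \<Rightarrow> nat \<Rightarrow> nat \<Rightarrow> rat) \<Rightarrow> rat" where
  "dsum R h = (\<Sum>x<p. \<Sum>y<p. \<Sum>z<p. \<Sum>t<p. of_bool (R (x + y + z + t)) * h x y z t)"

lemma dsum_add: "dsum R (\<lambda>x y z t. g x y z t + h x y z t) = dsum R g + dsum R h"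
  unfolding dsum_def by (simp only: distrib_left sum.distrib)

lemma dsum_diff: "dsum R (\<lambda>x y z t. g x y z t - h x y z t) = dsum R g - dsum R h"
  unfolding dsum_def by (simp only: right_diff_distrib sum_subtractf)

lemma dsum_cmult: "dsum R (\<lambda>x y z t. k * g x y z t) = k * dsum R g"
  unfolding dsum_def by (simp only: sum_distrib_left mult.left_commute)

lemma J_dsum: "(\<And>x y z t. h x y z t \<in> J k) \<Longrightarrow> dsum R h \<in> J k"
  unfolding dsum_def by (intro J_sum J_mult_left[of "of_bool _"]) auto

lemma dsum_swap:
  "dsum R (\<lambda>x y z t. h y x z t) = dsum R h"
  "dsum R (\<lambda>x y z t. h x z y t) = dsum R h"
  "dsum R (\<lambda>x y z t. h x y t z) = dsum R h"
  unfolding dsum_def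
  by (subst sum.swap, simp add: add.commute)
     (rule sum.cong[OF refl], subst sum.swap, simp add: add.commute add.left_commute,
      rule sum.cong[OF refl], rule sum.cong[OF refl], subst sum.swap, simp add: add.commute add.left_commute)

text \<open>Lifting changes the sum \<open>s\<close> to \<open>s + q * (x + y + z + t)\<close>:
  divisibility by \<open>q\<close> is unaffected and the quotient grows by the digit sum.\<close>

lemma qsum_lift:
  assumes "p dvd q" "0 < q"
  shows "qsum (\<lambda>s. q dvd s \<and> R (s div q)) (p * q) g = qsum (\<lambda>s. q dvd s) q (\<lambda>a b c d.
     dsum (\<lambda>k. R ((a + b + c + d) div q + k)) (\<lambda>x y z t. g (a + q * x) (b + q * y) (c + q * z) (d + q * t)))"
proof -
  have *: "of_bool (q dvd (a + q * x) + (b + q * y) + (c + q * z) + (d + q * t) \<and>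
       R (((a + q * x) + (b + q * y) + (c + q * z) + (d + q * t)) div q)) * u
     = of_bool (q dvd a + b + c + d) * (of_bool (R ((a + b + c + d) div q + (x + y + z + t))) * u)"
    for a b c d x y z t and u :: rat
  proof -
    have e: "(a + q * x) + (b + q * y) + (c + q * z) + (d + q * t) = (a + b + c + d) + q * (x + y + z + t)"
      by (simp add: algebra_simps)
    show ?thesis unfolding e using assms(2) by (simp add: dvd_add_left_iff add.commute del: add_mult_distrib2)
  qed
  show ?thesis
    unfolding qsum_nested sum_units_lift[OF assms] sum_interchange4 dsum_def sum_distrib_left * ..
qed

text \<open>Indices record the order in \<open>q\<close>; products of total order at least three
  fall into \<open>J (3 * r)\<close>.\<close>

lemma mult_second_order:
  assumes "A - (x0 + x1 + x2) \<in> J (3 * r)" "B - (y0 + y1 + y2) \<in> J (3 * r)"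
    and x: "x0 \<in> J 0" "x1 \<in> J r" "x2 \<in> J (2 * r)" and y: "y0 \<in> J 0" "y1 \<in> J r" "y2 \<in> J (2 * r)"
  shows "A * B - (x0 * y0 + (x0 * y1 + x1 * y0) + (x0 * y2 + x1 * y1 + x2 * y0)) \<in> J (3 * r)"
proof -
  have 0: "x1 \<in> J 0" "x2 \<in> J 0" "y1 \<in> J 0" "y2 \<in> J 0" using x y J_mono by blast+
  have A: "A \<in> J 0" using J_add[OF J_mono[OF assms(1), of 0] J_add[OF J_add[OF x(1) 0(1)] 0(2)]] by simp
  have 12: "x1 * y2 \<in> J (3 * r)" "x2 * y1 \<in> J (3 * r)"
    using J_mult[OF x(2) y(3)] J_mult[OF x(3) y(2)] by (simp_all add: algebra_simps)
  have 22: "x2 * y2 \<in> J (3 * r)" by (rule J_mono[OF J_mult[OF x(3) y(3)]]) simp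
  have "A * B - (x0 * y0 + (x0 * y1 + x1 * y0) + (x0 * y2 + x1 * y1 + x2 * y0))
    = A * (B - (y0 + y1 + y2)) + (y0 + y1 + y2) * (A - (x0 + x1 + x2)) + (x1 * y2 + x2 * y1 + x2 * y2)"
    by (simp add: algebra_simps)
  also have "\<dots> \<in> J (3 * r)"
    by (intro J_add[of _ "3 * r"] J_mult_left[OF A assms(2)] J_mult_left[OF _ assms(1)] J_add[of _ 0] 0 y 12 22)
  finally show ?thesis .
qed

lemma inverse_second_order:
  assumes q: "p dvd q" "of_nat q \<in> J r" and a: "a \<in> units q"
  shows "1 / of_nat (a + q * x) - (1 / of_nat a + - (of_nat q * (of_nat x * (1 / of_nat a) ^ 2))
     + of_nat q * of_nat q * (of_nat x ^ 2 * (1 / of_nat a) ^ 3)) \<in> J (3 * r)"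
proof -
  have nd: "\<not> p dvd a + q * x" using q a by (auto simp: in_units_iff dvd_add_left_iff)
  hence nz: "of_nat a + of_nat q * of_nat x \<noteq> (0 :: rat)"
    by (metis dvd_0_right of_nat_0_eq_iff of_nat_add of_nat_mult)
  have id: "1 / (a + y) - (1 / a + - (y * (1 / a) ^ 2) + y * y * (1 / a) ^ 3) = - (y * y * y * ((1 / a) ^ 3 * (1 / (a + y))))"
    if "a \<noteq> 0" "a + y \<noteq> 0" for a y :: rat
    using that by (simp add: divide_simps) (simp add: algebra_simps eval_nat_numeral)
  have "1 / of_nat (a + q * x) - (1 / of_nat a + - (of_nat q * (of_nat x * (1 / of_nat a) ^ 2))
     + of_nat q * of_nat q * (of_nat x ^ 2 * (1 / of_nat a) ^ 3)) =
     - (of_nat q * of_nat q * of_nat q * (of_nat x ^ 3 * ((1 / of_nat a) ^ 3 * (1 / of_nat (a + q * x)))) :: rat)"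
    using id[OF units_pos(2)[OF a] nz] by (simp add: power2_eq_square power3_eq_cube mult_ac)
  also have "\<dots> \<in> J (3 * r)"
  proof -
    have q3: "of_nat q * of_nat q * of_nat q \<in> J (3 * r)"
      by (rule J_mono[OF J_mult[OF J_mult[OF q(2) q(2)] q(2)]]) simp
    show ?thesis unfolding J_uminus_iff
      by (intro J_mult_right[OF _ q3] J_mult_left[of _ _ 0] J_power J_of_nat J_inverse_units[OF a] J_inverse_dvd nd)
  qed
  finally show ?thesis .
qed

text \<open>The number of admissible digit quadruples and the moments of their digits: all the
  information about the digit condition that enters a second-order expansion.\<close>

definition moment0 :: "(nat \<Rightarrow> bool) \<Rightarrow> rat" where "moment0 R = dsum R (\<lambda>x y z t. 1)"
definition moment1 :: "(nat \<Rightarrow> bool) \<Rightarrow> rat" where "moment1 R = dsum R (\<lambda>x y z t. of_nat x)"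
definition moment2 :: "(nat \<Rightarrow> bool) \<Rightarrow> rat" where "moment2 R = dsum R (\<lambda>x y z t. of_nat x ^ 2)"
definition moment11 :: "(nat \<Rightarrow> bool) \<Rightarrow> rat" where "moment11 R = dsum R (\<lambda>x y z t. of_nat x * of_nat y)"

lemma dsum_monomials:
  "dsum R (\<lambda>x y z t. 1) = moment0 R"
  "dsum R (\<lambda>x y z t. of_nat x) = moment1 R" "dsum R (\<lambda>x y z t. of_nat y) = moment1 R"
  "dsum R (\<lambda>x y z t. of_nat z) = moment1 R" "dsum R (\<lambda>x y z t. of_nat t) = moment1 R"
  "dsum R (\<lambda>x y z t. of_nat x ^ 2) = moment2 R" "dsum R (\<lambda>x y z t. of_nat y ^ 2) = moment2 R"
  "dsum R (\<lambda>x y z t. of_nat z ^ 2) = moment2 R" "dsum R (\<lambda>x y z t. of_nat t ^ 2) = moment2 R"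
  "dsum R (\<lambda>x y z t. of_nat x * of_nat y) = moment11 R" "dsum R (\<lambda>x y z t. of_nat x * of_nat z) = moment11 R"
  "dsum R (\<lambda>x y z t. of_nat x * of_nat t) = moment11 R" "dsum R (\<lambda>x y z t. of_nat y * of_nat z) = moment11 R"
  "dsum R (\<lambda>x y z t. of_nat y * of_nat t) = moment11 R" "dsum R (\<lambda>x y z t. of_nat z * of_nat t) = moment11 R"
proof -
  show x: "dsum R (\<lambda>x y z t. 1) = moment0 R" "dsum R (\<lambda>x y z t. of_nat x) = moment1 R"
    "dsum R (\<lambda>x y z t. of_nat x ^ 2) = moment2 R" "dsum R (\<lambda>x y z t. of_nat x * of_nat y) = moment11 R"
    by (simp_all only: moment0_def moment1_def moment2_def moment11_def)
  show y: "dsum R (\<lambda>x y z t. of_nat y) = moment1 R" "dsum R (\<lambda>x y z t. of_nat y ^ 2) = moment2 R"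
    unfolding x(2,3)[symmetric] by (rule dsum_swap(1))+
  show z: "dsum R (\<lambda>x y z t. of_nat z) = moment1 R" "dsum R (\<lambda>x y z t. of_nat z ^ 2) = moment2 R"
    unfolding y[symmetric] by (rule dsum_swap(2))+
  show "dsum R (\<lambda>x y z t. of_nat t) = moment1 R" "dsum R (\<lambda>x y z t. of_nat t ^ 2) = moment2 R"
    unfolding z[symmetric] by (rule dsum_swap(3))+
  show xz: "dsum R (\<lambda>x y z t. of_nat x * of_nat z) = moment11 R"
    unfolding x(4)[symmetric] by (rule dsum_swap(2))
  show xt: "dsum R (\<lambda>x y z t. of_nat x * of_nat t) = moment11 R"
    unfolding xz[symmetric] by (rule dsum_swap(3))
  show "dsum R (\<lambda>x y z t. of_nat y * of_nat z) = moment11 R"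
    unfolding xz[symmetric] by (rule dsum_swap(1))
  show yt: "dsum R (\<lambda>x y z t. of_nat y * of_nat t) = moment11 R"
    unfolding xt[symmetric] by (rule dsum_swap(1))
  show "dsum R (\<lambda>x y z t. of_nat z * of_nat t) = moment11 R"
    unfolding yt[symmetric] by (rule dsum_swap(2))
qed

text \<open>\<open>V1\<close>, \<open>V2\<close> and \<open>V11\<close> are, up to sign, the
  coefficients of the expansion of \<open>V\<close> at lifted arguments, grouped by digit monomials
  that have equal moments.\<close>

definition V1 :: "nat \<Rightarrow> nat \<Rightarrow> nat \<Rightarrow> nat \<Rightarrow> rat" where
  "V1 a b c d = V a b c d * (1 / of_nat a + 1 / of_nat b + 1 / of_nat c + 1 / of_nat d)"

definition V2 :: "nat \<Rightarrow> nat \<Rightarrow> nat \<Rightarrow> nat \<Rightarrow> rat" where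
  "V2 a b c d = V a b c d * ((1 / of_nat a) ^ 2 + (1 / of_nat b) ^ 2 + (1 / of_nat c) ^ 2 + (1 / of_nat d) ^ 2)"

definition V11 :: "nat \<Rightarrow> nat \<Rightarrow> nat \<Rightarrow> nat \<Rightarrow> rat" where
  "V11 a b c d = V a b c d *
     (1 / of_nat a * (1 / of_nat b) + 1 / of_nat a * (1 / of_nat c) + 1 / of_nat a * (1 / of_nat d)
    + 1 / of_nat b * (1 / of_nat c) + 1 / of_nat b * (1 / of_nat d) + 1 / of_nat c * (1 / of_nat d))"

lemma dsum_V:
  assumes q: "p dvd q" "of_nat q \<in> J r"
    and u: "a \<in> units q" "b \<in> units q" "c \<in> units q" "d \<in> units q"
  shows "dsum R (\<lambda>x y z t. V (a + q * x) (b + q * y) (c + q * z) (d + q * t)) -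
    (moment0 R * V a b c d - of_nat q * moment1 R * V1 a b c d
      + of_nat q * of_nat q * (moment2 R * V2 a b c d + moment11 R * V11 a b c d)) \<in> J (3 * r)"
proof -
  let ?Q = "of_nat q :: rat"
  let ?a = "1 / of_nat a :: rat" and ?b = "1 / of_nat b :: rat" and ?c = "1 / of_nat c :: rat" and ?d = "1 / of_nat d :: rat"
  let ?V = "V a b c d"
  \<comment> \<open>The second-order Taylor polynomial as a combination of digit monomials, so that
    \<open>dsum_monomials\<close> evaluates it; \<open>?V * 1\<close> represents the constant
    monomial.\<close>
  let ?h = "\<lambda>x y z t :: nat. ?V * 1
     + ((- (?Q * ?V * ?a)) * of_nat x + (- (?Q * ?V * ?b)) * of_nat y + (- (?Q * ?V * ?c)) * of_nat z + (- (?Q * ?V * ?d)) * of_nat t)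
     + ((?Q * ?Q * ?V * ?a ^ 2) * of_nat x ^ 2 + (?Q * ?Q * ?V * ?b ^ 2) * of_nat y ^ 2
      + (?Q * ?Q * ?V * ?c ^ 2) * of_nat z ^ 2 + (?Q * ?Q * ?V * ?d ^ 2) * of_nat t ^ 2)
     + ((?Q * ?Q * ?V * ?a * ?b) * (of_nat x * of_nat y) + (?Q * ?Q * ?V * ?a * ?c) * (of_nat x * of_nat z)
      + (?Q * ?Q * ?V * ?a * ?d) * (of_nat x * of_nat t) + (?Q * ?Q * ?V * ?b * ?c) * (of_nat y * of_nat z)
      + (?Q * ?Q * ?V * ?b * ?d) * (of_nat y * of_nat t) + (?Q * ?Q * ?V * ?c * ?d) * (of_nat z * of_nat t))"
  have qq: "?Q * ?Q \<in> J (2 * r)" using J_mult[OF q(2) q(2)] by (simp add: mult_2)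
  define i1 where "i1 e x = - (?Q * (of_nat x * (1 / of_nat e) ^ 2))" for e x
  define i2 where "i2 e x = ?Q * ?Q * (of_nat x ^ 2 * (1 / of_nat e) ^ 3)" for e x
  have i: "1 / of_nat (e + q * x) - (1 / of_nat e + i1 e x + i2 e x) \<in> J (3 * r)"
    "1 / of_nat e \<in> J 0" "i1 e x \<in> J r" "i2 e x \<in> J (2 * r)" if "e \<in> units q" for e x
  proof -
    show "1 / of_nat (e + q * x) - (1 / of_nat e + i1 e x + i2 e x) \<in> J (3 * r)"
      unfolding i1_def i2_def by (rule inverse_second_order[OF q that])
    show "i1 e x \<in> J r" unfolding i1_def J_uminus_iff
      by (intro J_mult_right[OF _ q(2)] J_mult_left[of _ _ 0] J_of_nat J_power J_inverse_units[OF that])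
    show "i2 e x \<in> J (2 * r)" unfolding i2_def
      by (intro J_mult_right[OF _ qq] J_mult_left[of _ _ 0] J_of_nat J_power J_inverse_units[OF that])
  qed (rule J_inverse_units[OF that])
  have rr: "x * y \<in> J (2 * r)" if "x \<in> J r" "y \<in> J r" for x y using J_mult[OF that] by (simp add: mult_2)
  have "dsum R (\<lambda>x y z t. V (a + q * x) (b + q * y) (c + q * z) (d + q * t)) - dsum R ?h \<in> J (3 * r)"
    unfolding dsum_diff[symmetric]
  proof (rule J_dsum)
    fix x y z t :: nat
    have "1 / of_nat (a + q * x) * (1 / of_nat (b + q * y)) * (1 / of_nat (c + q * z) * (1 / of_nat (d + q * t)))
      - (?a * ?b * (?c * ?d)
       + (?a * ?b * (?c * i1 d t + i1 c z * ?d) + (?a * i1 b y + i1 a x * ?b) * (?c * ?d))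
       + (?a * ?b * (?c * i2 d t + i1 c z * i1 d t + i2 c z * ?d) + (?a * i1 b y + i1 a x * ?b) * (?c * i1 d t + i1 c z * ?d)
         + (?a * i2 b y + i1 a x * i1 b y + i2 a x * ?b) * (?c * ?d))) \<in> J (3 * r)"
      by (intro mult_second_order i u J_add[of _ "r"] J_add[of _ "2 * r"] J_mult_left J_mult_right rr)
    thus "V (a + q * x) (b + q * y) (c + q * z) (d + q * t) - ?h x y z t \<in> J (3 * r)"
      by (simp add: V_def i1_def i2_def power2_eq_square power3_eq_cube algebra_simps)
  qed
  also have "dsum R ?h = moment0 R * V a b c d - of_nat q * moment1 R * V1 a b c d
      + of_nat q * of_nat q * (moment2 R * V2 a b c d + moment11 R * V11 a b c d)"
    unfolding dsum_add dsum_cmult dsum_monomials V1_def V2_def V11_def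
    by (simp add: algebra_simps)
  finally show ?thesis .
qed

end

text \<open>Closed forms for \<open>dsum_eq\<close>. The parameter \<open>c\<close> is kept apart
  from the upper limit \<open>k\<close>, so that induction on \<open>k\<close> goes through.\<close>

lemma sum_arith_mult_square:
  "(\<Sum>x\<le>k. (c - of_nat x + 1) :: rat) = (of_nat k + 1) * (2 * c - of_nat k + 2) / 2"
  "(\<Sum>x\<le>k. (c - of_nat x + 1) * (c - of_nat x + 2) / 2 :: rat) =
     (c + 1) * (c + 2) / 2 * (of_nat k + 1) - (2 * c + 3) * of_nat k * (of_nat k + 1) / 4
      + of_nat k * (of_nat k + 1) * (2 * of_nat k + 1) / 12"
  "(\<Sum>x\<le>k. of_nat x ^ 2 * ((c - of_nat x + 1) * (c - of_nat x + 2) / 2) :: rat) =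
     (c + 1) * (c + 2) * of_nat k * (of_nat k + 1) * (2 * of_nat k + 1) / 12
      - (2 * c + 3) * of_nat k ^ 2 * (of_nat k + 1) ^ 2 / 8
      + of_nat k * (of_nat k + 1) * (2 * of_nat k + 1) * (3 * of_nat k ^ 2 + 3 * of_nat k - 1) / 60"
  by (induction k) (simp_all add: field_simps power2_eq_square)

context prime_ge5 begin

text \<open>The digit \<open>t\<close> is determined modulo \<open>p\<close> by the other three, and
  \<open>z\<close> is then free, which gives a factor \<open>p\<close>.\<close>

lemma moment_dvd:
  defines "R \<equiv> \<lambda>m k. p dvd m + k"
  shows "moment0 (R m) = of_nat p ^ 3" "moment1 (R m) \<in> J 2" "moment2 (R m) \<in> J 1" "moment11 (R m) \<in> J 1"
proof -
  have *: "dsum (R m) (\<lambda>x y z t. f x y) = of_nat p * (\<Sum>x<p. \<Sum>y<p. f x y)" for f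
  proof -
    have e: "(\<Sum>t<p. of_bool (p dvd m + (x + y + z + t)) * u) = (u :: rat)" for x y z u
      using sum_shift_delta[of "m + x + y + z"]
      by (simp add: delta_def add.assoc flip: sum_distrib_right)
    show ?thesis unfolding dsum_def R_def e by (simp add: sum_distrib_left)
  qed
  show "moment0 (R m) = of_nat p ^ 3" unfolding moment0_def *[of "\<lambda>x y. 1"] by (simp add: power3_eq_cube)
  have "moment1 (R m) = of_nat p * (of_nat p * (\<Sum>x<p. of_nat x))"
    unfolding moment1_def *[of "\<lambda>x y. of_nat x"] by (simp add: sum_distrib_left)
  thus "moment1 (R m) \<in> J 2" using J_mult_J1[OF J_p J_mult_left[OF J_of_nat sum_id_p]] by simp
  have "moment2 (R m) = of_nat p * (\<Sum>x<p. of_nat p * of_nat x ^ 2)"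
    unfolding moment2_def *[of "\<lambda>x y. of_nat x ^ 2"] by simp
  thus "moment2 (R m) \<in> J 1"
    by (simp only:) (intro J_mult_right[OF _ J_p] J_sum J_mult_left[of _ _ 0] J_of_nat J_power)
  have "moment11 (R m) = of_nat p * (\<Sum>x<p. \<Sum>y<p. of_nat x * of_nat y)"
    unfolding moment11_def *[of "\<lambda>x y. of_nat x * of_nat y"] ..
  thus "moment11 (R m) \<in> J 1"
    by (simp only:) (intro J_mult_right[OF _ J_p] J_sum J_mult_left[of _ _ 0] J_of_nat)
qed

text \<open>As \<open>T < p\<close>, the bound on the digits follows from their sum, so the weight
  of \<open>x\<close> is the number of triples of natural numbers with sum
  \<open>T - x\<close>.\<close>

lemma dsum_eq:
  assumes "T < p"
  shows "dsum (\<lambda>k. k = T) (\<lambda>x y z t. f x) =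
    (\<Sum>x\<le>T. f x * ((of_nat T - of_nat x + 1) * (of_nat T - of_nat x + 2) / 2))"
proof -
  have cut: "(\<Sum>z<p. of_bool (s + z \<le> T) * g (s + z)) = of_bool (s \<le> T) * (\<Sum>z\<le>T - s. g (s + z) :: rat)" for s g
  proof (cases "s \<le> T")
    case True
    have "(\<Sum>z<p. of_bool (s + z \<le> T) * g (s + z)) = (\<Sum>z\<le>T - s. g (s + z))"
      using True assms by (intro sum.mono_neutral_cong_right) auto
    thus ?thesis using True by simp
  qed auto
  have 1: "(\<Sum>t<p. of_bool (x + y + z + t = T)) = (of_bool (x + y + z \<le> T) :: rat)" for x y z
  proof (cases "x + y + z \<le> T")
    case True
    hence "(\<Sum>t<p. of_bool (x + y + z + t = T)) = (\<Sum>t<p. if t = T - (x + y + z) then 1 else (0 :: rat))"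
      by (intro sum.cong) auto
    thus ?thesis using True assms by simp
  qed auto
  have 2: "(\<Sum>z<p. of_bool (x + y + z \<le> T)) = (of_bool (x + y \<le> T) * (of_nat T - of_nat (x + y) + 1) :: rat)" for x y
    using cut[of "x + y" "\<lambda>_. 1"] by (cases "x + y \<le> T") (auto simp: of_nat_diff)
  have 3: "(\<Sum>y<p. of_bool (x + y \<le> T) * (of_nat T - of_nat (x + y) + 1)) =
      (of_bool (x \<le> T) * ((of_nat T - of_nat x + 1) * (of_nat T - of_nat x + 2) / 2) :: rat)" for x
  proof (cases "x \<le> T")
    case True
    have "(\<Sum>y<p. of_bool (x + y \<le> T) * (of_nat T - of_nat (x + y) + 1)) =
      (\<Sum>y\<le>T - x. of_nat (T - x) - of_nat y + 1 :: rat)"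
      using True cut[of x "\<lambda>s. of_nat T - of_nat s + 1"] by (simp add: of_nat_diff algebra_simps)
    also have "\<dots> = (of_nat T - of_nat x + 1) * (of_nat T - of_nat x + 2) / 2"
      unfolding sum_arith_mult_square using True by (simp add: of_nat_diff algebra_simps)
    finally show ?thesis using True by simp
  qed auto
  have "dsum (\<lambda>k. k = T) (\<lambda>x y z t. f x) = (\<Sum>x<p. \<Sum>y<p. \<Sum>z<p. (\<Sum>t<p. of_bool (x + y + z + t = T)) * f x)"
    unfolding dsum_def by (simp only: sum_distrib_right)
  also have "\<dots> = (\<Sum>x<p. (\<Sum>y<p. \<Sum>z<p. of_bool (x + y + z \<le> T)) * f x)"
    unfolding 1 by (simp only: sum_distrib_right)
  also have "\<dots> = (\<Sum>x<p. of_bool (0 + x \<le> T) * (f (0 + x) * ((of_nat T - of_nat (0 + x) + 1) * (of_nat T - of_nat (0 + x) + 2) / 2)))"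
    unfolding 2 3 by (simp add: mult_ac)
  also have "\<dots> = (\<Sum>x\<le>T. f x * ((of_nat T - of_nat x + 1) * (of_nat T - of_nat x + 2) / 2))"
    unfolding cut[of 0 "\<lambda>x. f x * ((of_nat T - of_nat x + 1) * (of_nat T - of_nat x + 2) / 2)"] by simp
  finally show ?thesis .
qed

text \<open>The digits sum to \<open>T = p - m\<close>, so \<open>moment0\<close> is the binomial
  coefficient of \<open>T + 3\<close> over 3, and one of \<open>T + 1\<close>, \<open>T + 2\<close>,
  \<open>T + 3\<close> is \<open>p\<close>. Summing the digits gives \<open>moment1\<close>;
  squaring their sum gives \<open>moment11\<close> from \<open>moment2\<close>.\<close>

lemma moment_eq:
  assumes "m \<in> {1, 2, 3}"
  defines "R \<equiv> \<lambda>k. m + k = p"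
  shows "6 * moment0 R = (of_nat p - of_nat m + 1) * (of_nat p - of_nat m + 2) * (of_nat p - of_nat m + 3)"
    and "4 * moment1 R = (of_nat p - of_nat m) * moment0 R"
    and "moment0 R \<in> J 1" and "p \<ge> 7 \<Longrightarrow> moment2 R \<in> J 1" and "p \<ge> 7 \<Longrightarrow> moment11 R \<in> J 1"
    and "moment1 R \<in> J 0" "moment2 R \<in> J 0" "moment11 R \<in> J 0"
proof -
  define T where "T = p - m"
  have T: "T < p" "of_nat T = (of_nat p - of_nat m :: rat)"
    using assms(1) p_ge5 by (auto simp: T_def of_nat_diff)
  have R: "R = (\<lambda>k. k = T)" using assms(1) p_ge5 by (auto simp: R_def T_def fun_eq_iff)
  show 6: "6 * moment0 R = (of_nat p - of_nat m + 1) * (of_nat p - of_nat m + 2) * (of_nat p - of_nat m + 3)"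
    unfolding R moment0_def dsum_eq[OF T(1), of "\<lambda>_. 1"] mult_1 sum_arith_mult_square T(2)[symmetric]
    by (simp add: field_simps)
  have dvd: "(of_nat p - of_nat m + 1) * (of_nat p - of_nat m + 2) * (of_nat p - of_nat m + 3) \<in> J 1"
  proof -
    let ?P = "of_nat p :: rat"
    have "(?P - of_nat m + 1) * (?P - of_nat m + 2) * (?P - of_nat m + 3) =
       ?P * (if m = 1 then (?P + 1) * (?P + 2) else if m = 2 then (?P - 1) * (?P + 1) else (?P - 2) * (?P - 1))"
      using assms(1) by (auto simp: algebra_simps)
    also have "\<dots> \<in> J 1"
      by (rule J_mult_right[OF _ J_p]) (auto intro!: J_mult_left J_add J_diff)
    finally show ?thesis .
  qed
  show NJ: "moment0 R \<in> J 1"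
    using dvd J_cancel[OF coprime_6, of "moment0 R" 1] by (simp add: 6)
  show moment1: "4 * moment1 R = (of_nat p - of_nat m) * moment0 R"
  proof -
    have "4 * moment1 R = dsum R (\<lambda>x y z t. of_nat x + of_nat y + of_nat z + of_nat t)"
      unfolding dsum_add dsum_monomials by simp
    also have "\<dots> = dsum R (\<lambda>x y z t. of_nat T * 1)"
      unfolding dsum_def R by (auto intro!: sum.cong simp flip: of_nat_add)
    also have "\<dots> = (of_nat p - of_nat m) * moment0 R" unfolding dsum_cmult dsum_monomials T(2) ..
    finally show ?thesis .
  qed
  have m2: "120 * moment2 R = (6 * moment0 R) * (of_nat T * (2 * of_nat T + 3))"
    unfolding 6 unfolding R moment2_def dsum_eq[OF T(1), of "\<lambda>x. of_nat x ^ 2"] sum_arith_mult_square T(2)[symmetric]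
    by (simp add: field_simps power2_eq_square)
  have m11: "12 * moment11 R = (of_nat p - of_nat m) ^ 2 * moment0 R - 4 * moment2 R"
  proof -
    have "4 * moment2 R + 12 * moment11 R = dsum R (\<lambda>x y z t. of_nat x ^ 2 + of_nat y ^ 2 + of_nat z ^ 2 + of_nat t ^ 2
       + 2 * (of_nat x * of_nat y + of_nat x * of_nat z + of_nat x * of_nat t
         + of_nat y * of_nat z + of_nat y * of_nat t + of_nat z * of_nat t))"
      unfolding dsum_add dsum_cmult dsum_monomials by simp
    also have "\<dots> = dsum R (\<lambda>x y z t. of_nat T ^ 2 * 1)"
      unfolding dsum_def R
    proof (intro sum.cong refl)
      fix x y z t
      have "of_nat x ^ 2 + of_nat y ^ 2 + of_nat z ^ 2 + of_nat t ^ 2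
       + 2 * (of_nat x * of_nat y + of_nat x * of_nat z + of_nat x * of_nat t
         + of_nat y * of_nat z + of_nat y * of_nat t + of_nat z * of_nat t) = (of_nat (x + y + z + t) ^ 2 :: rat)"
        by (simp add: power2_eq_square algebra_simps)
      thus "of_bool (x + y + z + t = T) * (of_nat x ^ 2 + of_nat y ^ 2 + of_nat z ^ 2 + of_nat t ^ 2
       + 2 * (of_nat x * of_nat y + of_nat x * of_nat z + of_nat x * of_nat t
         + of_nat y * of_nat z + of_nat y * of_nat t + of_nat z * of_nat t)) =
         of_bool (x + y + z + t = T) * (of_nat T ^ 2 * 1 :: rat)" by auto
    qed
    also have "\<dots> = (of_nat p - of_nat m) ^ 2 * moment0 R" unfolding dsum_cmult dsum_monomials T(2) ..
    finally show ?thesis by simp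
  qed
  show "moment1 R \<in> J 0" "moment2 R \<in> J 0" "moment11 R \<in> J 0"
    unfolding moment1_def moment2_def moment11_def by (intro J_dsum J_mult_left J_of_nat J_power)+
  {
    assume "p \<ge> 7"
    \<comment> \<open>The closed form of \<open>moment2\<close> has denominator 120, divisible by 5,
      hence \<open>p \<ge> 7\<close>.\<close>
    have c5: "coprime 5 p" using coprime_small[of 5] \<open>p \<ge> 7\<close> by simp
    have "coprime (6 * 2 * 2 * 5) p" using coprime_2 coprime_6 c5 by (simp only: coprime_mult_left_iff)
    hence c120: "coprime 120 p" by simp
    have "coprime (6 * 2) p" using coprime_2 coprime_6 by (simp only: coprime_mult_left_iff)
    hence c12: "coprime 12 p" by simp
    have "120 * moment2 R \<in> J 1"
      unfolding m2 by (intro J_mult_right[of _ _ 1] J_mult_left[OF J_numeral NJ] J_mult_left[of _ _ 0] J_add J_of_nat J_numeral)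
    thus moment2: "moment2 R \<in> J 1" using J_cancel[OF c120, of "moment2 R" 1] by simp
    have "12 * moment11 R \<in> J 1"
      unfolding m11 by (intro J_diff[of _ 1] J_mult_left[OF _ NJ] J_mult_left[OF J_numeral moment2] J_power J_diff J_of_nat)
    thus "moment11 R \<in> J 1" using J_cancel[OF c12, of "moment11 R" 1] by simp
  }
qed

section \<open>Reflection of \<open>S\<close> and the lifts of \<open>U\<close>, \<open>W\<close>,
  \<open>Q\<close> and \<open>S\<close>\<close>

lemma J_V1: "a \<in> units q \<Longrightarrow> b \<in> units q \<Longrightarrow> c \<in> units q \<Longrightarrow> d \<in> units q \<Longrightarrow> V1 a b c d \<in> J 0"
  and J_V2: "a \<in> units q \<Longrightarrow> b \<in> units q \<Longrightarrow> c \<in> units q \<Longrightarrow> d \<in> units q \<Longrightarrow> V2 a b c d \<in> J 0"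
  and J_V11: "a \<in> units q \<Longrightarrow> b \<in> units q \<Longrightarrow> c \<in> units q \<Longrightarrow> d \<in> units q \<Longrightarrow> V11 a b c d \<in> J 0"
  unfolding V1_def V2_def V11_def
  by (intro J_mult_left[of _ _ 0] J_add[of _ 0] J_power; (rule J_V J_inverse_units; assumption))+

lemma qsum_V1: "qsum R q V1 = 4 * qsum R q (\<lambda>a b c d. 1 / of_nat a * V a b c d)"
proof -
  let ?g = "\<lambda>a b c d. 1 / of_nat a * V a b c d"
  have V1: "V1 = (\<lambda>a b c d. ?g a b c d + ?g b a c d + ?g c b a d + ?g d b c a)"
    by (intro ext) (simp only: V1_def V_def distrib_left mult_ac)
  have "qsum R q V1 = qsum R q ?g + qsum R q (\<lambda>a b c d. ?g b a c d)
      + qsum R q (\<lambda>a b c d. ?g c b a d) + qsum R q (\<lambda>a b c d. ?g d b c a)"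
    unfolding V1 qsum_add ..
  also have "\<dots> = 4 * qsum R q ?g"
    unfolding qsum_swap(1)[of R q ?g] qsum_swap(2)[of R q ?g] qsum_swap(3)[of R q ?g] by simp
  finally show ?thesis .
qed

text \<open>Expand each \<open>1 / (q - a)\<close> as \<open>- (1 / a + q / a^2)\<close> modulo q^2.
  The four signs cancel, and the first-order term \<open>q * V1\<close> sums to
  \<open>4 * q * Q 1 q\<close>.\<close>

lemma S_reflect:
  assumes q: "p dvd q" "of_nat q \<in> J r"
  shows "S 3 q - (S 1 q + 4 * of_nat q * Q 1 q) \<in> J (2 * r)"
proof -
  have r: "1 / of_nat (q - a) - (- (1 / of_nat a) + - (of_nat q * (1 / of_nat a) ^ 2)) \<in> J (2 * r)"
    "- (1 / of_nat a) \<in> J 0" "- (of_nat q * (1 / of_nat a) ^ 2) \<in> J r" if a: "a \<in> units q" for a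
  proof -
    note b = reflect_in_units[OF q(1) a]
    have "1 / (y - x) - (- (1 / x) + - (y * (1 / x) ^ 2)) = y * y * ((1 / x) ^ 2 * (1 / (y - x)))"
      if "x \<noteq> 0" "y - x \<noteq> 0" for x y :: rat
      using that by (simp add: divide_simps) (simp add: algebra_simps eval_nat_numeral)
    from this[of "of_nat a" "of_nat q"] units_pos(2)[OF a] units_pos(2)[OF b] a
    have "1 / of_nat (q - a) - (- (1 / of_nat a) + - (of_nat q * (1 / of_nat a) ^ 2))
        = of_nat q * of_nat q * ((1 / of_nat a) ^ 2 * (1 / of_nat (q - a)) :: rat)"
      by (simp add: in_units_iff of_nat_diff)
    also have "\<dots> \<in> J (r + r)"
      by (intro J_mult_right[OF _ J_mult[OF q(2) q(2)]] J_mult_left[of _ _ 0] J_power J_inverse_units[OF a] J_inverse_units[OF b])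
    finally show "1 / of_nat (q - a) - (- (1 / of_nat a) + - (of_nat q * (1 / of_nat a) ^ 2)) \<in> J (2 * r)"
      by (simp add: mult_2)
    show "- (1 / of_nat a) \<in> J 0" "- (of_nat q * (1 / of_nat a) ^ 2) \<in> J r"
      unfolding J_uminus_iff by (intro J_inverse_units[OF a] J_mult_right[OF _ q(2)] J_power)+
  qed
  have "S 3 q - qsum (\<lambda>s. s = q) q (\<lambda>a b c d. V a b c d + of_nat q * V1 a b c d) \<in> J (2 * r)"
    unfolding S_def qsum_reflect[OF q(1), symmetric]
  proof (rule J_qsum_cong)
    fix a b c d assume u: "a \<in> units q" "b \<in> units q" "c \<in> units q" "d \<in> units q"
    define y where "y e = - (of_nat q * (1 / of_nat e :: rat) ^ 2)" for e
    note r' = r[folded y_def]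
    have "1 / of_nat (q - a) * (1 / of_nat (q - b)) * (1 / of_nat (q - c) * (1 / of_nat (q - d)))
      - (- (1 / of_nat a) * - (1 / of_nat b) * (- (1 / of_nat c) * - (1 / of_nat d))
       + (- (1 / of_nat a) * - (1 / of_nat b) * (- (1 / of_nat c) * y d + - (1 / of_nat d) * y c)
        + - (1 / of_nat c) * - (1 / of_nat d) * (- (1 / of_nat a) * y b + - (1 / of_nat b) * y a))) \<in> J (2 * r)"
      by (intro mult_first_order[where r = r] J_add[of _ r] J_mult_left[of _ _ r] J_mult_left[of _ _ 0] r' u) simp_all
    thus "V (q - a) (q - b) (q - c) (q - d) - (V a b c d + of_nat q * V1 a b c d) \<in> J (2 * r)"
      by (simp add: V_def V1_def y_def power2_eq_square algebra_simps add_divide_distrib)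
  qed
  thus ?thesis by (simp add: qsum_add qsum_cmult qsum_V1 S_def Q_def mult_ac)
qed

text \<open>The condition on the digits is a divisibility, so \<open>moment_dvd\<close> applies: the
  main term is \<open>p^3 * U q\<close>, the linear term gains p^2 from \<open>moment1\<close>, and
  the quadratic one has order 2r + 1.\<close>

lemma U_lift:
  assumes r: "r \<ge> 1" and U: "U (p ^ r) \<in> J (r - 1)"
  shows "U (p * p ^ r) \<in> J (r + 2)"
proof -
  define q where "q = p ^ r"
  have q: "p dvd q" "0 < q" "of_nat q \<in> J r" using r p_pos J_p_power by (auto simp: q_def)
  define R where "R a b c d = (\<lambda>k. p dvd (a + b + c + d) div q + k)" for a b c d
  have "U (p * q) = qsum (\<lambda>s. q dvd s \<and> p dvd s div q) (p * q) V"
    unfolding U_def using q by (intro arg_cong[of _ _ "\<lambda>R. qsum R (p * q) V"] ext)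
      (auto simp: dvd_div_iff_mult mult.commute dest: dvd_mult_right)
  also have "\<dots> = qsum (\<lambda>s. q dvd s) q (\<lambda>a b c d. dsum (R a b c d)
     (\<lambda>x y z t. V (a + q * x) (b + q * y) (c + q * z) (d + q * t)))"
    unfolding qsum_lift[OF q(1,2)] R_def ..
  finally have eq: "U (p * q) = qsum (\<lambda>s. q dvd s) q (\<lambda>a b c d. dsum (R a b c d)
     (\<lambda>x y z t. V (a + q * x) (b + q * y) (c + q * z) (d + q * t)))" .
  have "U (p * q) - qsum (\<lambda>s. q dvd s) q (\<lambda>a b c d. of_nat p ^ 3 * V a b c d) \<in> J (r + 2)"
    unfolding eq
  proof (rule J_qsum_cong)
    fix a b c d assume u: "a \<in> units q" "b \<in> units q" "c \<in> units q" "d \<in> units q"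
    have 1: "dsum (R a b c d) (\<lambda>x y z t. V (a + q * x) (b + q * y) (c + q * z) (d + q * t)) -
      (moment0 (R a b c d) * V a b c d - of_nat q * moment1 (R a b c d) * V1 a b c d
      + of_nat q * of_nat q * (moment2 (R a b c d) * V2 a b c d + moment11 (R a b c d) * V11 a b c d)) \<in> J (r + 2)"
      by (rule J_mono[OF dsum_V[OF q(1,3) u]]) (use r in simp)
    have 2: "of_nat q * moment1 (R a b c d) * V1 a b c d \<in> J (r + 2)"
      unfolding R_def by (intro J_mult_right J_V1[OF u] J_mult q(3) moment_dvd)
    have 3: "of_nat q * of_nat q * (moment2 (R a b c d) * V2 a b c d + moment11 (R a b c d) * V11 a b c d) \<in> J (r + r + 1)"
      unfolding R_def by (intro J_mult q(3) J_add J_mult_right[OF J_V2[OF u]] J_mult_right[OF J_V11[OF u]] moment_dvd)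
    have 4: "of_nat q * of_nat q * (moment2 (R a b c d) * V2 a b c d + moment11 (R a b c d) * V11 a b c d) \<in> J (r + 2)"
      by (rule J_mono[OF 3]) (use r in simp)
    have 5: "moment0 (R a b c d) = of_nat p ^ 3" unfolding R_def by (rule moment_dvd)
    from J_add[OF J_diff[OF 1 2] 4]
    show "dsum (R a b c d) (\<lambda>x y z t. V (a + q * x) (b + q * y) (c + q * z) (d + q * t)) - of_nat p ^ 3 * V a b c d \<in> J (r + 2)"
      by (simp add: 5)
  qed
  moreover have "qsum (\<lambda>s. q dvd s) q (\<lambda>a b c d. of_nat p ^ 3 * V a b c d) \<in> J (r + 2)"
    unfolding qsum_cmult U_def[symmetric]
    using J_p_power_mult[OF U, of 3] r by (simp add: q_def)
  ultimately show ?thesis using J_add by (fastforce simp: q_def)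
qed

text \<open>Modulo \<open>p\<close> the summand does not see the digits, so each quadruple below
  \<open>q\<close> contributes its value times the number of admissible digit quadruples.\<close>

lemma qsum_lift_J1:
  assumes q: "p dvd q" "0 < q"
    and "\<And>k. k \<in> {1, 2, 3} \<Longrightarrow> moment0 (\<lambda>l. R (k + l)) \<in> J 1"
  shows "qsum (\<lambda>s. q dvd s \<and> R (s div q)) (p * q) (\<lambda>a b c d. 1 / of_nat a * V a b c d) \<in> J 1"
  unfolding qsum_lift[OF q]
proof (rule J_qsum)
  fix a b c d assume u: "a \<in> units q" "b \<in> units q" "c \<in> units q" "d \<in> units q" and s: "q dvd a + b + c + d"
  let ?R = "\<lambda>k. R ((a + b + c + d) div q + k)"
  have r: "1 / of_nat (e + q * x) - 1 / of_nat e \<in> J 1" "1 / of_nat (e + q * x) \<in> J 0" "1 / of_nat e \<in> J 0"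
    if e: "e \<in> units q" for e x
  proof -
    have nd: "\<not> p dvd e + q * x" using q e by (auto simp: in_units_iff dvd_add_left_iff)
    show i: "1 / of_nat (e + q * x) \<in> J 0" by (rule J_inverse_dvd[OF nd])
    show i': "1 / of_nat e \<in> J 0" by (rule J_inverse_units[OF e])
    have "(of_nat (e + q * x) :: rat) \<noteq> 0" using nd by (metis dvd_0_right of_nat_0_eq_iff)
    hence "1 / of_nat (e + q * x) - 1 / of_nat e = - (1 / of_nat (e + q * x) * (1 / of_nat e) * of_nat (q * x) :: rat)"
      using units_pos(2)[OF e] by (simp add: field_simps)
    also have "\<dots> \<in> J 1"
      unfolding J_uminus_iff by (intro J_mult_left J_mult_left[of _ _ 0] i i' J_dvd) (use q in simp)
    finally show "1 / of_nat (e + q * x) - 1 / of_nat e \<in> (J 1 :: rat set)" .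
  qed
  have "dsum ?R (\<lambda>x y z t. 1 / of_nat (a + q * x) * V (a + q * x) (b + q * y) (c + q * z) (d + q * t))
     - dsum ?R (\<lambda>x y z t. (1 / of_nat a * V a b c d) * 1) \<in> J 1"
    unfolding dsum_diff[symmetric] mult_1_right V_def
    by (intro J_dsum J_mult_cong r J_mult_left[of _ _ 0] u)
  moreover have "dsum ?R (\<lambda>x y z t. (1 / of_nat a * V a b c d) * 1) \<in> J 1"
  proof -
    have "(a + b + c + d) div q \<in> {1, 2, 3}"
      using multiple_of_four_lt[OF s sum_bounds_units[OF u]] q by auto
    from assms(3)[OF this] show ?thesis unfolding dsum_cmult dsum_monomials
      by (intro J_mult_left[of _ _ 1] J_mult_left[of _ _ 0] J_inverse_units[OF u(1)] J_V[OF u])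
  qed
  ultimately show "dsum ?R (\<lambda>x y z t. 1 / of_nat (a + q * x) * V (a + q * x) (b + q * y) (c + q * z) (d + q * t)) \<in> J 1"
    using J_add by fastforce
qed

lemma W_lift: "p dvd q \<Longrightarrow> 0 < q \<Longrightarrow> W (p * q) \<in> J 1"
proof -
  assume q: "p dvd q" "0 < q"
  have "W (p * q) = qsum (\<lambda>s. q dvd s \<and> p dvd s div q) (p * q) (\<lambda>a b c d. 1 / of_nat a * V a b c d)"
    unfolding W_def using q by (intro arg_cong[of _ _ "\<lambda>R. qsum R (p * q) _"] ext)
      (auto simp: dvd_div_iff_mult mult.commute dest: dvd_mult_right)
  also have "\<dots> \<in> J 1"
    using J_mono[OF J_p_power[of 3], of 1] by (intro qsum_lift_J1 q) (simp add: moment_dvd)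
  finally show ?thesis .
qed

lemma eq_mult_iff: "0 < q \<Longrightarrow> (s :: nat) = p * q \<longleftrightarrow> q dvd s \<and> s div q = p"
  by auto

lemma Q1_lift: "p dvd q \<Longrightarrow> 0 < q \<Longrightarrow> Q 1 (p * q) \<in> J 1"
proof -
  assume q: "p dvd q" "0 < q"
  have "Q 1 (p * q) = qsum (\<lambda>s. q dvd s \<and> s div q = p) (p * q) (\<lambda>a b c d. 1 / of_nat a * V a b c d)"
    unfolding Q_def mult_1 eq_mult_iff[OF q(2)] ..
  also have "\<dots> \<in> J 1" by (intro qsum_lift_J1 q moment_eq(3))
  finally show ?thesis .
qed

text \<open>A quadruple with sum \<open>m * q\<close> lifts to sum \<open>p * q\<close> when its
  digits sum to \<open>p - m\<close>; \<open>dsum_V\<close> and \<open>moment_eq\<close> give the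
  terms up to first order. The second-order part \<open>T m\<close> has order 2r, enough for
  \<open>r \<ge> 2\<close>; for \<open>r = 1\<close> the moments supply another factor
  \<open>p\<close> if \<open>p \<ge> 7\<close>.\<close>

lemma S1_lift:
  assumes r: "r \<ge> 2 \<or> r = 1 \<and> p \<ge> 7"
  defines "q \<equiv> p ^ r"
  defines "n \<equiv> \<lambda>m. moment0 (\<lambda>k. m + k = p)"
  shows "S 1 (p * q) - ((n 1 * S 1 q + n 2 * S 2 q + n 3 * S 3 q)
     - of_nat q * ((of_nat p - 1) * n 1 * Q 1 q + (of_nat p - 2) * n 2 * Q 2 q + (of_nat p - 3) * n 3 * Q 3 q)) \<in> J (r + 2)"
proof -
  have q: "p dvd q" "0 < q" "of_nat q \<in> J r" using r p_pos J_p_power by (auto simp: q_def)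
  define R where "R m = (\<lambda>k. m + k = p)" for m
  define T where "T m = of_nat q * of_nat q *
      (moment2 (R m) * qsum (\<lambda>s. s = m * q) q V2 + moment11 (R m) * qsum (\<lambda>s. s = m * q) q V11)" for m
  have T: "T m \<in> J (r + 2)" if "m \<in> {1, 2, 3}" for m
  proof -
    have v: "qsum (\<lambda>s. s = m * q) q V2 \<in> J 0" "qsum (\<lambda>s. s = m * q) q V11 \<in> J 0"
      by (intro J_qsum J_V2 J_V11; assumption)+
    show ?thesis
    proof (cases "r \<ge> 2")
      case True
      have "T m \<in> J (r + r + 0)" unfolding T_def R_def
        by (intro J_mult q(3) J_add J_mult_right[OF v(1)] J_mult_right[OF v(2)] moment_eq that)
      thus ?thesis by (rule J_mono) (use True in simp)
    next
      case False
      have "T m \<in> J (r + r + 1)" unfolding T_def R_def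
        by (intro J_mult q(3) J_add J_mult_right[OF v(1)] J_mult_right[OF v(2)] moment_eq that) (use r False in auto)
      thus ?thesis by (rule J_mono) (use r in auto)
    qed
  qed
  define f where "f m a b c d = moment0 (R m) * V a b c d - of_nat q * moment1 (R m) * V1 a b c d
      + (of_nat q * of_nat q * moment2 (R m) * V2 a b c d + of_nat q * of_nat q * moment11 (R m) * V11 a b c d)" for m a b c d
  have "S 1 (p * q) = qsum (\<lambda>s. q dvd s \<and> s div q = p) (p * q) V"
    unfolding S_def mult_1 eq_mult_iff[OF q(2)] ..
  also have "\<dots> = qsum (\<lambda>s. q dvd s) q (\<lambda>a b c d. dsum (R ((a + b + c + d) div q))
     (\<lambda>x y z t. V (a + q * x) (b + q * y) (c + q * z) (d + q * t)))"
    unfolding qsum_lift[OF q(1,2), of "\<lambda>k. k = p"] R_def ..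
  finally have eq: "S 1 (p * q) = qsum (\<lambda>s. q dvd s) q (\<lambda>a b c d. dsum (R ((a + b + c + d) div q))
     (\<lambda>x y z t. V (a + q * x) (b + q * y) (c + q * z) (d + q * t)))" .
  have "S 1 (p * q) - qsum (\<lambda>s. q dvd s) q (\<lambda>a b c d. f ((a + b + c + d) div q) a b c d) \<in> J (3 * r)"
    unfolding eq
  proof (rule J_qsum_cong)
    fix a b c d assume u: "a \<in> units q" "b \<in> units q" "c \<in> units q" "d \<in> units q"
    from dsum_V[OF q(1,3) u]
    show "dsum (R ((a + b + c + d) div q)) (\<lambda>x y z t. V (a + q * x) (b + q * y) (c + q * z) (d + q * t))
       - f ((a + b + c + d) div q) a b c d \<in> J (3 * r)"
      unfolding f_def by (simp add: distrib_left mult.assoc)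
  qed
  moreover have "qsum (\<lambda>s. s = m * q) q (\<lambda>a b c d. f ((a + b + c + d) div q) a b c d)
     = n m * S m q - of_nat q * ((of_nat p - of_nat m) * n m * Q m q) + T m" if "m \<in> {1, 2, 3}" for m
  proof -
    have "qsum (\<lambda>s. s = m * q) q (\<lambda>a b c d. f ((a + b + c + d) div q) a b c d) = qsum (\<lambda>s. s = m * q) q (f m)"
      by (rule qsum_cong) (use q in simp)
    also have "\<dots> = moment0 (R m) * S m q - of_nat q * (4 * moment1 (R m)) * Q m q + T m"
      unfolding f_def[abs_def] qsum_add qsum_diff qsum_cmult qsum_V1 S_def Q_def T_def by (simp add: algebra_simps)
    also have "4 * moment1 (R m) = (of_nat p - of_nat m) * moment0 (R m)" unfolding R_def by (rule moment_eq(2)[OF that])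
    finally show ?thesis by (simp add: n_def R_def mult.assoc)
  qed
  from this[of 1] this[of 2] this[of 3]
  have "qsum (\<lambda>s. q dvd s) q (\<lambda>a b c d. f ((a + b + c + d) div q) a b c d)
    = (n 1 * S 1 q - of_nat q * ((of_nat p - 1) * n 1 * Q 1 q) + T 1)
    + (n 2 * S 2 q - of_nat q * ((of_nat p - 2) * n 2 * Q 2 q) + T 2)
    + (n 3 * S 3 q - of_nat q * ((of_nat p - 3) * n 3 * Q 3 q) + T 3)"
    unfolding qsum_dvd[OF q(2)] by simp
  ultimately have "S 1 (p * q) - ((n 1 * S 1 q - of_nat q * ((of_nat p - 1) * n 1 * Q 1 q) + T 1)
    + (n 2 * S 2 q - of_nat q * ((of_nat p - 2) * n 2 * Q 2 q) + T 2)
    + (n 3 * S 3 q - of_nat q * ((of_nat p - 3) * n 3 * Q 3 q) + T 3)) \<in> J (3 * r)" by (simp only:)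
  hence 1: "S 1 (p * q) - ((n 1 * S 1 q - of_nat q * ((of_nat p - 1) * n 1 * Q 1 q) + T 1)
    + (n 2 * S 2 q - of_nat q * ((of_nat p - 2) * n 2 * Q 2 q) + T 2)
    + (n 3 * S 3 q - of_nat q * ((of_nat p - 3) * n 3 * Q 3 q) + T 3)) \<in> J (r + 2)"
    by (rule J_mono) (use r in auto)
  have "S 1 (p * q) - ((n 1 * S 1 q + n 2 * S 2 q + n 3 * S 3 q)
     - of_nat q * ((of_nat p - 1) * n 1 * Q 1 q + (of_nat p - 2) * n 2 * Q 2 q + (of_nat p - 3) * n 3 * Q 3 q))
   = (S 1 (p * q) - ((n 1 * S 1 q - of_nat q * ((of_nat p - 1) * n 1 * Q 1 q) + T 1)
    + (n 2 * S 2 q - of_nat q * ((of_nat p - 2) * n 2 * Q 2 q) + T 2)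
    + (n 3 * S 3 q - of_nat q * ((of_nat p - 3) * n 3 * Q 3 q) + T 3))) + (T 1 + T 2 + T 3)"
    by (simp add: distrib_left)
  also have "\<dots> \<in> J (r + 2)" by (intro J_add[of _ "r + 2"] 1 T) simp_all
  finally show ?thesis .
qed

end

section \<open>The modulus \<open>125\<close> and the conclusion\<close>

text \<open>Representatives modulo \<open>125\<close> of the inverses of the numbers prime to \<open>5\<close>.\<close>
definition inverse_table :: "int list" where
  "inverse_table = [0, 1, -62, 42, -31, 0, 21, 18, 47, 14, 0, -34, -52, -48, 9, 0, -39, -22, 7, -46, 0, 6, -17, -38, -26, 0]"

lemma inverse_table_correct:
  "\<forall>i\<le>25. if 5 dvd i then inverse_table ! i = 0 else 125 dvd int i * inverse_table ! i - 1"
  by code_simp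

text \<open>The integer counterpart of \<open>S 1 25\<close> in the form of \<open>S1_conv\<close>;
  the value is congruent to \<open>- 120\<close> modulo 125.\<close>

lemma inverse_table_conv:
  "(\<Sum>i\<le>25. (\<Sum>j\<le>i. inverse_table ! j * inverse_table ! (i - j)) *
     (\<Sum>j\<le>25 - i. inverse_table ! j * inverse_table ! (25 - i - j))) = - 70829620"
  by code_simp

context prime_ge5 begin

text \<open>\<open>S 1 q\<close> is the coefficient of \<open>X^q\<close> in a fourth power of a
  series vanishing at multiples of \<open>p\<close>. Written as the square of a square, it is cheap
  to evaluate.\<close>

lemma S1_conv:
  defines "f \<equiv> \<lambda>i. if p dvd i then 0 else 1 / of_nat i :: rat"
  shows "S 1 q = (\<Sum>i\<le>q. (\<Sum>j\<le>i. f j * f (i - j)) * (\<Sum>j\<le>q - i. f j * f (q - i - j)))"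
proof -
  have "(\<Sum>i\<le>q. (\<Sum>j\<le>i. f j * f (i - j)) * (\<Sum>j\<le>q - i. f j * f (q - i - j)))
     = fps_nth ((Abs_fps f * Abs_fps f) * (Abs_fps f * Abs_fps f)) q"
    by (simp only: fps_mult_nth fps_nth_Abs_fps atLeast0AtMost)
  also have "\<dots> = fps_nth (Abs_fps f ^ 4) q" by (simp add: eval_nat_numeral mult_ac)
  also have "\<dots> = (\<Sum>v\<in>natpermute q 4. \<Prod>j\<in>{0..3}. fps_nth (Abs_fps f) (v ! j))"
    by (simp add: fps_power_nth)
  also have "\<dots> = (\<Sum>v\<in>tuples p 4 q. 1 / of_nat (prod_list v))"
  proof (rule sum.mono_neutral_cong_right)
    show "finite (natpermute q 4)" by (rule natpermute_finite)
    show "tuples p 4 q \<subseteq> natpermute q 4" by (auto simp: tuples_def natpermute_def)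
    show "\<forall>v\<in>natpermute q 4 - tuples p 4 q. (\<Prod>j\<in>{0..3}. fps_nth (Abs_fps f) (v ! j)) = 0"
    proof
      fix v assume v: "v \<in> natpermute q 4 - tuples p 4 q"
      then obtain a b c d where abcd: "v = [a, b, c, d]" "a + b + c + d = q"
        by (auto simp: natpermute_def numeral_eq_Suc length_Suc_conv)
      hence "p dvd a \<or> p dvd b \<or> p dvd c \<or> p dvd d"
        using v by (auto simp: tuples_def prime_to_def coprime_p_iff intro: Nat.gr0I)
      thus "(\<Prod>j\<in>{0..3}. fps_nth (Abs_fps f) (v ! j)) = 0"
        using abcd by (auto simp: numeral_eq_Suc f_def)
    qed
    fix v assume v: "v \<in> tuples p 4 q"
    then obtain a b c d where abcd: "v = [a, b, c, d]"
      by (auto simp: tuples_def numeral_eq_Suc length_Suc_conv)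
    thus "(\<Prod>j\<in>{0..3}. fps_nth (Abs_fps f) (v ! j)) = 1 / of_nat (prod_list v)"
      using v by (auto simp: numeral_eq_Suc f_def tuples_def prime_to_def coprime_p_iff)
  qed
  also have "\<dots> = S 1 q"
    unfolding sum_tuples4 S_def V_def by (simp add: mult_ac)
  finally show ?thesis by simp
qed

text \<open>Each inverse may be replaced by its representative modulo 125. The target
  \<open>- 24 / 5 * 25 * bernoulli 0\<close> equals \<open>- 120\<close>.\<close>

lemma S1_25:
  assumes p: "p = 5" shows "S 1 (p ^ 2) + 120 \<in> J 3"
proof -
  let ?t = "\<lambda>i. of_int (inverse_table ! i) :: rat"
  define f where "f i = (if p dvd i then 0 else 1 / of_nat i :: rat)" for i
  have J125: "of_int n \<in> J 3" if n: "125 dvd n" for n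
  proof -
    obtain k where "n = 125 * k" using n by (rule dvdE)
    hence "of_int n = (of_nat p ^ 3 * of_int k :: rat)" by (simp add: p)
    thus ?thesis using J_p_power_mult[OF J_of_int[of k], of 3] by simp
  qed
  have fJ: "f i \<in> J 0" for i unfolding f_def by (auto intro: J_inverse_dvd)
  have tJ: "?t i \<in> J 0" for i by simp
  have f: "f i - ?t i \<in> J 3" if "i \<le> 25" for i
  proof (cases "5 dvd i")
    case True
    hence "f i = 0" "?t i = 0" using inverse_table_correct that by (auto simp: f_def p)
    thus ?thesis by simp
  next
    case False
    hence "125 dvd int i * inverse_table ! i - 1" using inverse_table_correct that by auto
    moreover have nd: "\<not> p dvd i" using False p by simp
    ultimately have "- (1 / of_nat i * of_int (int i * inverse_table ! i - 1)) \<in> J 3"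
      unfolding J_uminus_iff by (intro J_mult_left J125 J_inverse_dvd)
    also have "- (1 / of_nat i * of_int (int i * inverse_table ! i - 1)) = f i - ?t i"
      using False by (cases "i = 0") (simp_all add: f_def p field_simps)
    finally show ?thesis .
  qed
  let ?A = "\<Sum>i\<le>25. (\<Sum>j\<le>i. f j * f (i - j)) * (\<Sum>j\<le>25 - i. f j * f (25 - i - j))"
  let ?B = "\<Sum>i\<le>25. (\<Sum>j\<le>i. ?t j * ?t (i - j)) * (\<Sum>j\<le>25 - i. ?t j * ?t (25 - i - j))"
  have A: "S 1 25 = ?A" unfolding f_def by (rule S1_conv)
  have "?B = of_int (\<Sum>i\<le>25. (\<Sum>j\<le>i. inverse_table ! j * inverse_table ! (i - j)) *
     (\<Sum>j\<le>25 - i. inverse_table ! j * inverse_table ! (25 - i - j)))"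
    by (simp only: of_int_sum of_int_mult)
  hence B: "?B = of_int (- 70829620)" unfolding inverse_table_conv .
  have AB: "?A - ?B \<in> J 3"
    by (intro J_sum_cong J_mult_cong J_sum J_mult_left[of _ _ 0] f fJ tJ) auto
  have "S 1 25 - of_int (- 70829620) \<in> J 3" using AB unfolding A B .
  from J_add[OF this J125[of "- 70829500"]] have "S 1 25 + 120 \<in> J 3" by (simp add: add.commute)
  moreover have "p ^ 2 = 25" by (simp add: p)
  ultimately show ?thesis by (simp only:)
qed

text \<open>\<open>S_reflect\<close>, \<open>Q_reflect\<close> and the splittings of
  \<open>U\<close> and \<open>W\<close> eliminate \<open>S 2\<close>, \<open>S 3\<close>,
  \<open>Q 2\<close> and \<open>Q 3\<close> from \<open>S1_lift\<close>. The identity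
  \<open>id\<close> collects what remains; its right-hand side is negligible.\<close>

lemma S1_lift_simplified:
  assumes r: "r \<ge> 2 \<or> r = 1 \<and> p \<ge> 7"
    and W: "W (p ^ r) \<in> J 1" and Q1: "r \<ge> 2 \<Longrightarrow> Q 1 (p ^ r) \<in> J 1"
  defines "q \<equiv> p ^ r"
  shows "6 * S 1 (p * q) - (6 * of_nat p * S 1 q + of_nat p * (of_nat p ^ 2 - 1) * U q + 8 * of_nat q * of_nat p * Q 1 q) \<in> J (r + 2)"
proof -
  have q: "p dvd q" "0 < q" "of_nat q \<in> J r" using r p_pos J_p_power by (auto simp: q_def)
  let ?P = "of_nat p :: rat" and ?q = "of_nat q :: rat"
  define n where "n m = moment0 (\<lambda>k. m + k = p)" for m
  define \<rho> where "\<rho> = S 3 q - (S 1 q + 4 * ?q * Q 1 q)"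
  define \<sigma> where "\<sigma> = Q 3 q + Q 1 q"
  have \<rho>: "\<rho> \<in> J (r + 1)" unfolding \<rho>_def by (rule J_mono[OF S_reflect[OF q(1,3)]]) (use r in auto)
  have \<sigma>: "\<sigma> \<in> J 1" unfolding \<sigma>_def by (rule Q_reflect[OF q(1)])
  have n: "6 * n 1 = ?P * (?P + 1) * (?P + 2)" "6 * n 2 = (?P - 1) * ?P * (?P + 1)" "6 * n 3 = (?P - 2) * (?P - 1) * ?P"
    unfolding n_def using moment_eq(1)[of 1] moment_eq(1)[of 2] moment_eq(1)[of 3] by (simp_all add: algebra_simps)
  have S3: "S 3 q = S 1 q + 4 * ?q * Q 1 q + \<rho>" by (simp add: \<rho>_def)
  have S2: "S 2 q = U q - S 1 q - S 3 q" using U_eq[OF q(2)] by simp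
  have Q3: "Q 3 q = \<sigma> - Q 1 q" by (simp add: \<sigma>_def)
  have Q2: "Q 2 q = W q - \<sigma>" using W_eq[OF q(2)] by (simp add: \<sigma>_def)
  have id: "(P * (P + 1) * (P + 2) * s1 + (P - 1) * P * (P + 1) * (u - s1 - (s1 + 4 * q * q1 + e)) + (P - 2) * (P - 1) * P * (s1 + 4 * q * q1 + e))
      - q * ((P - 1) * (P * (P + 1) * (P + 2)) * q1 + (P - 2) * ((P - 1) * P * (P + 1)) * (w - s)
        + (P - 3) * ((P - 2) * (P - 1) * P) * (s - q1))
     - (6 * P * s1 + P * (P ^ 2 - 1) * u + 8 * q * P * q1)
     = 3 * (1 - P) * (P * e) - 8 * P * (q * P * (P * q1)) - (P - 2) * (P ^ 2 - 1) * (q * P * (w - s))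
       - (P - 3) * (P - 1) * (P - 2) * (q * P * s)" for P q s1 u q1 e w s :: rat
    by (simp add: algebra_simps power2_eq_square)
  have "6 * (S 1 (p * q) - ((n 1 * S 1 q + n 2 * S 2 q + n 3 * S 3 q)
     - ?q * ((?P - 1) * n 1 * Q 1 q + (?P - 2) * n 2 * Q 2 q + (?P - 3) * n 3 * Q 3 q))) \<in> J (r + 2)"
    using S1_lift[OF r] unfolding n_def q_def by (intro J_mult_left[OF J_numeral])
  also have "6 * (S 1 (p * q) - ((n 1 * S 1 q + n 2 * S 2 q + n 3 * S 3 q)
     - ?q * ((?P - 1) * n 1 * Q 1 q + (?P - 2) * n 2 * Q 2 q + (?P - 3) * n 3 * Q 3 q)))
    = 6 * S 1 (p * q) - (((6 * n 1) * S 1 q + (6 * n 2) * S 2 q + (6 * n 3) * S 3 q)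
      - ?q * ((?P - 1) * (6 * n 1) * Q 1 q + (?P - 2) * (6 * n 2) * Q 2 q + (?P - 3) * (6 * n 3) * Q 3 q))"
    by (simp add: algebra_simps)
  finally have A: "6 * S 1 (p * q) - (((6 * n 1) * S 1 q + (6 * n 2) * S 2 q + (6 * n 3) * S 3 q)
      - ?q * ((?P - 1) * (6 * n 1) * Q 1 q + (?P - 2) * (6 * n 2) * Q 2 q + (?P - 3) * (6 * n 3) * Q 3 q)) \<in> J (r + 2)" .
  have B: "((6 * n 1) * S 1 q + (6 * n 2) * S 2 q + (6 * n 3) * S 3 q)
      - ?q * ((?P - 1) * (6 * n 1) * Q 1 q + (?P - 2) * (6 * n 2) * Q 2 q + (?P - 3) * (6 * n 3) * Q 3 q)
     - (6 * ?P * S 1 q + ?P * (?P ^ 2 - 1) * U q + 8 * ?q * ?P * Q 1 q) \<in> J (r + 2)"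
    unfolding S2 Q2 Q3 S3 n id
  proof -
    have 1: "?P * \<rho> \<in> J (r + 2)" using J_mult[OF J_p \<rho>] by simp
    have qP: "?q * ?P * x \<in> J (r + 2)" if "x \<in> J 1" for x
      using J_mult[OF J_mult[OF q(3) J_p] that] by (simp add: add.assoc)
    have 2: "?q * ?P * (?P * Q 1 q) \<in> J (r + 2)" by (intro qP J_mult_right[OF _ J_p] J_Q)
    have 3: "?q * ?P * (W q - \<sigma>) \<in> J (r + 2)" by (intro qP J_diff \<sigma>) (use W in \<open>simp add: q_def\<close>)
    have 4: "?q * ?P * \<sigma> \<in> J (r + 2)" by (intro qP \<sigma>)
    show "3 * (1 - ?P) * (?P * \<rho>) - 8 * ?P * (?q * ?P * (?P * Q 1 q)) - (?P - 2) * (?P ^ 2 - 1) * (?q * ?P * (W q - \<sigma>))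
       - (?P - 3) * (?P - 1) * (?P - 2) * (?q * ?P * \<sigma>) \<in> J (r + 2)"
      by (intro J_diff[of _ "r + 2"] J_mult_left[OF _ 1] J_mult_left[OF _ 2] J_mult_left[OF _ 3] J_mult_left[OF _ 4]
          J_mult_left[of _ _ 0] J_diff[of _ 0] J_numeral J_of_nat J_1 J_power)
  qed
  show ?thesis by (rule J_trans[OF A B])
qed

lemma W_prime_power: "W (p ^ Suc r) \<in> J 1"
  using W_p W_lift[of "p ^ r"] p_pos by (cases r) auto

lemma Q1_prime_power: "r \<ge> 2 \<Longrightarrow> Q 1 (p ^ r) \<in> J 1"
  using Q1_lift[of "p ^ (r - 1)"] p_pos by (cases r) auto

lemma J_U: "U q \<in> J 0"
  unfolding U_def by (intro J_qsum J_V; assumption)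

text \<open>Starting from integrality of \<open>U p\<close>, one lift already gives
  \<open>J 3\<close>; each further lift raises the order by one.\<close>

lemma U_prime_power: "U (p ^ (r + 2)) \<in> J (r + 3)"
proof (induction r)
  case 0
  show ?case using U_lift[of 1] J_U by (simp add: power2_eq_square eval_nat_numeral)
next
  case (Suc r)
  show ?case using U_lift[of "r + 2"] J_mono[OF Suc] by (simp add: eval_nat_numeral)
qed

text \<open>From exponent 2 on, the terms with \<open>U\<close> and \<open>Q 1\<close> in
  \<open>S1_lift_simplified\<close> vanish to the required order, so each lift multiplies
  \<open>S 1\<close> by \<open>p\<close>.\<close>

lemma S1_prime_power: "S 1 (p ^ (r + 2)) - of_nat p ^ r * S 1 (p ^ 2) \<in> J (r + 3)"
proof (induction r)
  case (Suc r)
  let ?P = "of_nat p :: rat" and ?q = "p ^ (r + 2)"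
  have 1: "6 * S 1 (p * ?q) - (6 * ?P * S 1 ?q + ?P * (?P ^ 2 - 1) * U ?q + 8 * of_nat ?q * ?P * Q 1 ?q) \<in> J (r + 4)"
    using S1_lift_simplified[of "r + 2"] W_prime_power[of "r + 1"] Q1_prime_power[of "r + 2"]
    by (simp add: eval_nat_numeral)
  have 2: "?P * (?P ^ 2 - 1) * U ?q \<in> J (1 + (r + 3))"
    by (intro J_mult[OF _ U_prime_power] J_mult_right[OF _ J_p] J_diff J_power J_of_nat J_1)
  have 3: "8 * of_nat ?q * ?P * Q 1 ?q \<in> J (r + 2 + 1 + 1)"
    by (intro J_mult[OF _ Q1_prime_power] J_mult[OF _ J_p] J_mult_left[OF J_numeral])
       (use J_p_power[of "r + 2"] in simp_all)
  have 4: "?P * (S 1 ?q - ?P ^ r * S 1 (p ^ 2)) \<in> J (1 + (r + 3))"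
    by (rule J_mult[OF J_p Suc])
  have "of_nat 6 * (S 1 (p ^ (Suc r + 2)) - ?P ^ Suc r * S 1 (p ^ 2)) =
    (6 * S 1 (p * ?q) - (6 * ?P * S 1 ?q + ?P * (?P ^ 2 - 1) * U ?q + 8 * of_nat ?q * ?P * Q 1 ?q))
    + ?P * (?P ^ 2 - 1) * U ?q + 8 * of_nat ?q * ?P * Q 1 ?q + 6 * (?P * (S 1 ?q - ?P ^ r * S 1 (p ^ 2)))"
    by (simp add: algebra_simps)
  also have "\<dots> \<in> J (r + 4)"
    by (intro J_add[of _ "r + 4"] J_mult_left[OF J_numeral]) (use 1 2 3 4 in \<open>simp_all add: eval_nat_numeral\<close>)
  finally show ?case using J_cancel[OF coprime_6] by (simp add: eval_nat_numeral)
qed (simp add: power2_eq_square)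

text \<open>Modulo p^2, \<open>S 1 p\<close>, \<open>U p\<close> and \<open>8 * p * Q 1 p\<close>
  are \<open>- 12\<close>, \<open>- 6\<close> and \<open>30\<close> times \<open>H 4 p\<close>. The
  lift gives \<open>6 * S 1 (p^2)\<close> \<equiv> \<open>(- 72 + 6 + 30) * p * H 4 p\<close> modulo
  p^3, and \<open>H_bernoulli\<close> finishes.\<close>

lemma S1_square:
  assumes "p \<ge> 7" shows "5 * S 1 (p ^ 2) + 24 * of_nat (p ^ 2) * bernoulli (p - 5) \<in> J 3"
proof -
  let ?P = "of_nat p :: rat"
  have c5: "coprime 5 p" using coprime_small[of 5] assms by simp
  have "coprime (6 * 5) p" using coprime_6 c5 by (simp only: coprime_mult_left_iff)
  hence c30: "coprime 30 p" by simp
  have c15: "coprime 15 p" using coprime_3 c5 coprime_mult_left_iff[of 3 5 p] by simp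
  have H5: "5 * H 4 p - 4 * (?P * bernoulli (p - 5)) \<in> J 2"
    using H_bernoulli[of 4] assms c15 by simp
  have E1: "S 1 p + 12 * H 4 p \<in> J 2" by (rule S1_H4)
  have E4: "30 * H 4 p - 4 * ?P * Phi 5 \<in> J 2" using H_double[of 4] by simp
  have "of_nat 30 * (U p + 6 * H 4 p) = (30 * U p + 24 * ?P * Phi 5) + 6 * (30 * H 4 p - 4 * ?P * Phi 5)"
    by simp
  also have "\<dots> \<in> J 2" by (intro J_add U_double J_mult_left[OF J_numeral] E4)
  finally have E2: "U p + 6 * H 4 p \<in> J 2" by (rule J_cancel[OF c30])
  \<comment> \<open>\<open>W p\<close> and the reflection sum \<open>Q 3 p + Q 1 p\<close> vanish
    modulo \<open>p\<close>; this combination removes \<open>Q 2 p\<close> and \<open>Q 3 p\<close>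
    from \<open>M_double\<close>.\<close>
  have "of_nat 30 * (2 * Q 1 p - Phi 5) = 60 * W p + 30 * (Q 3 p + Q 1 p) - (30 * (Q 1 p + 2 * Q 2 p + 3 * Q 3 p) + 30 * Phi 5)"
    using W_eq p_pos by simp
  also have "\<dots> \<in> J 1"
    by (intro J_diff[of _ 1] J_add[of _ 1] M_double J_mult_left[OF J_numeral W_p] J_mult_left[OF J_numeral Q_reflect] dvd_refl)
  finally have E3: "2 * Q 1 p - Phi 5 \<in> J 1" by (rule J_cancel[OF c30])
  have E3': "?P * (2 * Q 1 p - Phi 5) \<in> J 2" by (rule J_mult_J1[OF J_p E3])
  have L: "6 * S 1 (p ^ 2) - (6 * ?P * S 1 p + ?P * (?P ^ 2 - 1) * U p + 8 * ?P * ?P * Q 1 p) \<in> J 3"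
    using S1_lift_simplified[of 1] W_p assms by (simp add: power2_eq_square eval_nat_numeral)
  have 1: "?P ^ 3 * U p \<in> J 3" by (intro J_mult_right[OF _ J_p_power] J_U)
  let ?X = "6 * (S 1 p + 12 * H 4 p) - (U p + 6 * H 4 p) + 4 * (?P * (2 * Q 1 p - Phi 5)) - (30 * H 4 p - 4 * ?P * Phi 5)"
  have "?X \<in> J 2"
    by (intro J_add[of _ 2] J_diff[of _ 2] J_mult_left[OF J_numeral] E1 E2 E3' E4)
  hence 2: "?P * ?X \<in> J 3" by (rule J_mono[OF J_mult[OF J_p]]) simp
  have "of_nat 6 * (S 1 (p ^ 2) + 6 * ?P * H 4 p) =
    (6 * S 1 (p ^ 2) - (6 * ?P * S 1 p + ?P * (?P ^ 2 - 1) * U p + 8 * ?P * ?P * Q 1 p)) + ?P ^ 3 * U p + ?P * ?X"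
    by (simp add: algebra_simps power2_eq_square power3_eq_cube)
  also have "\<dots> \<in> J 3" by (intro J_add[of _ 3] L 1 2)
  finally have A: "S 1 (p ^ 2) + 6 * ?P * H 4 p \<in> J 3" by (rule J_cancel[OF coprime_6])
  have B: "?P * (5 * H 4 p - 4 * (?P * bernoulli (p - 5))) \<in> J 3"
    using J_mult[OF J_p H5] by (simp add: eval_nat_numeral)
  from J_diff[OF J_mult_left[OF J_numeral[of "num.Bit1 (num.Bit0 num.One)"] A] J_mult_left[OF J_numeral[of "num.Bit0 (num.Bit1 num.One)"] B]]
  show ?thesis by (simp add: algebra_simps power2_eq_square)
qed

text \<open>For \<open>p \<ge> 7\<close> the factor 5 is cancelled; for \<open>p = 5\<close>, where
  it is not invertible, the explicit value of \<open>S 1 25\<close> and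
  \<open>bernoulli 0 = 1\<close> are used.\<close>

lemma S1_square_div5: "S 1 (p ^ 2) + 24 / 5 * of_nat (p ^ 2) * bernoulli (p - 5) \<in> J 3"
proof (cases "p \<ge> 7")
  case True
  have "coprime 5 p" using coprime_small[of 5] True by simp
  moreover have "of_nat 5 * (S 1 (p ^ 2) + 24 / 5 * of_nat (p ^ 2) * bernoulli (p - 5)) \<in> J 3"
    using S1_square[OF True] by (simp add: algebra_simps)
  ultimately show ?thesis by (rule J_cancel)
next
  case False
  have "p \<noteq> 6" using prime_p by (auto simp: prime_nat_iff dest: spec[of _ 2])
  hence "p = 5" using False p_ge5 by simp
  moreover have "bernoulli 0 = 1" by (subst bernoulli_rec) simp
  ultimately show ?thesis using S1_25 by simp
qed

lemma sum_tuples4_cong: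
  assumes "r \<ge> 2"
  shows "(\<Sum>xs\<in>tuples p 4 (p ^ r). 1 / of_nat (prod_list xs)) + 24 / 5 * of_nat (p ^ r) * bernoulli (p - 5) \<in> J (r + 1)"
proof -
  obtain s where s: "r = s + 2" using assms by (metis add.commute le_Suc_ex)
  have "of_nat p ^ s * (S 1 (p ^ 2) + 24 / 5 * of_nat (p ^ 2) * bernoulli (p - 5)) \<in> J (s + 3)"
    by (rule J_p_power_mult[OF S1_square_div5])
  from J_add[OF S1_prime_power[of s] this]
  have "S 1 (p ^ r) + 24 / 5 * of_nat (p ^ r) * bernoulli (p - 5) \<in> J (r + 1)"
    unfolding s by (simp add: algebra_simps power2_eq_square eval_nat_numeral)
  moreover have "(\<Sum>xs\<in>tuples p 4 (p ^ r). 1 / of_nat (prod_list xs)) = S 1 (p ^ r)"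
    unfolding sum_tuples4 S_def V_def by (simp add: mult_ac)
  ultimately show ?thesis by simp
qed

end

theorem theorem1p1:
  fixes n r p :: nat
  assumes "n = 2 \<or> n = 4"
    and "r > 0" and "real r \<ge> real n / 2"
    and "prime p" and "p \<ge> 5"
  shows "rat_cong
           (\<Sum>xs \<in> tuples p n (p ^ r). 1 / of_nat (prod_list xs))
           (- (fact n / of_nat (n + 1)) * of_nat (p ^ r) * bernoulli (p - n - 1))
           p (r + 1)"
proof -
  interpret prime_ge5 p by unfold_locales (use assms in auto)
  show ?thesis
  proof (cases "n = 2")
    case True
    thus ?thesis using sum_tuples2_cong[of r] assms
      by (simp add: rat_cong_iff_J numeral_3_eq_3)
  next
    case False
    hence n: "n = 4" using assms by simp
    hence "r \<ge> 2" using assms by simp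
    from sum_tuples4_cong[OF this] show ?thesis
      unfolding n by (simp add: rat_cong_iff_J fact_numeral)
  qed
qed

end
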